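(* Let $(\mathcal{J}\lhd\mathcal{A},\mathcal{H},\mathcal{D},n)$ be an even relative spectral triple with Clifford normal for $J\lhd A$ such that the $C^*$-algebra $A$ is unital and represented non-degenerately on $\mathcal{H}$. The even operator $\mathcal{K}:\mathfrak{H}_n^{-1/2}\to\mathcal{H}$ defined by $$\langle\mathcal{K}f,v\rangle_{\mathcal{H}}=\langle f,[nr_1\widetilde{\mathcal{D}}^{-1}e_1v]\rangle_n\qquad\forall v\in\mathcal{H}$$ is well defined and continuous, and its range is $\ker(\mathcal{D})^\perp\subset\ker(\mathcal{D}^* )$ (the orthogonal complement of $\ker(\mathcal{D})$ in $\ker(\mathcal{D}^* )$). The even continuous operator $$P_C:\mathfrak{H}_n^{-1/2}\to\mathfrak{H}_n^{-1/2},\qquad P_C:=R\circ\mathcal{K},$$ is a (not necessarily self-adjoint) idempotent with range $\mathfrak{H}_C^{-1/2}$. The continuous operators $\mathcal{K}$ and $P_C$ depend only on the normal structure.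
   Context: Graded commutator: $[a,b]_\pm=ab-(-1)^{|a||b|}ba$. Inner products are linear in the second variable. $A$ is a separable $\mathbb{Z}/2$-graded $C^*$-algebra and $J\lhd A$ a graded ideal. An even relative spectral triple $(\mathcal{J}\lhd\mathcal{A},\mathcal{H},\mathcal{D})$ for $J\lhd A$ consists of an even representation of $A$ on a $\mathbb{Z}/2$-graded separable Hilbert space $\mathcal{H}$ (grading $\gamma$), an odd closed symmetric operator $\mathcal{D}$, and dense $*$-subalgebras $\mathcal{J}\subseteq J$, $\mathcal{A}\subseteq A$, $\mathcal{J}$ an ideal in $\mathcal{A}$, such that: (1) $a\,\mathrm{Dom}(\mathcal{D})\subset\mathrm{Dom}(\mathcal{D})$ and $[\mathcal{D},a]_\pm$ is bounded for $a\in\mathcal{A}$; (2) $j\,\mathrm{Dom}(\mathcal{D}^* )\subset\mathrm{Dom}(\mathcal{D})$ for $j\in\mathcal{J}$; (3) $a(1+\mathcal{D}^*\mathcal{D})^{-1/2}$ and (4) $a(1-P_{\ker\mathcal{D}^*})(1+\mathcal{D}\mathcal{D}^* )^{-1/2}$ are compact for $a\in\mathcal{A}$. A Clifford normal is an odd $n\in\mathbb{B}(\mathcal{H})$ such that: 1) $n\,\mathrm{Dom}(\mathcal{D})\subset\mathrm{Dom}(\mathcal{D})$ and $\mathrm{Dom}(n):=\mathrm{Dom}(\mathcal{D}^* )\cap n\,\mathrm{Dom}(\mathcal{D}^* )$ is a core for $\mathcal{D}^*$; 2) $n^*=-n$; 3) $[\mathcal{D}^*,n]$ is a densely defined symmetric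 operator on $\mathcal{H}$; 4) $[n,a]_\pm\mathrm{Dom}(n)\subset\mathrm{Dom}(\mathcal{D})$ for $a\in\mathcal{A}$; 5) $(n^2+1)\mathrm{Dom}(n)\subset\mathrm{Dom}(\mathcal{D})$; 6) $\langle\xi,\mathcal{D}^*n\xi\rangle-\langle\mathcal{D}^*\xi,n\xi\rangle\ge0$ for $\xi\in\mathrm{Dom}(n)$; 7) for $w,z\in\mathrm{Dom}(\mathcal{D}^* )$, if $\langle w,\mathcal{D}^*n\xi\rangle-\langle\mathcal{D}^*w,n\xi\rangle=-\langle z,\mathcal{D}^*\xi\rangle+\langle\mathcal{D}^*z,\xi\rangle$ for all $\xi\in\mathrm{Dom}(n)$, then $w+nz\in\mathrm{Dom}(\mathcal{D})$. Two Clifford normals $n,n'$ are equivalent if $n-n'$ extends by continuity in the graph norm to a continuous operator $\mathrm{Dom}(\mathcal{D}^* )\to\mathrm{Dom}(\mathcal{D})$; an equivalence class is a normal structure. $\mathfrak{H}_n^{1/2}:=\mathrm{Dom}(n)/\mathrm{Dom}(\mathcal{D})$ and $\check{\mathfrak{H}}:=\mathrm{Dom}(\mathcal{D}^* )/\mathrm{Dom}(\mathcal{D})$ are Hilbert spaces with the graph norms of $n$ (as a densely defined operator on $\mathrm{Dom}(\mathcal{D}^* )$) and of $\mathcal{D}^*$; $[\xi]$ denotes a class. $\omega_{\mathcal{D}^*}([\xi],[\eta])=\langle\xi,\mathcal{D}^*\eta\rangle-\langle\mathcal{D}^*\xi,\eta\rangle$ on $\check{\mathfrak{H}}$; $\langle[\xi],[\eta]\rangle_n:=\omega_{\mathcal{D}^*}([\xi],[n\eta])$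 for $[\xi]\in\check{\mathfrak{H}}$, $[\eta]\in\mathfrak{H}_n^{1/2}$. $\mathfrak{H}_n^{-1/2}$ is the dual of $\mathfrak{H}_n^{1/2}$, with pairing $\langle f,\zeta\rangle_n$ (extending $\langle\cdot,\cdot\rangle_n$, antilinear in $f$), and $\check{\mathfrak{H}}\hookrightarrow\mathfrak{H}_n^{-1/2}$ continuously via $\psi\mapsto\langle\psi,\cdot\rangle_n$. $R:\mathrm{Dom}(\mathcal{D}^* )\to\check{\mathfrak{H}}\hookrightarrow\mathfrak{H}_n^{-1/2}$ is the resulting continuous map, and the Cauchy space $\mathfrak{H}_C^{-1/2}$ is the closure of $R(\ker(\mathcal{D}^* ))$ in $\mathfrak{H}_n^{-1/2}$. $\widetilde{\mathcal{H}}=\mathcal{H}\oplus\mathcal{H}$, and $\widetilde{\mathcal{D}}$ is the (self-adjoint) restriction of $\mathcal{D}^*\oplus\mathcal{D}^*$ to $\{(\xi,\eta)\in\mathrm{Dom}(n)\oplus\mathrm{Dom}(n):\eta-n\gamma\xi\in\mathrm{Dom}(\mathcal{D})\}$. As $A$ is unital and non-degenerately represented, $\widetilde{\mathcal{D}}$ is Fredholm with closed range; $\widetilde{\mathcal{D}}^{-1}\in\mathbb{B}(\widetilde{\mathcal{H}})$ is the pseudoinverse, i.e. the extension by zero of the inverse of $\widetilde{\mathcal{D}}:\ker(\widetilde{\mathcal{D}})^\perp\to\ker(\widetilde{\mathcal{D}})^\perp$. $e_1:\mathcal{H}\to\widetilde{\mathcal{H}}$ is the inclusion into the first factor and $r_1:\widetilde{\mathcal{H}}\to\mathcal{H}$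 the projection onto the first factor.
   Formalization: The formula for K carries a minus sign, since with the printed sign P_C² = −P_C whenever ker(D* ) ≠ ker(D); and Dom(n) is read as the ξ in Dom(D* ) with nξ in Dom(D* ). *)

theory Defs
  imports "HOL-Analysis.Analysis"
begin

section \<open>Complex Hilbert spaces and C*-algebras\<close>

class scaleC = scaleR +
  fixes scaleC :: "complex \<Rightarrow> 'a \<Rightarrow> 'a" (infixr "*\<^sub>C" 75)

class complex_vector = real_vector + scaleC +
  assumes scaleC_add_right: "c *\<^sub>C (x + y) = c *\<^sub>C x + c *\<^sub>C y"
    and scaleC_add_left: "(c + d) *\<^sub>C x = c *\<^sub>C x + d *\<^sub>C x"
    and scaleC_scaleC: "c *\<^sub>C d *\<^sub>C x = (c * d) *\<^sub>C x"
    and scaleC_of_real: "complex_of_real r *\<^sub>C x = r *\<^sub>R x"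

text \<open>Inner products are antilinear in the first and linear in the second variable. The norm is
  the one of the underlying real inner product space, \<open>(norm x)\<^sup>2 = inner x x = Re (cinner x x)\<close>.\<close>

class complex_hilbert = complex_vector + real_inner + complete_space +
  fixes cinner :: "'a \<Rightarrow> 'a \<Rightarrow> complex"
  assumes cinner_commute: "cinner x y = cnj (cinner y x)"
    and cinner_add_right: "cinner x (y + z) = cinner x y + cinner x z"
    and cinner_scaleC_right: "cinner x (c *\<^sub>C y) = c * cinner x y"
    and Re_cinner: "Re (cinner x y) = inner x y"

lemma cinner_add_left: "cinner (x + y) z = cinner x z + cinner y z"
  for x y z :: "'a::complex_hilbert"
  by (metis cinner_add_right cinner_commute complex_cnj_add)

lemma cinner_zero_right [simp]: "cinner x 0 = 0" for x :: "'a::complex_hilbert"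
  using cinner_add_right[of x 0 0] by simp

lemma cinner_zero_left [simp]: "cinner 0 x = 0" for x :: "'a::complex_hilbert"
  using cinner_add_left[of 0 0 x] by simp

lemma cinner_diff_left: "cinner (x - y) z = cinner x z - cinner y z"
  for x y z :: "'a::complex_hilbert"
  using cinner_add_left[of "x - y" y z] by simp

lemma cinner_diff_right: "cinner x (y - z) = cinner x y - cinner x z"
  for x y z :: "'a::complex_hilbert"
  using cinner_add_right[of x "y - z" z] by simp

instantiation prod :: (complex_hilbert, complex_hilbert) complex_hilbert
begin
definition scaleC_prod :: "complex \<Rightarrow> 'a \<times> 'b \<Rightarrow> 'a \<times> 'b" where
  "scaleC_prod c x = (c *\<^sub>C fst x, c *\<^sub>C snd x)"
definition cinner_prod :: "'a \<times> 'b \<Rightarrow> 'a \<times> 'b \<Rightarrow> complex" where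
  "cinner_prod x y = cinner (fst x) (fst y) + cinner (snd x) (snd y)"
instance
proof
  fix x y z :: "'a \<times> 'b" and c d :: complex and r :: real
  show "c *\<^sub>C (x + y) = c *\<^sub>C x + c *\<^sub>C y"
    by (simp add: scaleC_prod_def scaleC_add_right)
  show "(c + d) *\<^sub>C x = c *\<^sub>C x + d *\<^sub>C x"
    by (simp add: scaleC_prod_def scaleC_add_left)
  show "c *\<^sub>C d *\<^sub>C x = (c * d) *\<^sub>C x"
    by (simp add: scaleC_prod_def scaleC_scaleC)
  show "complex_of_real r *\<^sub>C x = r *\<^sub>R x"
    by (simp add: scaleC_prod_def scaleC_of_real scaleR_prod_def)
  show "cinner x y = cnj (cinner y x)"
    by (simp add: cinner_prod_def cinner_commute[of "fst x"] cinner_commute[of "snd x"])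
  show "cinner x (y + z) = cinner x y + cinner x z"
    by (simp add: cinner_prod_def cinner_add_right)
  show "cinner x (c *\<^sub>C y) = c * cinner x y"
    by (simp add: cinner_prod_def scaleC_prod_def cinner_scaleC_right distrib_left)
  show "Re (cinner x y) = inner x y"
    by (simp add: cinner_prod_def Re_cinner inner_prod_def)
qed
end

text \<open>The multiplication is not assumed to have a unit.\<close>

class cstar_algebra = complex_vector + real_normed_algebra + complete_space +
  fixes star :: "'a \<Rightarrow> 'a"
  assumes norm_scaleC: "norm (c *\<^sub>C a) = cmod c * norm a"
    and mult_scaleC_left: "(c *\<^sub>C a) * b = c *\<^sub>C (a * b)"
    and mult_scaleC_right: "a * (c *\<^sub>C b) = c *\<^sub>C (a * b)"
    and star_star: "star (star a) = a"
    and star_add: "star (a + b) = star a + star b"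
    and star_scaleC: "star (c *\<^sub>C a) = cnj c *\<^sub>C star a"
    and star_mult: "star (a * b) = star b * star a"
    and cstar_identity: "norm (star a * a) = (norm a)\<^sup>2"

definition csubspace :: "'a::complex_vector set \<Rightarrow> bool" where
  "csubspace V \<longleftrightarrow> 0 \<in> V \<and> (\<forall>x\<in>V. \<forall>y\<in>V. x + y \<in> V) \<and> (\<forall>c. \<forall>x\<in>V. c *\<^sub>C x \<in> V)"

definition separable_set :: "'a::topological_space set \<Rightarrow> bool" where
  "separable_set X \<longleftrightarrow> (\<exists>S. countable S \<and> S \<subseteq> X \<and> X \<subseteq> closure S)"

definition star_subalgebra :: "'a::cstar_algebra set \<Rightarrow> bool" where
  "star_subalgebra B \<longleftrightarrow> csubspace B \<and> (\<forall>a\<in>B. \<forall>b\<in>B. a * b \<in> B) \<and> (\<forall>a\<in>B. star a \<in> B)"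

text \<open>Two-sided ideal \<open>I\<close> in a subalgebra \<open>B\<close>.\<close>

definition ideal_in :: "'a::cstar_algebra set \<Rightarrow> 'a set \<Rightarrow> bool" where
  "ideal_in I B \<longleftrightarrow> csubspace I \<and> I \<subseteq> B \<and> (\<forall>a\<in>B. \<forall>j\<in>I. a * j \<in> I \<and> j * a \<in> I)"

text \<open>A \<open>\<int>/2\<close>-grading on a C*-algebra is given by its grading automorphism \<open>\<alpha>\<close>:
  \<open>a\<close> is homogeneous of degree \<open>k\<close> iff \<open>\<alpha> a = (-1)\<^sup>k a\<close>.\<close>

definition cstar_grading :: "('a::cstar_algebra \<Rightarrow> 'a) \<Rightarrow> bool" where
  "cstar_grading \<alpha> \<longleftrightarrow>
     (\<forall>a b. \<alpha> (a + b) = \<alpha> a + \<alpha> b) \<and> (\<forall>c a. \<alpha> (c *\<^sub>C a) = c *\<^sub>C \<alpha> a) \<and>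
     (\<forall>a b. \<alpha> (a * b) = \<alpha> a * \<alpha> b) \<and> (\<forall>a. \<alpha> (star a) = star (\<alpha> a)) \<and> (\<forall>a. \<alpha> (\<alpha> a) = a)"

section \<open>Bounded and unbounded operators\<close>

definition bounded_clinear :: "('a::complex_hilbert \<Rightarrow> 'b::complex_hilbert) \<Rightarrow> bool" where
  "bounded_clinear T \<longleftrightarrow> bounded_linear T \<and> (\<forall>c x. T (c *\<^sub>C x) = c *\<^sub>C T x)"

definition compact_op :: "('a::complex_hilbert \<Rightarrow> 'b::complex_hilbert) \<Rightarrow> bool" where
  "compact_op T \<longleftrightarrow> bounded_clinear T \<and> compact (closure (T ` cball 0 1))"

definition ortho_compl :: "'a::complex_hilbert set \<Rightarrow> 'a set" where
  "ortho_compl V = {x. \<forall>v\<in>V. cinner v x = 0}"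

definition ortho_proj :: "'a::complex_hilbert set \<Rightarrow> 'a \<Rightarrow> 'a" where
  "ortho_proj V x = (THE p. p \<in> V \<and> x - p \<in> ortho_compl V)"

definition hilbert_grading :: "('h::complex_hilbert \<Rightarrow> 'h) \<Rightarrow> bool" where
  "hilbert_grading \<gamma> \<longleftrightarrow>
     bounded_clinear \<gamma> \<and> (\<forall>x. \<gamma> (\<gamma> x) = x) \<and> (\<forall>x y. cinner (\<gamma> x) y = cinner x (\<gamma> y))"

text \<open>A partially defined operator is a domain together with a function; the values of the function
  outside the domain are irrelevant.\<close>

datatype 'h operator = Operator (Dom: "'h set") (app: "'h \<Rightarrow> 'h")

notation app (infixr "\<cdot>" 78)

definition graph_of :: "'h operator \<Rightarrow> ('h \<times> 'h) set" where
  "graph_of T = {(\<xi>, T \<cdot> \<xi>) | \<xi>. \<xi> \<in> Dom T}"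

definition op_linear :: "'h::complex_hilbert operator \<Rightarrow> bool" where
  "op_linear T \<longleftrightarrow> csubspace (Dom T) \<and>
     (\<forall>\<xi>\<in>Dom T. \<forall>\<eta>\<in>Dom T. T \<cdot> (\<xi> + \<eta>) = T \<cdot> \<xi> + T \<cdot> \<eta>) \<and>
     (\<forall>c. \<forall>\<xi>\<in>Dom T. T \<cdot> (c *\<^sub>C \<xi>) = c *\<^sub>C T \<cdot> \<xi>)"

definition op_symmetric :: "'h::complex_hilbert operator \<Rightarrow> bool" where
  "op_symmetric T \<longleftrightarrow> op_linear T \<and> closure (Dom T) = UNIV \<and>
     (\<forall>\<xi>\<in>Dom T. \<forall>\<eta>\<in>Dom T. cinner (T \<cdot> \<xi>) \<eta> = cinner \<xi> (T \<cdot> \<eta>))"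

definition op_closed :: "'h::complex_hilbert operator \<Rightarrow> bool" where
  "op_closed T \<longleftrightarrow> closed (graph_of T)"

definition adj :: "'h::complex_hilbert operator \<Rightarrow> 'h operator" where
  "adj T = Operator {\<eta>. \<exists>\<zeta>. \<forall>\<xi>\<in>Dom T. cinner \<zeta> \<xi> = cinner \<eta> (T \<cdot> \<xi>)}
                    (\<lambda>\<eta>. THE \<zeta>. \<forall>\<xi>\<in>Dom T. cinner \<zeta> \<xi> = cinner \<eta> (T \<cdot> \<xi>))"

definition op_comp :: "'h operator \<Rightarrow> 'h operator \<Rightarrow> 'h operator" where
  "op_comp S T = Operator {\<xi>\<in>Dom T. T \<cdot> \<xi> \<in> Dom S} (\<lambda>\<xi>. S \<cdot> T \<cdot> \<xi>)"

definition op_diff :: "'h::minus operator \<Rightarrow> 'h operator \<Rightarrow> 'h operator" where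
  "op_diff S T = Operator (Dom S \<inter> Dom T) (\<lambda>\<xi>. S \<cdot> \<xi> - T \<cdot> \<xi>)"

definition everywhere :: "('h \<Rightarrow> 'h) \<Rightarrow> 'h operator" where
  "everywhere b = Operator UNIV b"

definition one_plus :: "'h::plus operator \<Rightarrow> 'h operator" where
  "one_plus T = Operator (Dom T) (\<lambda>\<xi>. \<xi> + T \<cdot> \<xi>)"

definition ker :: "'h::zero operator \<Rightarrow> 'h set" where
  "ker T = {\<xi>\<in>Dom T. T \<cdot> \<xi> = 0}"

definition odd_op :: "('h::complex_hilbert \<Rightarrow> 'h) \<Rightarrow> 'h operator \<Rightarrow> bool" where
  "odd_op \<gamma> T \<longleftrightarrow> (\<forall>\<xi>\<in>Dom T. \<gamma> \<xi> \<in> Dom T \<and> T \<cdot> \<gamma> \<xi> = - \<gamma> (T \<cdot> \<xi>))"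

text \<open>\<open>is_inv_sqrt M S\<close> says \<open>S = M\<^sup>-\<^sup>1\<^sup>/\<^sup>2\<close>: the (unique) bounded positive operator \<open>S\<close> whose square
  is a two-sided inverse of \<open>M : Dom M \<rightarrow> H\<close>. It is used for \<open>M = 1 + D*D\<close> and \<open>M = 1 + DD*\<close>.\<close>

definition is_inv_sqrt :: "'h::complex_hilbert operator \<Rightarrow> ('h \<Rightarrow> 'h) \<Rightarrow> bool" where
  "is_inv_sqrt M S \<longleftrightarrow> bounded_clinear S \<and> (\<forall>x. cinner x (S x) \<in> \<real>\<^sub>\<ge>\<^sub>0) \<and>
     (\<forall>x. S (S x) \<in> Dom M \<and> M \<cdot> S (S x) = x) \<and> (\<forall>\<xi>\<in>Dom M. S (S (M \<cdot> \<xi>)) = \<xi>)"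

text \<open>The extension by zero of the inverse of \<open>T : (ker T)\<^sup>\<bottom> \<rightarrow> (ker T)\<^sup>\<bottom>\<close>, for \<open>T\<close> self-adjoint with
  closed range.\<close>

definition pseudoinverse :: "'h::complex_hilbert operator \<Rightarrow> 'h \<Rightarrow> 'h" where
  "pseudoinverse T v =
     (THE \<zeta>. \<zeta> \<in> Dom T \<inter> ortho_compl (ker T) \<and> T \<cdot> \<zeta> = v - ortho_proj (ker T) v)"

section \<open>Relative spectral triples\<close>

definition even_representation ::
  "('a::cstar_algebra \<Rightarrow> 'a) \<Rightarrow> ('h::complex_hilbert \<Rightarrow> 'h) \<Rightarrow> ('a \<Rightarrow> 'h \<Rightarrow> 'h) \<Rightarrow> bool" where
  "even_representation \<alpha> \<gamma> \<pi> \<longleftrightarrow>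
     (\<forall>a. bounded_clinear (\<pi> a)) \<and>
     (\<forall>a b x. \<pi> (a + b) x = \<pi> a x + \<pi> b x) \<and> (\<forall>c a x. \<pi> (c *\<^sub>C a) x = c *\<^sub>C \<pi> a x) \<and>
     (\<forall>a b x. \<pi> (a * b) x = \<pi> a (\<pi> b x)) \<and>
     (\<forall>a x y. cinner (\<pi> (star a) x) y = cinner x (\<pi> a y)) \<and>
     (\<forall>a x. \<pi> (\<alpha> a) x = \<gamma> (\<pi> a (\<gamma> x)))"

definition nondegenerate :: "('a \<Rightarrow> 'h::complex_hilbert \<Rightarrow> 'h) \<Rightarrow> bool" where
  "nondegenerate \<pi> \<longleftrightarrow> closure (span {\<pi> a x | a x. True}) = UNIV"

text \<open>For an odd operator \<open>T\<close> and \<open>a = a\<^sub>0 + a\<^sub>1\<close> with \<open>a\<^sub>0\<close> even and \<open>a\<^sub>1\<close> odd, the bilinear extension of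
  the graded commutator is \<open>[T, a]\<^sub>\<plusminus> = T a - (a\<^sub>0 - a\<^sub>1) T = T a - \<alpha>(a) T\<close>.\<close>

definition gcomm :: "('a \<Rightarrow> 'a) \<Rightarrow> ('a \<Rightarrow> 'h::complex_hilbert \<Rightarrow> 'h) \<Rightarrow> 'h operator \<Rightarrow> 'a \<Rightarrow> 'h operator" where
  "gcomm \<alpha> \<pi> T a = op_diff (op_comp T (everywhere (\<pi> a))) (op_comp (everywhere (\<pi> (\<alpha> a))) T)"

locale even_relative_spectral_triple =
  fixes \<alpha> :: "'a::cstar_algebra \<Rightarrow> 'a"
    and J :: "'a set"
    and \<J> \<A> :: "'a set"
    and \<pi> :: "'a \<Rightarrow> 'h::complex_hilbert \<Rightarrow> 'h"
    and \<gamma> :: "'h \<Rightarrow> 'h"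
    and D :: "'h operator"
  assumes separable_A: "separable_set (UNIV :: 'a set)"
    and grading_A: "cstar_grading \<alpha>"
    and ideal_J: "ideal_in J UNIV" "closed J"
    and graded_J: "\<alpha> ` J \<subseteq> J"
    and separable_H: "separable_set (UNIV :: 'h set)"
    and grading_H: "hilbert_grading \<gamma>"
    and representation: "even_representation \<alpha> \<gamma> \<pi>"
    and D_odd: "odd_op \<gamma> D"
    and D_closed: "op_closed D"
    and D_symmetric: "op_symmetric D"
    and dense_A: "star_subalgebra \<A>" "closure \<A> = UNIV"
    and dense_J: "star_subalgebra \<J>" "closure \<J> = J"
    and ideal_in_A: "ideal_in \<J> \<A>"
    and preserves_Dom: "a \<in> \<A> \<Longrightarrow> \<pi> a ` Dom D \<subseteq> Dom D"
    and bounded_commutator: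
      "a \<in> \<A> \<Longrightarrow> \<exists>C. \<forall>\<xi>\<in>Dom (gcomm \<alpha> \<pi> D a). norm (gcomm \<alpha> \<pi> D a \<cdot> \<xi>) \<le> C * norm \<xi>"
    and ideal_Dom: "j \<in> \<J> \<Longrightarrow> \<pi> j ` Dom (adj D) \<subseteq> Dom D"
    and compact_resolvent:
      "a \<in> \<A> \<Longrightarrow> \<exists>S. is_inv_sqrt (one_plus (op_comp (adj D) D)) S \<and> compact_op (\<pi> a \<circ> S)"
    and compact_adjoint_resolvent:
      "a \<in> \<A> \<Longrightarrow> \<exists>S. is_inv_sqrt (one_plus (op_comp D (adj D))) S \<and>
         compact_op (\<lambda>v. \<pi> a (S v - ortho_proj (ker (adj D)) (S v)))"

section \<open>Clifford normals\<close>

text \<open>\<open>Dom(n) = Dom(D*) \<inter> n Dom(D*)\<close> is the natural domain of \<open>n\<close> as a densely defined operator on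
  \<open>Dom(D*)\<close>; it is also the natural domain of \<open>D*n\<close> and of \<open>[D*,n]\<close>. The set \<open>n Dom(D*)\<close> is thus to be
  read as \<open>{\<xi>. n \<xi> \<in> Dom(D*)}\<close>. For \<open>n\<^sup>2 = -1\<close> this is the image of \<open>Dom(D*)\<close> under \<open>n\<close>, as shown
  below. A Clifford normal satisfies \<open>n\<^sup>2 = -1\<close> only modulo \<open>Dom(D)\<close> and need not be injective or have
  dense range, so that its image need not contain \<open>Dom(D)\<close>.\<close>

definition Dom_n :: "'h::complex_hilbert operator \<Rightarrow> ('h \<Rightarrow> 'h) \<Rightarrow> 'h set" where
  "Dom_n D n = {\<xi>\<in>Dom (adj D). n \<xi> \<in> Dom (adj D)}"

lemma Dom_n_image:
  assumes "\<And>\<xi>. n (n \<xi>) = - \<xi>" "\<And>\<xi>. n (- \<xi>) = - n \<xi>" "\<And>\<xi>. \<xi> \<in> Dom (adj D) \<Longrightarrow> - \<xi> \<in> Dom (adj D)"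
  shows "Dom_n D n = Dom (adj D) \<inter> n ` Dom (adj D)"
proof (intro equalityI subsetI)
  fix \<xi> assume "\<xi> \<in> Dom_n D n"
  moreover have "\<xi> = n (- n \<xi>)"
    by (simp add: assms)
  ultimately show "\<xi> \<in> Dom (adj D) \<inter> n ` Dom (adj D)"
    using assms(3) unfolding Dom_n_def by blast
next
  fix \<xi> assume "\<xi> \<in> Dom (adj D) \<inter> n ` Dom (adj D)"
  then show "\<xi> \<in> Dom_n D n"
    using assms unfolding Dom_n_def by auto
qed

locale clifford_normal = even_relative_spectral_triple \<alpha> J \<J> \<A> \<pi> \<gamma> D
  for \<alpha> :: "'a::cstar_algebra \<Rightarrow> 'a"
    and J :: "'a set"
    and \<J> \<A> :: "'a set"
    and \<pi> :: "'a \<Rightarrow> 'h::complex_hilbert \<Rightarrow> 'h"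
    and \<gamma> :: "'h \<Rightarrow> 'h"
    and D :: "'h operator" +
  fixes n :: "'h \<Rightarrow> 'h"
  assumes n_bounded: "bounded_clinear n"
    and n_odd: "odd_op \<gamma> (everywhere n)"
    and n_Dom: "n ` Dom D \<subseteq> Dom D"
    and n_core: "graph_of (adj D) \<subseteq> closure (graph_of (Operator (Dom_n D n) (app (adj D))))"
    and n_skew: "cinner (n x) y = - cinner x (n y)"
    and n_commutator: "op_symmetric
       (op_diff (op_comp (adj D) (everywhere n)) (op_comp (everywhere n) (adj D)))"
    and n_gcomm: "a \<in> \<A> \<Longrightarrow> \<xi> \<in> Dom_n D n \<Longrightarrow> gcomm \<alpha> \<pi> (everywhere n) a \<cdot> \<xi> \<in> Dom D"
    and n_square: "\<xi> \<in> Dom_n D n \<Longrightarrow> n (n \<xi>) + \<xi> \<in> Dom D"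
    and n_positive: "\<xi> \<in> Dom_n D n \<Longrightarrow>
       cinner \<xi> (adj D \<cdot> n \<xi>) - cinner (adj D \<cdot> \<xi>) (n \<xi>) \<in> \<real>\<^sub>\<ge>\<^sub>0"
    and n_maximal: "w \<in> Dom (adj D) \<Longrightarrow> z \<in> Dom (adj D) \<Longrightarrow>
       (\<And>\<xi>. \<xi> \<in> Dom_n D n \<Longrightarrow>
          cinner w (adj D \<cdot> n \<xi>) - cinner (adj D \<cdot> w) (n \<xi>)
            = - cinner z (adj D \<cdot> \<xi>) + cinner (adj D \<cdot> z) \<xi>) \<Longrightarrow>
       w + n z \<in> Dom D"

definition graph_norm :: "'h::complex_hilbert operator \<Rightarrow> 'h \<Rightarrow> real" where
  "graph_norm T \<xi> = sqrt ((norm \<xi>)\<^sup>2 + (norm (T \<cdot> \<xi>))\<^sup>2)"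

text \<open>As \<open>n - n'\<close> is bounded on the whole Hilbert space, an extension of it by continuity to
  \<open>Dom(D*)\<close> in the (finer) graph norm is again given by \<open>n - n'\<close>. On \<open>Dom(D)\<close> the graph norms of
  \<open>D\<close> and \<open>D*\<close> agree.\<close>

definition normal_equiv :: "'h::complex_hilbert operator \<Rightarrow> ('h \<Rightarrow> 'h) \<Rightarrow> ('h \<Rightarrow> 'h) \<Rightarrow> bool" where
  "normal_equiv D n n' \<longleftrightarrow>
     (\<forall>\<xi>\<in>Dom (adj D). n \<xi> - n' \<xi> \<in> Dom D) \<and>
     (\<exists>C. \<forall>\<xi>\<in>Dom (adj D). graph_norm D (n \<xi> - n' \<xi>) \<le> C * graph_norm (adj D) \<xi>)"

section \<open>Boundary spaces\<close>

text \<open>Elements of quotients by \<open>Dom(D)\<close> are cosets \<open>[\<xi>] = \<xi> + Dom(D)\<close>.\<close>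

definition cls :: "'h::complex_hilbert operator \<Rightarrow> 'h \<Rightarrow> 'h set" where
  "cls D \<xi> = {\<xi> + d | d. d \<in> Dom D}"

definition half_space :: "'h::complex_hilbert operator \<Rightarrow> ('h \<Rightarrow> 'h) \<Rightarrow> 'h set set" where
  "half_space D n = cls D ` Dom_n D n"

text \<open>The graph norm of \<open>n\<close> as an operator on \<open>Dom(D*)\<close>, the latter carrying the graph norm of \<open>D*\<close>,
  and the induced quotient norm on \<open>Dom(n)/Dom(D)\<close>.\<close>

definition graph_norm_n :: "'h::complex_hilbert operator \<Rightarrow> ('h \<Rightarrow> 'h) \<Rightarrow> 'h \<Rightarrow> real" where
  "graph_norm_n D n \<xi> = sqrt ((graph_norm (adj D) \<xi>)\<^sup>2 + (graph_norm (adj D) (n \<xi>))\<^sup>2)"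

definition half_norm :: "'h::complex_hilbert operator \<Rightarrow> ('h \<Rightarrow> 'h) \<Rightarrow> 'h set \<Rightarrow> real" where
  "half_norm D n Z = (INF \<xi>\<in>Z. graph_norm_n D n \<xi>)"

definition \<omega> :: "'h::complex_hilbert operator \<Rightarrow> 'h \<Rightarrow> 'h \<Rightarrow> complex" where
  "\<omega> D \<xi> \<eta> = cinner \<xi> (adj D \<cdot> \<eta>) - cinner (adj D \<cdot> \<xi>) \<eta>"

text \<open>\<open>\<langle>X, Z\<rangle>\<^sub>n\<close> for classes \<open>X\<close> in \<open>Dom(D*)/Dom(D)\<close> and \<open>Z\<close> in \<open>Dom(n)/Dom(D)\<close>, as the common value
  on representatives.\<close>

definition pairing_n :: "'h::complex_hilbert operator \<Rightarrow> ('h \<Rightarrow> 'h) \<Rightarrow> 'h set \<Rightarrow> 'h set \<Rightarrow> complex" where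
  "pairing_n D n X Z = (THE c. \<forall>\<xi>\<in>X. \<forall>\<eta>\<in>Z. c = \<omega> D \<xi> (n \<eta>))"

text \<open>The dual of \<open>Dom(n)/Dom(D)\<close>: bounded linear functionals, extended by zero to sets that are not
  elements of \<open>Dom(n)/Dom(D)\<close>. The pairing \<open>\<langle>f, \<zeta>\<rangle>\<^sub>n\<close> is \<open>f \<zeta>\<close>. It is antilinear in \<open>f\<close> because
  the scalar multiplication on the dual is the conjugate one, \<open>dual_scale\<close>.\<close>

definition dual_space :: "'h::complex_hilbert operator \<Rightarrow> ('h \<Rightarrow> 'h) \<Rightarrow> ('h set \<Rightarrow> complex) set" where
  "dual_space D n = {f.
     (\<forall>\<xi>\<in>Dom_n D n. \<forall>\<eta>\<in>Dom_n D n. f (cls D (\<xi> + \<eta>)) = f (cls D \<xi>) + f (cls D \<eta>)) \<and>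
     (\<forall>c. \<forall>\<xi>\<in>Dom_n D n. f (cls D (c *\<^sub>C \<xi>)) = c * f (cls D \<xi>)) \<and>
     (\<exists>C. \<forall>Z\<in>half_space D n. cmod (f Z) \<le> C * half_norm D n Z) \<and>
     (\<forall>Z. Z \<notin> half_space D n \<longrightarrow> f Z = 0)}"

definition dual_norm :: "'h::complex_hilbert operator \<Rightarrow> ('h \<Rightarrow> 'h) \<Rightarrow> ('h set \<Rightarrow> complex) \<Rightarrow> real" where
  "dual_norm D n f = (SUP Z\<in>{Z\<in>half_space D n. half_norm D n Z \<le> 1}. cmod (f Z))"

definition dual_add :: "('h set \<Rightarrow> complex) \<Rightarrow> ('h set \<Rightarrow> complex) \<Rightarrow> 'h set \<Rightarrow> complex" where
  "dual_add f g = (\<lambda>Z. f Z + g Z)"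

definition dual_scale :: "complex \<Rightarrow> ('h set \<Rightarrow> complex) \<Rightarrow> 'h set \<Rightarrow> complex" where
  "dual_scale c f = (\<lambda>Z. cnj c * f Z)"

text \<open>The grading induced by \<open>\<gamma>\<close>. It extends the grading \<open>[\<xi>] \<mapsto> [\<gamma> \<xi>]\<close> of \<open>Dom(D*)/Dom(D)\<close>, as
  \<open>\<langle>[\<gamma> \<xi>], \<zeta>\<rangle>\<^sub>n = \<langle>[\<xi>], \<gamma> \<zeta>\<rangle>\<^sub>n\<close> because \<open>D\<close> and \<open>n\<close> are odd.\<close>

definition dual_grading :: "('h \<Rightarrow> 'h) \<Rightarrow> ('h set \<Rightarrow> complex) \<Rightarrow> 'h set \<Rightarrow> complex" where
  "dual_grading \<gamma> f = (\<lambda>Z. f (\<gamma> ` Z))"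

definition check_to_dual :: "'h::complex_hilbert operator \<Rightarrow> ('h \<Rightarrow> 'h) \<Rightarrow> 'h set \<Rightarrow> 'h set \<Rightarrow> complex" where
  "check_to_dual D n X = (\<lambda>Z. if Z \<in> half_space D n then pairing_n D n X Z else 0)"

definition R_map :: "'h::complex_hilbert operator \<Rightarrow> ('h \<Rightarrow> 'h) \<Rightarrow> 'h \<Rightarrow> 'h set \<Rightarrow> complex" where
  "R_map D n \<xi> = check_to_dual D n (cls D \<xi>)"

definition cauchy_space :: "'h::complex_hilbert operator \<Rightarrow> ('h \<Rightarrow> 'h) \<Rightarrow> ('h set \<Rightarrow> complex) set" where
  "cauchy_space D n = {f\<in>dual_space D n.
     \<forall>\<epsilon>>0. \<exists>\<kappa>\<in>ker (adj D). dual_norm D n (\<lambda>Z. f Z - R_map D n \<kappa> Z) < \<epsilon>}"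

section \<open>The double, the Poisson operator and the Calderon projector\<close>

definition double_op ::
  "'h::complex_hilbert operator \<Rightarrow> ('h \<Rightarrow> 'h) \<Rightarrow> ('h \<Rightarrow> 'h) \<Rightarrow> ('h \<times> 'h) operator" where
  "double_op D \<gamma> n = Operator
     {(\<xi>, \<eta>). \<xi> \<in> Dom_n D n \<and> \<eta> \<in> Dom_n D n \<and> \<eta> - n (\<gamma> \<xi>) \<in> Dom D}
     (\<lambda>(\<xi>, \<eta>). (adj D \<cdot> \<xi>, adj D \<cdot> \<eta>))"

definition e1 :: "'h \<Rightarrow> 'h \<times> 'h::zero" where
  "e1 v = (v, 0)"

definition r1 :: "'h \<times> 'h \<Rightarrow> 'h" where
  "r1 p = fst p"

text \<open>The vector \<open>n r\<^sub>1 D\<^sup>~\<^sup>-\<^sup>1 e\<^sub>1 v\<close>.\<close>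

definition poisson_vector ::
  "'h::complex_hilbert operator \<Rightarrow> ('h \<Rightarrow> 'h) \<Rightarrow> ('h \<Rightarrow> 'h) \<Rightarrow> 'h \<Rightarrow> 'h" where
  "poisson_vector D \<gamma> n v = n (r1 (pseudoinverse (double_op D \<gamma> n) (e1 v)))"

text \<open>The sign in \<open>\<langle>K f, v\<rangle> = - \<langle>f, [n r\<^sub>1 D\<^sup>~\<^sup>-\<^sup>1 e\<^sub>1 v]\<rangle>\<^sub>n\<close> is forced by \<open>\<langle>[\<xi>], [\<eta>]\<rangle>\<^sub>n = \<omega>([\<xi>], [n \<eta>])\<close>
  and \<open>n\<^sup>2 = -1\<close> modulo \<open>Dom(D)\<close>. If \<open>\<kappa> \<in> ker(D*)\<close> and \<open>\<xi> = r\<^sub>1 D\<^sup>~\<^sup>-\<^sup>1 e\<^sub>1 v\<close>, so that \<open>D* \<xi>\<close> is the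
  component of \<open>v\<close> orthogonal to \<open>ker(D)\<close>, then \<open>\<langle>[\<kappa>], [n \<xi>]\<rangle>\<^sub>n = - \<langle>\<kappa>, D* \<xi>\<rangle>\<close> by the lemma
  \<open>pairing_kernel\<close> below. Hence \<open>K R \<kappa>\<close> is the component of \<open>\<kappa>\<close> orthogonal to \<open>ker(D)\<close>, and \<open>R K\<close> is
  idempotent. With the opposite sign, \<open>K R \<kappa>\<close> would be minus that component, and \<open>R K\<close> would be
  minus an idempotent.\<close>

definition poisson_op ::
  "'h::complex_hilbert operator \<Rightarrow> ('h \<Rightarrow> 'h) \<Rightarrow> ('h \<Rightarrow> 'h) \<Rightarrow> ('h set \<Rightarrow> complex) \<Rightarrow> 'h" where
  "poisson_op D \<gamma> n f = (THE h. \<forall>v. cinner h v = - f (cls D (poisson_vector D \<gamma> n v)))"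

definition calderon_op ::
  "'h::complex_hilbert operator \<Rightarrow> ('h \<Rightarrow> 'h) \<Rightarrow> ('h \<Rightarrow> 'h) \<Rightarrow> ('h set \<Rightarrow> complex) \<Rightarrow> 'h set \<Rightarrow> complex" where
  "calderon_op D \<gamma> n f = R_map D n (poisson_op D \<gamma> n f)"

lemma adj_eq:
  fixes T :: "'h::complex_hilbert operator"
  assumes dense: "closure (Dom T) = UNIV"
    and \<zeta>: "\<And>\<xi>. \<xi> \<in> Dom T \<Longrightarrow> cinner \<zeta> \<xi> = cinner \<eta> (T \<cdot> \<xi>)"
  shows "adj T \<cdot> \<eta> = \<zeta>"
proof -
  have "\<zeta>' = \<zeta>" if \<zeta>': "\<forall>\<xi>\<in>Dom T. cinner \<zeta>' \<xi> = cinner \<eta> (T \<cdot> \<xi>)" for \<zeta>'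
  proof -
    have "Dom T \<subseteq> {\<xi>. inner (\<zeta>' - \<zeta>) \<xi> = 0}"
      using \<zeta> \<zeta>' by (auto simp: cinner_diff_left simp flip: Re_cinner)
    then have "closure (Dom T) \<subseteq> {\<xi>. inner (\<zeta>' - \<zeta>) \<xi> = 0}"
      by (intro closure_minimal closed_hyperplane)
    then have "inner (\<zeta>' - \<zeta>) (\<zeta>' - \<zeta>) = 0"
      using dense by blast
    then show ?thesis by simp
  qed
  then show ?thesis
    unfolding adj_def using \<zeta> by (auto intro!: the_equality)
qed

lemma adj_cinner:
  fixes T :: "'h::complex_hilbert operator"
  assumes "closure (Dom T) = UNIV" "\<eta> \<in> Dom (adj T)" "\<xi> \<in> Dom T"
  shows "cinner (adj T \<cdot> \<eta>) \<xi> = cinner \<eta> (T \<cdot> \<xi>)"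
proof -
  obtain \<zeta> where \<zeta>: "\<forall>\<xi>\<in>Dom T. cinner \<zeta> \<xi> = cinner \<eta> (T \<cdot> \<xi>)"
    using assms(2) unfolding adj_def by auto
  then have "adj T \<cdot> \<eta> = \<zeta>"
    using adj_eq[OF assms(1)] by blast
  then show ?thesis using \<zeta> assms(3) by simp
qed

lemma (in clifford_normal) pairing_kernel:
  assumes \<kappa>: "\<kappa> \<in> ker (adj D)" and \<xi>: "\<xi> \<in> Dom_n D n"
  shows "\<omega> D \<kappa> (n (n \<xi>)) = - cinner \<kappa> (adj D \<cdot> \<xi>)"
proof -
  have dense: "closure (Dom D) = UNIV"
    using D_symmetric unfolding op_symmetric_def by simp
  have \<kappa>': "\<kappa> \<in> Dom (adj D)" "adj D \<cdot> \<kappa> = 0"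
    using \<kappa> unfolding ker_def by auto
  define d where "d = n (n \<xi>) + \<xi>"
  have d: "d \<in> Dom D" using n_square[OF \<xi>] by (simp add: d_def)
  have adj_d: "cinner (D \<cdot> d) \<eta> = cinner d (D \<cdot> \<eta>)" if "\<eta> \<in> Dom D" for \<eta>
    using D_symmetric d that unfolding op_symmetric_def by blast
  have \<xi>': "\<xi> \<in> Dom (adj D)" using \<xi> unfolding Dom_n_def by simp
  have "adj D \<cdot> n (n \<xi>) = D \<cdot> d - adj D \<cdot> \<xi>"
  proof (rule adj_eq[OF dense])
    fix \<eta> assume \<eta>: "\<eta> \<in> Dom D"
    have "cinner (n (n \<xi>)) (D \<cdot> \<eta>) = cinner d (D \<cdot> \<eta>) - cinner \<xi> (D \<cdot> \<eta>)"
      by (simp add: d_def cinner_add_left)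
    then show "cinner (D \<cdot> d - adj D \<cdot> \<xi>) \<eta> = cinner (n (n \<xi>)) (D \<cdot> \<eta>)"
      by (simp add: cinner_diff_left adj_d \<eta> adj_cinner[OF dense \<xi>' \<eta>])
  qed
  moreover have "cinner \<kappa> (D \<cdot> d) = 0"
    using adj_cinner[OF dense \<kappa>'(1) d] \<kappa>'(2) by simp
  ultimately show ?thesis
    by (simp add: \<omega>_def \<kappa>'(2) cinner_diff_right)
qed

end

theory Submission
  imports Defs
begin

text \<open>Write \<open>S\<close> for the adjoint of \<open>D\<close>, and \<open>P\<close> for the projection onto \<open>ker D\<close>. The proof rests on one analytic
  fact: the doubled operator \<open>double_op D \<gamma> n\<close>, called \<open>dbl\<close> below, is self-adjoint and bounded below on
  the orthogonal complement of its kernel \<open>ker D \<times> ker D\<close>. Then \<open>S \<xi> = v - P v\<close> has a solution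
  \<open>\<xi> = doubled_solution v\<close> in \<open>Dom_n D n\<close> that depends continuously on \<open>v\<close>, and the Poisson operator is
  the adjoint of \<open>v \<mapsto> - [n \<xi>]\<close>.

  Self-adjointness is the maximality axiom \<open>n_maximal\<close> in disguise (\<open>self_adjoint_dbl\<close>). For the lower
  bound, two symmetries of \<open>H \<oplus> H\<close> are used, \<open>G(\<xi>, \<eta>) = (\<gamma> \<eta>, \<gamma> \<xi>)\<close> and \<open>E(\<xi>, \<eta>) = (n \<gamma> \<eta>, n \<gamma> \<xi>)\<close>, which
  anticommute. For \<open>p\<close> in the domain of \<open>dbl\<close>, the vector \<open>p - E p\<close> lies in \<open>Dom D \<times> Dom D\<close>, so that the
  boundary condition says that \<open>p\<close> is fixed by \<open>E\<close> up to a vector in a compactly embedded space.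
  The positivity axiom for \<open>n\<close> makes the form \<open>\<langle>dbl y, G x\<rangle> + \<langle>G y, dbl x\<rangle>\<close> positive semidefinite. If \<open>dbl x\<close> is
  small, then the diagonal value at \<open>x\<close> is small, and the Cauchy-Schwarz inequality shows that \<open>G x\<close>
  almost lies in the kernel of \<open>dbl\<close> as well. For a sequence of unit vectors with \<open>dbl x\<^sub>k \<rightarrow> 0\<close>, both \<open>x\<^sub>k - E x\<^sub>k\<close>
  and \<open>G x\<^sub>k - E G x\<^sub>k = G (x\<^sub>k + E x\<^sub>k)\<close> therefore have convergent subsequences, and so does \<open>2 x\<^sub>k\<close>. Its
  limit is a nonzero vector in the kernel, which is absurd if all \<open>x\<^sub>k\<close> are orthogonal to the kernel
  (\<open>lower_bound_by_anticommuting_symmetries\<close>).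

  The compact embedding of \<open>Dom D\<close> comes from the compactness of \<open>a (1 + D*D)\<^sup>-\<^sup>1\<^sup>/\<^sup>2\<close>: the unit of \<open>A\<close> acts as the
  identity, and an element of the dense subalgebra close to the unit has a left inverse in \<open>A\<close>. The estimates in graph
  norms come from the uniform boundedness principle, which shows that \<open>S L\<close> is bounded whenever \<open>L\<close> is
  bounded with range in the domain of \<open>S\<close> (\<open>adj_compose_bounded\<close>).

  The rest is algebra with the boundary form \<open>\<omega>\<close>. Since \<open>n \<xi>\<close> lies in \<open>Dom D\<close> for \<open>v\<close> in the range of
  \<open>D\<close> and for \<open>v\<close> in \<open>ker D\<close>, the Poisson operator \<open>K\<close> takes values in \<open>ker S\<close>, orthogonally to \<open>ker D\<close>. Green's formula
  gives \<open>K (R \<kappa>) = \<kappa> - P \<kappa>\<close> for \<open>\<kappa>\<close> in \<open>ker S\<close> (\<open>poisson_op_R_map\<close>), from which the range of \<open>K\<close> and the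
  idempotence and the range of \<open>R K\<close> follow. Equivalent Clifford normals have the same doubled operator and
  the same pairings, hence the same \<open>K\<close> and \<open>R K\<close>.\<close>

section \<open>Hilbert spaces\<close>

lemma cinner_scaleC_left: "cinner (c *\<^sub>C x) y = cnj c * cinner x y"
  for x y :: "'a::complex_hilbert"
  by (metis cinner_commute cinner_scaleC_right complex_cnj_mult)

lemma cinner_self: "cinner x x = complex_of_real ((norm x)\<^sup>2)"
  for x :: "'a::complex_hilbert"
proof (rule complex_eqI)
  show "Re (cinner x x) = Re (complex_of_real ((norm x)\<^sup>2))"
    by (simp add: Re_cinner dot_square_norm)
  have "cinner x x = cnj (cinner x x)"
    by (rule cinner_commute)
  then show "Im (cinner x x) = Im (complex_of_real ((norm x)\<^sup>2))"
    by (metis Im_complex_of_real Reals_cnj_iff complex_is_Real_iff)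
qed

lemma norm_scaleC_hilbert: "norm (c *\<^sub>C x) = cmod c * norm x"
  for x :: "'a::complex_hilbert"
proof -
  have "complex_of_real ((norm (c *\<^sub>C x))\<^sup>2) = cnj c * c * complex_of_real ((norm x)\<^sup>2)"
    unfolding cinner_self[symmetric] by (simp add: cinner_scaleC_left cinner_scaleC_right)
  also have "\<dots> = complex_of_real ((cmod c * norm x)\<^sup>2)"
    by (metis complex_norm_square mult.commute of_real_mult power_mult_distrib)
  finally have "(norm (c *\<^sub>C x))\<^sup>2 = (cmod c * norm x)\<^sup>2"
    using of_real_eq_iff by blast
  then show ?thesis by simp
qed

lemma cmod_cinner_le: "cmod (cinner x y) \<le> norm x * norm y"
  for x y :: "'a::complex_hilbert"
proof (cases "cinner x y = 0")
  case False
  define c where "c = cinner x y"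
  have "cinner x (cnj c *\<^sub>C y) = complex_of_real ((cmod c)\<^sup>2)"
    by (metis c_def cinner_scaleC_right complex_norm_square mult.commute)
  then have "(cmod c)\<^sup>2 = inner x (cnj c *\<^sub>C y)"
    by (metis Re_cinner Re_complex_of_real)
  also have "\<dots> \<le> norm x * norm (cnj c *\<^sub>C y)"
    by (rule norm_cauchy_schwarz)
  finally have "cmod c * cmod c \<le> cmod c * (norm x * norm y)"
    by (simp add: norm_scaleC_hilbert power2_eq_square mult_ac)
  moreover have "cmod c > 0"
    using False c_def by simp
  ultimately show ?thesis
    using c_def by (metis mult_le_cancel_left_pos)
qed simp

lemma norm_symmetric_involution:
  fixes G :: "'a::complex_hilbert \<Rightarrow> 'a"
  assumes "\<And>x. G (G x) = x" "\<And>x y. cinner (G x) y = cinner x (G y)"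
  shows "norm (G x) = norm x"
proof -
  have "complex_of_real ((norm (G x))\<^sup>2) = complex_of_real ((norm x)\<^sup>2)"
    by (simp only: cinner_self[symmetric] assms)
  then show ?thesis
    by (simp only: of_real_eq_iff power2_eq_iff_nonneg norm_ge_zero)
qed

lemma scaleC_minus_one [simp]: "(-1) *\<^sub>C x = - x" for x :: "'a::complex_vector"
  using scaleC_of_real[of "-1" x] by simp

lemma scaleC_zero [simp]: "c *\<^sub>C 0 = (0::'a::complex_vector)"
  using scaleC_add_right[of c 0 0] by simp

lemma scaleC_minus_right: "c *\<^sub>C (- x) = - (c *\<^sub>C x)" for x :: "'a::complex_vector"
  using scaleC_add_right[of c x "- x"] by (simp add: eq_neg_iff_add_eq_0 add.commute)

lemma scaleC_diff_right: "c *\<^sub>C (x - y) = c *\<^sub>C x - c *\<^sub>C y" for x y :: "'a::complex_vector"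
  using scaleC_add_right[of c x "- y"] by (simp add: scaleC_minus_right)

lemma cinner_minus_right [simp]: "cinner x (- y) = - cinner x y" for x y :: "'a::complex_hilbert"
  using cinner_diff_right[of x 0 y] by simp

lemma cinner_minus_left [simp]: "cinner (- x) y = - cinner x y" for x y :: "'a::complex_hilbert"
  using cinner_diff_left[of 0 x y] by simp

lemma cinner_eqI:
  fixes x y :: "'a::complex_hilbert"
  assumes "\<And>v. cinner x v = cinner y v"
  shows "x = y"
proof -
  have "cinner (x - y) (x - y) = 0"
    by (simp add: cinner_diff_left assms)
  then show ?thesis
    by (simp add: cinner_self)
qed

lemma bounded_linear_cinner_right: "bounded_linear (cinner x)" for x :: "'a::complex_hilbert"
proof (rule bounded_linear_intro[where K = "norm x"])
  show "cinner x (r *\<^sub>R y) = r *\<^sub>R cinner x y" for r y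
    by (metis cinner_scaleC_right scaleC_of_real scaleR_conv_of_real)
  show "cmod (cinner x y) \<le> norm y * norm x" for y
    using cmod_cinner_le[of x y] by (simp add: mult.commute)
qed (rule cinner_add_right)

lemma bounded_linear_cinner_left: "bounded_linear (\<lambda>x. cinner x y)" for y :: "'a::complex_hilbert"
proof -
  have "bounded_linear (\<lambda>x. cnj (cinner y x))"
    by (intro bounded_linear_compose[OF bounded_linear_cnj] bounded_linear_cinner_right)
  then show ?thesis
    by (simp flip: cinner_commute)
qed

lemma csubspace_subspace: "csubspace V \<Longrightarrow> subspace V"
  unfolding csubspace_def subspace_def by (metis scaleC_of_real)

lemma csubspace_diff: "csubspace V \<Longrightarrow> x \<in> V \<Longrightarrow> y \<in> V \<Longrightarrow> x - y \<in> V"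
  by (metis csubspace_subspace subspace_diff)

lemma csubspace_neg: "csubspace V \<Longrightarrow> x \<in> V \<Longrightarrow> - x \<in> V"
  by (metis csubspace_subspace subspace_neg)

lemma csubspace_ortho_compl: "csubspace (ortho_compl V)"
  by (simp add: csubspace_def ortho_compl_def cinner_add_right cinner_scaleC_right)

lemma ortho_compl_commute: "x \<in> ortho_compl V \<Longrightarrow> v \<in> V \<Longrightarrow> cinner x v = 0"
  using cinner_commute[of x v] by (simp add: ortho_compl_def)

text \<open>Approximating the distance of a point to a closed subspace gives a Cauchy sequence by the
  parallelogram law.\<close>

lemma nearest_point_in_closed_subspace:
  fixes V :: "'a::{real_inner,complete_space} set"
  assumes "closed V" "subspace V"
  obtains p where "p \<in> V" "\<And>v. v \<in> V \<Longrightarrow> norm (x - p) \<le> norm (x - v)"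
proof -
  define d where "d = infdist x V"
  have ne: "V \<noteq> {}"
    using assms(2) subspace_0 by blast
  have d: "d \<le> norm (x - v)" if "v \<in> V" for v
    using infdist_le[OF that, of x] by (simp add: d_def dist_norm)
  have d0: "d \<ge> 0"
    by (simp add: d_def infdist_nonneg)
  have "\<exists>v\<in>V. norm (x - v) < d + 1 / Suc k" for k
  proof -
    have "infdist x V < d + 1 / Suc k"
      by (simp add: d_def)
    then have "\<exists>v\<in>V. dist x v < d + 1 / Suc k"
      using cINF_less_iff[OF ne bdd_below_image_dist[of x V]] ne by (simp add: infdist_notempty)
    then show ?thesis
      by (simp add: dist_norm)
  qed
  then obtain w where w: "\<And>k. w k \<in> V" "\<And>k. norm (x - w k) < d + 1 / Suc k"
    by metis
  have dist2: "(norm (w k - w l))\<^sup>2 \<le> 2 * (norm (x - w k))\<^sup>2 + 2 * (norm (x - w l))\<^sup>2 - 4 * d\<^sup>2" for k l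
  proof -
    \<comment> \<open>the midpoint is no closer to \<open>x\<close> than the distance \<open>d\<close>\<close>
    have "(1/2) *\<^sub>R (w k + w l) \<in> V"
      using assms(2) w(1) by (simp add: subspace_add subspace_scale)
    then have "d\<^sup>2 \<le> (norm (x - (1/2) *\<^sub>R (w k + w l)))\<^sup>2"
      using d d0 by (simp add: power_mono)
    moreover have "(norm (w k - w l))\<^sup>2 + 4 * (norm (x - (1/2) *\<^sub>R (w k + w l)))\<^sup>2
        = 2 * (norm (x - w k))\<^sup>2 + 2 * (norm (x - w l))\<^sup>2"
      by (simp add: power2_norm_eq_inner algebra_simps inner_commute)
    ultimately show ?thesis by linarith
  qed
  have lim: "(\<lambda>k. norm (x - w k)) \<longlonglongrightarrow> d"
  proof (rule tendsto_sandwich[of "\<lambda>_. d" _ _ "\<lambda>k. d + 1 / Suc k"])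
    show "(\<lambda>k. d + 1 / real (Suc k)) \<longlonglongrightarrow> d"
      using tendsto_add[OF tendsto_const LIMSEQ_inverse_real_of_nat, of d]
      by (simp add: inverse_eq_divide)
  qed (use d w in \<open>auto simp: less_imp_le\<close>)
  have "Cauchy w"
  proof (rule metric_CauchyI)
    fix e :: real assume e: "e > 0"
    have "(\<lambda>k. (norm (x - w k))\<^sup>2) \<longlonglongrightarrow> d\<^sup>2"
      by (intro tendsto_intros lim)
    then have "\<forall>\<^sub>F k in sequentially. (norm (x - w k))\<^sup>2 < d\<^sup>2 + e\<^sup>2 / 4"
      using e by (intro order_tendstoD) auto
    then obtain M where M: "\<And>k. k \<ge> M \<Longrightarrow> (norm (x - w k))\<^sup>2 < d\<^sup>2 + e\<^sup>2 / 4"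
      by (auto simp: eventually_sequentially)
    have "dist (w k) (w l) < e" if "k \<ge> M" "l \<ge> M" for k l
    proof -
      have "(norm (w k - w l))\<^sup>2 < e\<^sup>2"
        using dist2[of k l] M[OF that(1)] M[OF that(2)] by linarith
      then show ?thesis
        using e by (simp add: dist_norm power_less_imp_less_base)
    qed
    then show "\<exists>M. \<forall>m\<ge>M. \<forall>n\<ge>M. dist (w m) (w n) < e" by blast
  qed
  then obtain p where p: "w \<longlonglongrightarrow> p"
    using Cauchy_convergent convergent_def by blast
  have "p \<in> V"
    using assms(1) p w(1) closed_sequentially by blast
  moreover have "norm (x - p) = d"
    using LIMSEQ_unique[OF lim tendsto_norm[OF tendsto_diff[OF tendsto_const p]]] by simp
  ultimately show thesis
    using that d by metis
qed

lemma projection_exists: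
  fixes V :: "'a::complex_hilbert set"
  assumes "closed V" "csubspace V"
  shows "\<exists>p\<in>V. x - p \<in> ortho_compl V"
proof -
  obtain p where p: "p \<in> V" "\<And>v. v \<in> V \<Longrightarrow> norm (x - p) \<le> norm (x - v)"
    using nearest_point_in_closed_subspace[OF assms(1) csubspace_subspace[OF assms(2)]] by metis
  have inner0: "inner v (x - p) = 0" if v: "v \<in> V" for v
  proof (rule ccontr)
    assume *: "inner v (x - p) \<noteq> 0"
    then have v0: "v \<noteq> 0" by auto
    \<comment> \<open>moving \<open>p\<close> to \<open>p + t v\<close> with this optimal \<open>t\<close> would bring it closer to \<open>x\<close>\<close>
    define t where "t = inner v (x - p) / inner v v"
    have "p + t *\<^sub>R v \<in> V"
      using p(1) v csubspace_subspace[OF assms(2)] by (simp add: subspace_add subspace_scale)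
    then have "(norm (x - p))\<^sup>2 \<le> (norm (x - (p + t *\<^sub>R v)))\<^sup>2"
      using p(2) by (simp add: power_mono)
    also have "x - (p + t *\<^sub>R v) = (x - p) - t *\<^sub>R v" by simp
    also have "(norm ((x - p) - t *\<^sub>R v))\<^sup>2
        = (norm (x - p))\<^sup>2 - 2 * t * inner v (x - p) + t\<^sup>2 * inner v v"
      unfolding power2_norm_eq_inner
      by (simp add: inner_diff_left inner_diff_right inner_commute power2_eq_square)
    finally have "2 * t * inner v (x - p) \<le> t\<^sup>2 * inner v v" by simp
    also have "\<dots> = t * inner v (x - p)"
      using v0 by (simp add: t_def power2_eq_square)
    finally have "t * inner v (x - p) \<le> 0" by simp
    moreover have "t * inner v (x - p) > 0"
      using * v0 by (simp add: t_def zero_less_divide_iff power2_eq_square flip: power2_eq_square)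
    ultimately show False by simp
  qed
  have "cinner v (x - p) = 0" if v: "v \<in> V" for v
  proof -
    \<comment> \<open>the imaginary part of \<open>\<langle>v, x - p\<rangle>\<close> is, up to sign, the real part for the vector \<open>\<i> v\<close>\<close>
    have "\<i> *\<^sub>C v \<in> V"
      using v assms(2) by (simp add: csubspace_def)
    then have "Re (cinner (\<i> *\<^sub>C v) (x - p)) = 0" "Re (cinner v (x - p)) = 0"
      using inner0 v by (simp_all add: Re_cinner)
    then show ?thesis
      by (simp add: cinner_scaleC_left complex_eq_iff)
  qed
  then show ?thesis
    using p(1) by (auto simp: ortho_compl_def)
qed

lemma projection_unique:
  assumes "csubspace V" "p \<in> V" "x - p \<in> ortho_compl V" "q \<in> V" "x - q \<in> ortho_compl V"
  shows "p = (q::'a::complex_hilbert)"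
proof -
  have "p - q \<in> V"
    using assms by (simp add: csubspace_diff)
  moreover have "p - q \<in> ortho_compl V"
    using csubspace_diff[OF csubspace_ortho_compl assms(5,3)] by simp
  ultimately have "cinner (p - q) (p - q) = 0"
    by (simp add: ortho_compl_def)
  then show ?thesis
    by (simp add: cinner_self)
qed

lemma ortho_proj_eqI:
  assumes "csubspace V" "p \<in> V" "x - p \<in> ortho_compl V"
  shows "ortho_proj V x = (p::'a::complex_hilbert)"
  unfolding ortho_proj_def using assms projection_unique by blast

lemma
  fixes V :: "'a::complex_hilbert set"
  assumes "closed V" "csubspace V"
  shows ortho_proj_in: "ortho_proj V x \<in> V"
    and ortho_proj_ortho: "x - ortho_proj V x \<in> ortho_compl V"
  using projection_exists[OF assms, of x] ortho_proj_eqI[OF assms(2)] by metis+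

lemma norm_ortho_sum:
  assumes "cinner p q = 0"
  shows "(norm (p + q))\<^sup>2 = (norm p)\<^sup>2 + (norm (q::'a::complex_hilbert))\<^sup>2"
proof -
  have "inner p q = 0"
    using assms by (simp flip: Re_cinner)
  then show ?thesis
    by (simp add: power2_norm_eq_inner inner_add_left inner_add_right inner_commute)
qed

lemma norm_ortho_proj_le:
  fixes V :: "'a::complex_hilbert set"
  assumes "closed V" "csubspace V"
  shows "norm (ortho_proj V x) \<le> norm x"
proof -
  have "cinner (ortho_proj V x) (x - ortho_proj V x) = 0"
    using ortho_proj_in[OF assms] ortho_proj_ortho[OF assms] by (auto simp: ortho_compl_def)
  from norm_ortho_sum[OF this] have "(norm (ortho_proj V x))\<^sup>2 \<le> (norm x)\<^sup>2"
    by simp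
  then show ?thesis
    by (rule power2_le_imp_le) simp
qed

lemma bounded_clinear_ortho_proj:
  fixes V :: "'a::complex_hilbert set"
  assumes V: "closed V" "csubspace V"
  shows "bounded_clinear (ortho_proj V)"
proof -
  note in_V = ortho_proj_in[OF V] ortho_proj_ortho[OF V]
  have add: "ortho_proj V (x + y) = ortho_proj V x + ortho_proj V y" for x y
  proof (rule ortho_proj_eqI[OF V(2)])
    have "(x - ortho_proj V x) + (y - ortho_proj V y) \<in> ortho_compl V"
      using in_V csubspace_ortho_compl[of V] by (simp add: csubspace_def)
    then show "x + y - (ortho_proj V x + ortho_proj V y) \<in> ortho_compl V"
      by (simp add: algebra_simps)
  qed (use in_V V(2) in \<open>simp add: csubspace_def\<close>)
  have scale: "ortho_proj V (c *\<^sub>C x) = c *\<^sub>C ortho_proj V x" for c x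
  proof (rule ortho_proj_eqI[OF V(2)])
    have "c *\<^sub>C (x - ortho_proj V x) \<in> ortho_compl V"
      using in_V csubspace_ortho_compl[of V] by (simp add: csubspace_def)
    then show "c *\<^sub>C x - c *\<^sub>C ortho_proj V x \<in> ortho_compl V"
      by (simp add: scaleC_diff_right)
  qed (use in_V V(2) in \<open>simp add: csubspace_def\<close>)
  have "bounded_linear (ortho_proj V)"
    by (rule bounded_linear_intro[where K = 1])
      (use add scale norm_ortho_proj_le[OF V] in \<open>auto simp flip: scaleC_of_real\<close>)
  then show ?thesis
    using scale by (simp add: bounded_clinear_def)
qed

text \<open>A vector orthogonal to the kernel of \<open>f\<close> represents \<open>f\<close> after scaling. Complex linearity of \<open>f\<close> is
  needed for the complex inner product to reproduce it.\<close>

lemma riesz_representation: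
  fixes f :: "'a::complex_hilbert \<Rightarrow> complex"
  assumes f: "bounded_linear f" and scale: "\<And>c x. f (c *\<^sub>C x) = c * f x"
  shows "\<exists>!h. \<forall>v. cinner h v = f v"
proof (rule ex_ex1I)
  show "h = h'" if "\<forall>v. cinner h v = f v" "\<forall>v. cinner h' v = f v" for h h'
    using that by (intro cinner_eqI) simp
  interpret f: bounded_linear f by fact
  define V where "V = {x. f x = 0}"
  have V: "csubspace V"
    by (simp add: V_def csubspace_def f.add scale f.zero)
  have "closed V"
    unfolding V_def by (intro closed_Collect_eq continuous_intros f.continuous_on)
  note proj = ortho_proj_in[OF this V] ortho_proj_ortho[OF this V]
  show "\<exists>h. \<forall>v. cinner h v = f v"
  proof (cases "V = UNIV")
    case True
    then have "f v = 0" for v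
      by (auto simp: V_def)
    then show ?thesis
      by (intro exI[of _ 0]) simp
  next
    case False
    then obtain x where x: "x \<notin> V" by blast
    define z where "z = x - ortho_proj V x"
    have fz: "f z \<noteq> 0"
      using x proj(1)[of x] by (simp add: z_def f.diff V_def)
    then have z0: "z \<noteq> 0"
      using f.zero by auto
    define h where "h = cnj (f z / complex_of_real ((norm z)\<^sup>2)) *\<^sub>C z"
    have "cinner h v = f v" for v
    proof -
      have "v - (f v / f z) *\<^sub>C z \<in> V"
        using fz by (simp add: V_def f.diff scale)
      then have "cinner z (v - (f v / f z) *\<^sub>C z) = 0"
        using proj(2) ortho_compl_commute unfolding z_def by blast
      then have "cinner z v = f v / f z * complex_of_real ((norm z)\<^sup>2)"
        by (simp add: cinner_diff_right cinner_scaleC_right cinner_self)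
      then show ?thesis
        using fz z0 by (simp add: h_def cinner_scaleC_left)
    qed
    then show ?thesis by blast
  qed
qed

text \<open>The sets on which all \<open>f i\<close> are bounded by \<open>k\<close> are closed and cover the space. By the Baire category
  theorem one of them contains a ball, and linearity transports the bound from this ball to the
  ball around \<open>0\<close>.\<close>

theorem uniform_boundedness:
  fixes f :: "'i \<Rightarrow> 'a::{real_normed_vector,complete_space} \<Rightarrow> 'b::real_normed_vector"
  assumes lin: "\<And>i. i \<in> I \<Longrightarrow> bounded_linear (f i)"
    and pointwise: "\<And>x. \<exists>M. \<forall>i\<in>I. norm (f i x) \<le> M"
  shows "\<exists>C\<ge>0. \<forall>i\<in>I. \<forall>x. norm (f i x) \<le> C * norm x"
proof -
  define F where "F k = {x. \<forall>i\<in>I. norm (f i x) \<le> real k}" for k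
  have closed: "closed (F k)" for k
  proof -
    have "F k = (\<Inter>i\<in>I. {x. norm (f i x) \<le> real k})"
      by (auto simp: F_def)
    moreover have "closed {x. norm (f i x) \<le> real k}" if "i \<in> I" for i
      by (intro closed_Collect_le continuous_intros bounded_linear.continuous_on[OF lin[OF that]])
    ultimately show ?thesis by auto
  qed
  have "\<exists>k. interior (F k) \<noteq> {}"
  proof (rule ccontr)
    assume "\<not> ?thesis"
    then have "euclidean interior_of \<Union>(range F) = {}"
      using closed
      by (intro Baire_category_alt disjI1 completely_metrizable_space_euclidean) auto
    moreover have "\<Union>(range F) = UNIV"
    proof -
      have "\<exists>k. x \<in> F k" for x
      proof -
        obtain M where "\<forall>i\<in>I. norm (f i x) \<le> M"
          using pointwise by blast
        moreover obtain k where "M \<le> real k"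
          using real_arch_simple by blast
        ultimately show ?thesis
          unfolding F_def by (auto intro: order_trans)
      qed
      then show ?thesis by blast
    qed
    ultimately show False by simp
  qed
  then obtain k x0 where "x0 \<in> interior (F k)" by blast
  then obtain r where r: "r > 0" "cball x0 r \<subseteq> F k"
    by (meson mem_interior_cball)
  have "norm (f i x) \<le> 2 * real k / r * norm x" if i: "i \<in> I" for i x
  proof (cases "x = 0")
    case True
    then show ?thesis
      using linear_0[OF bounded_linear.linear[OF lin[OF i]]] by simp
  next
    case False
    interpret f: bounded_linear "f i" by (rule lin[OF i])
    define y where "y = x0 + (r / norm x) *\<^sub>R x"
    have "y \<in> cball x0 r" "x0 \<in> cball x0 r"
      using False r(1) by (simp_all add: y_def dist_norm)
    with r(2) have "y \<in> F k" "x0 \<in> F k"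
      by blast+
    with i have "norm (f i y) \<le> k" "norm (f i x0) \<le> k"
      by (simp_all add: F_def)
    then have "norm (f i y - f i x0) \<le> 2 * k"
      using norm_triangle_ineq4[of "f i y" "f i x0"] by simp
    moreover have "f i y - f i x0 = (r / norm x) *\<^sub>R f i x"
      by (simp add: y_def f.add f.scaleR)
    ultimately have "(r / norm x) * norm (f i x) \<le> 2 * k"
      using r(1) by simp
    then show ?thesis
      using False r(1) by (simp add: divide_simps mult.commute)
  qed
  then show ?thesis
    using r(1) by (intro exI[of _ "2 * real k / r"]) auto
qed

section \<open>Adjoints and self-adjoint operators\<close>

lemma adjI:
  assumes "closure (Dom T) = UNIV"
    and "\<And>\<xi>. \<xi> \<in> Dom T \<Longrightarrow> cinner \<zeta> \<xi> = cinner \<eta> (T \<cdot> \<xi>)"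
  shows "\<eta> \<in> Dom (adj T)" "adj T \<cdot> \<eta> = \<zeta>"
  using assms adj_eq[OF assms] by (auto simp: adj_def)

lemma adj_cinner_right:
  assumes "closure (Dom T) = UNIV" "\<eta> \<in> Dom (adj T)" "\<xi> \<in> Dom T"
  shows "cinner \<xi> (adj T \<cdot> \<eta>) = cinner (T \<cdot> \<xi>) \<eta>"
  using adj_cinner[OF assms] by (metis cinner_commute)

lemma op_linear_adj:
  assumes "closure (Dom T) = UNIV"
  shows "op_linear (adj T)"
proof -
  note c = adj_cinner[OF assms] and I = adjI[OF assms]
  have add: "\<xi> + \<eta> \<in> Dom (adj T) \<and> adj T \<cdot> (\<xi> + \<eta>) = adj T \<cdot> \<xi> + adj T \<cdot> \<eta>"
    if "\<xi> \<in> Dom (adj T)" "\<eta> \<in> Dom (adj T)" for \<xi> \<eta>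
    using that I[of "adj T \<cdot> \<xi> + adj T \<cdot> \<eta>" "\<xi> + \<eta>"] by (simp add: cinner_add_left c)
  have scale: "s *\<^sub>C \<xi> \<in> Dom (adj T) \<and> adj T \<cdot> (s *\<^sub>C \<xi>) = s *\<^sub>C adj T \<cdot> \<xi>"
    if "\<xi> \<in> Dom (adj T)" for \<xi> s
    using that I[of "s *\<^sub>C adj T \<cdot> \<xi>" "s *\<^sub>C \<xi>"] by (simp add: cinner_scaleC_left c)
  have "0 \<in> Dom (adj T)"
    using I[of 0 0] by simp
  then show ?thesis
    using add scale by (simp add: op_linear_def csubspace_def)
qed

lemma
  assumes "op_linear T"
  shows op_linear_csubspace: "csubspace (Dom T)"
    and op_linear_add: "\<lbrakk>x \<in> Dom T; y \<in> Dom T\<rbrakk> \<Longrightarrow> T \<cdot> (x + y) = T \<cdot> x + T \<cdot> y"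
    and op_linear_scaleC: "x \<in> Dom T \<Longrightarrow> T \<cdot> (c *\<^sub>C x) = c *\<^sub>C T \<cdot> x"
    and op_linear_scaleR: "x \<in> Dom T \<Longrightarrow> T \<cdot> (r *\<^sub>R x) = r *\<^sub>R T \<cdot> x"
    and op_linear_zero: "T \<cdot> 0 = 0"
    and op_linear_neg: "x \<in> Dom T \<Longrightarrow> T \<cdot> (- x) = - (T \<cdot> x)"
    and op_linear_diff: "\<lbrakk>x \<in> Dom T; y \<in> Dom T\<rbrakk> \<Longrightarrow> T \<cdot> (x - y) = T \<cdot> x - T \<cdot> y"
proof -
  show sub: "csubspace (Dom T)"
    and add: "\<And>x y. \<lbrakk>x \<in> Dom T; y \<in> Dom T\<rbrakk> \<Longrightarrow> T \<cdot> (x + y) = T \<cdot> x + T \<cdot> y"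
    and sc: "\<And>c x. x \<in> Dom T \<Longrightarrow> T \<cdot> (c *\<^sub>C x) = c *\<^sub>C T \<cdot> x"
    using assms by (simp_all add: op_linear_def)
  show "x \<in> Dom T \<Longrightarrow> T \<cdot> (r *\<^sub>R x) = r *\<^sub>R T \<cdot> x" for x r
    using sc[of x "complex_of_real r"] by (simp add: scaleC_of_real)
  show "T \<cdot> 0 = 0"
    using add[of 0 0] sub by (simp add: csubspace_def)
  show neg: "x \<in> Dom T \<Longrightarrow> T \<cdot> (- x) = - (T \<cdot> x)" for x
    using sc[of x "-1"] by simp
  show "\<lbrakk>x \<in> Dom T; y \<in> Dom T\<rbrakk> \<Longrightarrow> T \<cdot> (x - y) = T \<cdot> x - T \<cdot> y" for x y
    using add[of x "- y"] neg[of y] csubspace_neg[OF sub] by simp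
qed

lemma csubspace_graph: "op_linear T \<Longrightarrow> csubspace (graph_of T)"
  unfolding csubspace_def graph_of_def
  by (auto simp: op_linear_zero op_linear_add op_linear_scaleC scaleC_prod_def zero_prod_def
      dest!: op_linear_csubspace simp: csubspace_def)

lemma csubspace_ker: "op_linear T \<Longrightarrow> csubspace (ker T)"
  using op_linear_csubspace[of T]
  by (auto simp: csubspace_def ker_def op_linear_zero op_linear_add op_linear_scaleC)

lemma closed_graph_adj:
  assumes "closure (Dom T) = UNIV"
  shows "closed (graph_of (adj T))"
proof -
  have "p \<in> graph_of (adj T) \<longleftrightarrow> (\<forall>\<xi>\<in>Dom T. cinner (snd p) \<xi> = cinner (fst p) (T \<cdot> \<xi>))" for p
  proof
    assume "p \<in> graph_of (adj T)"
    then show "\<forall>\<xi>\<in>Dom T. cinner (snd p) \<xi> = cinner (fst p) (T \<cdot> \<xi>)"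
      by (auto simp: graph_of_def adj_cinner[OF assms])
  next
    assume "\<forall>\<xi>\<in>Dom T. cinner (snd p) \<xi> = cinner (fst p) (T \<cdot> \<xi>)"
    then have "fst p \<in> Dom (adj T)" "adj T \<cdot> fst p = snd p"
      using adjI[OF assms] by blast+
    then show "p \<in> graph_of (adj T)"
      unfolding graph_of_def by (metis (mono_tags, lifting) mem_Collect_eq prod.collapse)
  qed
  then have "graph_of (adj T) = (\<Inter>\<xi>\<in>Dom T. {p. cinner (snd p) \<xi> = cinner (fst p) (T \<cdot> \<xi>)})"
    by blast
  moreover have "closed {p::'a \<times> 'a. cinner (snd p) \<xi> = cinner (fst p) (T \<cdot> \<xi>)}" for \<xi>
    by (intro closed_Collect_eq bounded_linear.continuous_on[OF bounded_linear_cinner_left]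
        continuous_intros)
  ultimately show ?thesis by auto
qed

lemma closed_ortho_compl: "closed (ortho_compl V)"
proof -
  have "ortho_compl V = (\<Inter>v\<in>V. {x. cinner v x = 0})"
    by (auto simp: ortho_compl_def)
  moreover have "closed {x. cinner v x = 0}" for v :: 'a
    by (intro closed_Collect_eq bounded_linear.continuous_on[OF bounded_linear_cinner_right]
        continuous_intros)
  ultimately show ?thesis by auto
qed

lemma norm_le_of_dense:
  fixes z :: "'a::complex_hilbert"
  assumes "closure V = UNIV" and K0: "0 \<le> K" and bound: "\<And>y. y \<in> V \<Longrightarrow> cmod (cinner z y) \<le> K * norm y"
  shows "norm z \<le> K"
proof -
  have "closed {y. cmod (cinner z y) \<le> K * norm y}"
    by (intro closed_Collect_le continuous_intros
        bounded_linear.continuous_on[OF bounded_linear_cinner_right])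
  then have "closure V \<subseteq> {y. cmod (cinner z y) \<le> K * norm y}"
    using bound by (intro closure_minimal) auto
  then have K: "cmod (cinner z y) \<le> K * norm y" for y
    using assms(1) by blast
  have "norm z * norm z \<le> K * norm z"
    using K[of z] by (simp add: cinner_self power2_eq_square norm_mult)
  then show ?thesis
    using K0 by (cases "z = 0") simp_all
qed

text \<open>This takes the place of the closed graph theorem. The functionals \<open>x \<mapsto> \<langle>T y, L x\<rangle>\<close>, with \<open>y\<close> ranging over the
  domain of \<open>T\<close> and scaled by the norm of \<open>y\<close>, are bounded on all of the space, and pointwise
  bounded because \<open>\<langle>T y, L x\<rangle>\<close> equals \<open>\<langle>y, T* L x\<rangle>\<close>.\<close>

lemma adj_compose_bounded:
  fixes L :: "'x::{real_normed_vector,complete_space} \<Rightarrow> 'h::complex_hilbert"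
  assumes dense: "closure (Dom T) = UNIV"
    and L: "bounded_linear L" "\<And>x. L x \<in> Dom (adj T)"
  shows "\<exists>C\<ge>0. \<forall>x. norm (adj T \<cdot> L x) \<le> C * norm x"
proof -
  define f where "f y x = (1 / norm y) *\<^sub>R cinner (T \<cdot> y) (L x)" for y x
  have f: "cmod (f y x) = cmod (cinner (adj T \<cdot> L x) y) / norm y" if "y \<in> Dom T" for x y
  proof -
    have "cmod (cinner (T \<cdot> y) (L x)) = cmod (cinner (adj T \<cdot> L x) y)"
      using adj_cinner[OF dense L(2) that, of x] cinner_commute[of "T \<cdot> y" "L x"] by simp
    then show ?thesis
      by (simp add: f_def)
  qed
  have "\<exists>C\<ge>0. \<forall>y\<in>Dom T. \<forall>x. norm (f y x) \<le> C * norm x"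
  proof (rule uniform_boundedness)
    show "bounded_linear (f y)" for y
      unfolding f_def
      by (intro bounded_linear_compose[OF bounded_linear_scaleR_right]
          bounded_linear_compose[OF bounded_linear_cinner_right] L(1))
    show "\<exists>M. \<forall>y\<in>Dom T. norm (f y x) \<le> M" for x
    proof (intro exI ballI)
      fix y assume "y \<in> Dom T"
      then show "norm (f y x) \<le> norm (adj T \<cdot> L x)"
        using cmod_cinner_le[of "adj T \<cdot> L x" y]
        by (cases "y = 0") (simp_all add: f divide_le_eq)
    qed
  qed
  then obtain C where C: "C \<ge> 0" "\<And>y x. y \<in> Dom T \<Longrightarrow> cmod (f y x) \<le> C * norm x"
    by blast
  have "norm (adj T \<cdot> L x) \<le> C * norm x" for x
  proof (rule norm_le_of_dense[OF dense])
    fix y assume "y \<in> Dom T"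
    then show "cmod (cinner (adj T \<cdot> L x) y) \<le> C * norm x * norm y"
      using C(2)[of y x] by (cases "y = 0") (simp_all add: f divide_le_eq)
  qed (use C(1) in simp)
  then show ?thesis
    using C(1) by blast
qed

definition self_adjoint :: "'h::complex_hilbert operator \<Rightarrow> bool" where
  "self_adjoint T \<longleftrightarrow> op_symmetric T \<and> Dom (adj T) \<subseteq> Dom T"

lemma
  assumes "op_symmetric T"
  shows symmetric_linear: "op_linear T"
    and symmetric_dense: "closure (Dom T) = UNIV"
    and symmetric_cinner: "\<lbrakk>x \<in> Dom T; y \<in> Dom T\<rbrakk> \<Longrightarrow> cinner (T \<cdot> x) y = cinner x (T \<cdot> y)"
    and symmetric_Dom_adj: "x \<in> Dom T \<Longrightarrow> x \<in> Dom (adj T)"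
    and symmetric_adj: "x \<in> Dom T \<Longrightarrow> adj T \<cdot> x = T \<cdot> x"
proof -
  show "op_linear T" and dense: "closure (Dom T) = UNIV"
    and sym: "\<And>x y. \<lbrakk>x \<in> Dom T; y \<in> Dom T\<rbrakk> \<Longrightarrow> cinner (T \<cdot> x) y = cinner x (T \<cdot> y)"
    using assms by (auto simp: op_symmetric_def)
  show "x \<in> Dom T \<Longrightarrow> x \<in> Dom (adj T)" "x \<in> Dom T \<Longrightarrow> adj T \<cdot> x = T \<cdot> x"
    using adjI[OF dense sym] by blast+
qed

lemma self_adjoint_symmetric: "self_adjoint T \<Longrightarrow> op_symmetric T"
  by (simp add: self_adjoint_def)

text \<open>A self-adjoint operator contains every solution of its weak equation, which is how vectors are shown to lie
  in its domain.\<close>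

lemma self_adjointD:
  assumes T: "self_adjoint T" and z: "\<And>y. y \<in> Dom T \<Longrightarrow> cinner z y = cinner x (T \<cdot> y)"
  shows "x \<in> Dom T" "T \<cdot> x = z"
proof -
  have sym: "op_symmetric T" using T by (rule self_adjoint_symmetric)
  have x: "x \<in> Dom (adj T)" "adj T \<cdot> x = z"
    using adjI[OF symmetric_dense[OF sym] z] by blast+
  then show "x \<in> Dom T"
    using T by (auto simp: self_adjoint_def)
  then show "T \<cdot> x = z"
    using x symmetric_adj[OF sym] by simp
qed

lemma closed_graph_self_adjoint:
  assumes "self_adjoint T"
  shows "closed (graph_of T)"
proof -
  have sym: "op_symmetric T" using assms by (rule self_adjoint_symmetric)
  have "Dom (adj T) = Dom T"
    using assms symmetric_Dom_adj[OF sym] by (auto simp: self_adjoint_def)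
  then have "graph_of (adj T) = graph_of T"
    using symmetric_adj[OF sym] by (auto simp: graph_of_def)
  then show ?thesis
    using closed_graph_adj[OF symmetric_dense[OF sym]] by simp
qed

lemma closed_ker:
  fixes T :: "'h::complex_hilbert operator"
  assumes "closed (graph_of T)"
  shows "closed (ker T)"
proof -
  have "ker T = (\<lambda>x. (x, 0)) -` graph_of T"
    by (auto simp: ker_def graph_of_def)
  moreover have "continuous_on UNIV (\<lambda>x::'h. (x, 0::'h))"
    by (intro continuous_intros)
  ultimately show ?thesis
    using continuous_closed_vimage[OF assms, of "\<lambda>x. (x, 0)"]
    by (simp add: continuous_on_eq_continuous_at)
qed

text \<open>The component \<open>u\<close> is read off from the projection of \<open>(v, 0)\<close> onto the graph of \<open>T\<close>.\<close>

lemma one_plus_square_surjective: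
  assumes T: "self_adjoint T"
  obtains u where "u \<in> Dom T" "T \<cdot> u \<in> Dom T" "v = u + T \<cdot> T \<cdot> u"
proof -
  have lin: "op_linear T" using self_adjoint_symmetric[OF T] by (rule symmetric_linear)
  obtain u where u: "u \<in> Dom T" "(v, 0) - (u, T \<cdot> u) \<in> ortho_compl (graph_of T)"
    using projection_exists[OF closed_graph_self_adjoint[OF T] csubspace_graph[OF lin], of "(v, 0)"]
    by (auto simp: graph_of_def)
  have "cinner (v - u) y = cinner (T \<cdot> u) (T \<cdot> y)" if "y \<in> Dom T" for y
    using ortho_compl_commute[OF u(2), of "(y, T \<cdot> y)"] that
    by (auto simp: graph_of_def cinner_prod_def)
  with self_adjointD[OF T, of "v - u" "T \<cdot> u"] have "T \<cdot> u \<in> Dom T" "T \<cdot> T \<cdot> u = v - u"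
    by blast+
  then show thesis
    using that u(1) by simp
qed

text \<open>An upper bound \<open>a > 0\<close> replaces \<open>B y y\<close>, which may vanish.\<close>

lemma psd_cauchy_schwarz:
  fixes B :: "'a::complex_vector \<Rightarrow> 'a \<Rightarrow> complex"
  assumes V: "csubspace V" "x \<in> V" "y \<in> V"
    and herm: "\<And>u v. \<lbrakk>u \<in> V; v \<in> V\<rbrakk> \<Longrightarrow> B u v = cnj (B v u)"
    and add: "\<And>u v w. \<lbrakk>u \<in> V; v \<in> V; w \<in> V\<rbrakk> \<Longrightarrow> B u (v + w) = B u v + B u w"
    and scale: "\<And>c u v. \<lbrakk>u \<in> V; v \<in> V\<rbrakk> \<Longrightarrow> B u (c *\<^sub>C v) = c * B u v"
    and pos: "\<And>u. u \<in> V \<Longrightarrow> 0 \<le> Re (B u u)"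
    and a: "Re (B y y) \<le> a" "0 < a"
  shows "(cmod (B y x))\<^sup>2 \<le> a * Re (B x x)"
proof -
  define b where "b = B y x"
  \<comment> \<open>for \<open>a = B y y\<close> this choice minimises \<open>B (x + c y) (x + c y)\<close>\<close>
  define c where "c = - (b / complex_of_real a)"
  have cy: "c *\<^sub>C y \<in> V" "x + c *\<^sub>C y \<in> V"
    using V by (simp_all add: csubspace_def)
  have "B (x + c *\<^sub>C y) (x + c *\<^sub>C y) = B x x + c * cnj b + cnj c * b + c * cnj c * B y y"
  proof -
    have "B (x + c *\<^sub>C y) x = B x x + cnj c * b"
      using herm[OF cy(2) V(2)] herm[OF V(2) V(2)] herm[OF V(3) V(2)] add[OF V(2) V(2) cy(1)]
        scale[OF V(2) V(3), of c] by (simp add: b_def)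
    moreover have "B (x + c *\<^sub>C y) y = cnj b + cnj c * B y y"
      using herm[OF cy(2) V(3)] herm[OF V(3) V(3)] add[OF V(3) V(2) cy(1)]
        scale[OF V(3) V(3), of c] by (simp add: b_def)
    ultimately show ?thesis
      using add[OF cy(2) V(2) cy(1)] scale[OF cy(2) V(3), of c] by (simp add: algebra_simps)
  qed
  moreover have "0 \<le> Re (B (x + c *\<^sub>C y) (x + c *\<^sub>C y))"
    using pos cy(2) by blast
  moreover have "c * cnj b = - complex_of_real ((cmod b)\<^sup>2 / a)"
    "cnj c * b = - complex_of_real ((cmod b)\<^sup>2 / a)"
    "c * cnj c = complex_of_real ((cmod b)\<^sup>2 / a\<^sup>2)"
    unfolding c_def using complex_norm_square[of b]
    by (simp_all add: power2_eq_square mult_ac)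
  ultimately have "0 \<le> Re (B x x) - 2 * ((cmod b)\<^sup>2 / a) + (cmod b)\<^sup>2 / a\<^sup>2 * Re (B y y)"
    by simp
  also have "(cmod b)\<^sup>2 / a\<^sup>2 * Re (B y y) \<le> (cmod b)\<^sup>2 / a\<^sup>2 * a"
    using a by (intro mult_left_mono) auto
  also have "(cmod b)\<^sup>2 / a\<^sup>2 * a = (cmod b)\<^sup>2 / a"
    using a(2) by (simp add: power2_eq_square)
  finally have "(cmod b)\<^sup>2 / a \<le> Re (B x x)"
    by simp
  then show ?thesis
    using a(2) by (simp add: b_def divide_le_eq mult.commute)
qed

section \<open>Self-adjoint operators with closed range\<close>

lemma graph_sequential_limit:
  assumes "closed (graph_of T)" "\<And>k::nat. x k \<in> Dom T" "x \<longlonglongrightarrow> a" "(\<lambda>k. T \<cdot> x k) \<longlonglongrightarrow> b"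
  shows "a \<in> Dom T" "T \<cdot> a = b"
proof -
  have lim: "(\<lambda>k. (x k, T \<cdot> x k)) \<longlonglongrightarrow> (a, b)"
    using assms(3,4) by (rule tendsto_Pair)
  have "(a, b) \<in> graph_of T"
    by (rule closed_sequentially[OF assms(1) _ lim]) (use assms(2) in \<open>auto simp: graph_of_def\<close>)
  then show "a \<in> Dom T" "T \<cdot> a = b"
    by (auto simp: graph_of_def)
qed

text \<open>The lower bound makes the range closed. Its orthogonal complement is the kernel, by self-adjointness,
  so that every vector orthogonal to the kernel is attained.\<close>

lemma self_adjoint_pseudoinverse:
  assumes T: "self_adjoint T"
    and low: "\<And>x. x \<in> Dom T \<Longrightarrow> x \<in> ortho_compl (ker T) \<Longrightarrow> norm x \<le> C * norm (T \<cdot> x)"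
  shows "pseudoinverse T v \<in> Dom T" (is ?th1)
    and "pseudoinverse T v \<in> ortho_compl (ker T)" (is ?th2)
    and "T \<cdot> pseudoinverse T v = v - ortho_proj (ker T) v" (is ?th3)
    and "\<lbrakk>\<zeta> \<in> Dom T; \<zeta> \<in> ortho_compl (ker T); T \<cdot> \<zeta> = v - ortho_proj (ker T) v\<rbrakk>
      \<Longrightarrow> pseudoinverse T v = \<zeta>" (is "PROP ?th4")
proof -
  note sym = self_adjoint_symmetric[OF T]
  note lin = symmetric_linear[OF sym]
  note cl = closed_graph_self_adjoint[OF T]
  define K where "K = ker T"
  have K: "closed K" "csubspace K"
    unfolding K_def using closed_ker[OF cl] csubspace_ker[OF lin] .
  define V where "V = Dom T \<inter> ortho_compl K"
  have V: "csubspace V"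
    using op_linear_csubspace[OF lin] csubspace_ortho_compl[of K]
    by (auto simp: V_def csubspace_def)
  define W where "W = (\<lambda>x. T \<cdot> x) ` V"
  have W: "csubspace W"
    unfolding csubspace_def
  proof (intro conjI ballI allI)
    show "0 \<in> W"
      using V op_linear_zero[OF lin] unfolding W_def csubspace_def by (metis image_eqI)
    show "x + y \<in> W" if "x \<in> W" "y \<in> W" for x y
    proof -
      from that obtain u w where uw: "u \<in> V" "w \<in> V" "x = T \<cdot> u" "y = T \<cdot> w"
        by (auto simp: W_def)
      then have "x + y = T \<cdot> (u + w)"
        using op_linear_add[OF lin, of u w] by (simp add: V_def)
      moreover have "u + w \<in> V"
        using V uw by (simp add: csubspace_def)
      ultimately show ?thesis by (auto simp: W_def)
    qed
    show "c *\<^sub>C x \<in> W" if "x \<in> W" for c x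
    proof -
      from that obtain u where u: "u \<in> V" "x = T \<cdot> u"
        by (auto simp: W_def)
      then have "c *\<^sub>C x = T \<cdot> (c *\<^sub>C u)"
        using op_linear_scaleC[OF lin, of u c] by (simp add: V_def)
      moreover have "c *\<^sub>C u \<in> V"
        using V u by (simp add: csubspace_def)
      ultimately show ?thesis by (auto simp: W_def)
    qed
  qed
  have "closed W"
    unfolding closed_sequential_limits
  proof (intro allI impI, elim conjE)
    fix w l assume w: "\<forall>k. w k \<in> W" and l: "w \<longlonglongrightarrow> l"
    have "\<forall>k. \<exists>x. x \<in> V \<and> w k = T \<cdot> x"
      using w by (auto simp: W_def)
    then obtain x where x: "\<And>k. x k \<in> V" "\<And>k. w k = T \<cdot> x k"
      by metis
    have diff: "norm (x k - x m) \<le> \<bar>C\<bar> * norm (w k - w m)" for k m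
    proof -
      have "norm (x k - x m) \<le> C * norm (T \<cdot> (x k - x m))"
        using low[of "x k - x m"] csubspace_diff[OF V x(1) x(1), of k m] by (auto simp: V_def K_def)
      also have "T \<cdot> (x k - x m) = w k - w m"
        using x op_linear_diff[OF lin, of "x k" "x m"] by (simp add: V_def)
      also have "C * norm (w k - w m) \<le> \<bar>C\<bar> * norm (w k - w m)"
        by (intro mult_right_mono) auto
      finally show ?thesis .
    qed
    have "Cauchy x"
    proof (rule metric_CauchyI)
      fix e :: real assume e: "e > 0"
      have "Cauchy w" using l by (rule LIMSEQ_imp_Cauchy)
      moreover have "e / (\<bar>C\<bar> + 1) > 0" using e by simp
      ultimately obtain M where M: "\<And>k m. k \<ge> M \<Longrightarrow> m \<ge> M \<Longrightarrow> dist (w k) (w m) < e / (\<bar>C\<bar> + 1)"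
        by (meson metric_CauchyD)
      have "dist (x k) (x m) < e" if "k \<ge> M" "m \<ge> M" for k m
      proof -
        have "norm (x k - x m) \<le> (\<bar>C\<bar> + 1) * norm (w k - w m)"
          using diff[of k m] by (simp add: distrib_right add_increasing2)
        also have "\<dots> < e"
          using M[OF that] by (simp add: dist_norm pos_less_divide_eq add_nonneg_pos mult.commute)
        finally show ?thesis by (simp add: dist_norm)
      qed
      then show "\<exists>M. \<forall>k\<ge>M. \<forall>m\<ge>M. dist (x k) (x m) < e" by blast
    qed
    then obtain a where a: "x \<longlonglongrightarrow> a"
      using Cauchy_convergent convergent_def by blast
    have "a \<in> Dom T" "T \<cdot> a = l"
    proof -
      have Tx: "(\<lambda>k. T \<cdot> x k) \<longlonglongrightarrow> l"
        using l by (simp add: x(2)[abs_def])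
      show "a \<in> Dom T" "T \<cdot> a = l"
        using graph_sequential_limit[OF cl _ a Tx] x(1) by (simp_all add: V_def)
    qed
    moreover have "a \<in> ortho_compl K"
    proof -
      show ?thesis
        by (rule closed_sequentially[OF closed_ortho_compl _ a]) (use x(1) in \<open>simp add: V_def\<close>)
    qed
    ultimately show "l \<in> W" by (auto simp: W_def V_def)
  qed
  have W_ortho: "w \<in> ortho_compl K" if "w \<in> W" for w
  proof -
    obtain x where x: "x \<in> Dom T" "w = T \<cdot> x" using \<open>w \<in> W\<close> by (auto simp: W_def V_def)
    have "cinner k w = 0" if "k \<in> K" for k
      using symmetric_cinner[OF sym _ x(1), of k] that x(2) by (auto simp: K_def ker_def)
    then show ?thesis by (simp add: ortho_compl_def)
  qed
  define v' where "v' = v - ortho_proj K v"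
  have v': "v' \<in> ortho_compl K"
    unfolding v'_def using K by (rule ortho_proj_ortho)
  have "v' \<in> W"
  proof -
    obtain w where w: "w \<in> W" "v' - w \<in> ortho_compl W"
      using projection_exists[OF \<open>closed W\<close> W] by blast
    have "cinner 0 y = cinner (v' - w) (T \<cdot> y)" if y: "y \<in> Dom T" for y
    proof -
      define k where "k = ortho_proj K y"
      have k: "k \<in> K" "y - k \<in> ortho_compl K"
        unfolding k_def using ortho_proj_in[OF K] ortho_proj_ortho[OF K] by blast+
      have "y - k \<in> V"
        using k y csubspace_diff[OF op_linear_csubspace[OF lin], of y k] by (simp add: V_def K_def ker_def)
      moreover have "T \<cdot> (y - k) = T \<cdot> y"
        using k(1) y op_linear_diff[OF lin, of y k] by (simp add: K_def ker_def)
      ultimately have "T \<cdot> y \<in> W" unfolding W_def by (metis image_eqI)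
      then show ?thesis
        using ortho_compl_commute[OF w(2)] by simp
    qed
    then have "v' - w \<in> K"
      using self_adjointD[OF T, of 0 "v' - w"] by (auto simp: K_def ker_def)
    moreover have "v' - w \<in> ortho_compl K"
      using csubspace_diff[OF csubspace_ortho_compl v' W_ortho[OF w(1)]] .
    ultimately have "cinner (v' - w) (v' - w) = 0"
      by (auto simp: ortho_compl_def)
    then have "v' = w" by (simp add: cinner_self)
    then show ?thesis using w(1) by simp
  qed
  then obtain \<zeta>0 where \<zeta>0: "\<zeta>0 \<in> Dom T \<inter> ortho_compl (ker T)" "T \<cdot> \<zeta>0 = v - ortho_proj (ker T) v"
    by (auto simp: W_def V_def v'_def K_def)
  have uniq: "\<zeta> = \<zeta>'" if "\<zeta> \<in> Dom T \<inter> ortho_compl (ker T)" "\<zeta>' \<in> Dom T \<inter> ortho_compl (ker T)"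
    "T \<cdot> \<zeta> = T \<cdot> \<zeta>'" for \<zeta> \<zeta>'
  proof -
    have "\<zeta> - \<zeta>' \<in> V"
      using csubspace_diff[OF V] that by (simp add: V_def K_def)
    moreover have "T \<cdot> (\<zeta> - \<zeta>') = 0"
      using that op_linear_diff[OF lin, of \<zeta> \<zeta>'] by simp
    ultimately show ?thesis
      using low[of "\<zeta> - \<zeta>'"] by (simp add: V_def K_def)
  qed
  have eqI: "pseudoinverse T v = \<zeta>"
    if "\<zeta> \<in> Dom T" "\<zeta> \<in> ortho_compl (ker T)" "T \<cdot> \<zeta> = v - ortho_proj (ker T) v" for \<zeta>
    unfolding pseudoinverse_def using that uniq by (intro the_equality) auto
  then show "PROP ?th4" by blast
  show ?th1 ?th2 ?th3
    using eqI[of \<zeta>0] \<zeta>0 by auto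
qed

lemma bounded_clinear_pseudoinverse:
  assumes T: "self_adjoint T" and C: "0 \<le> C"
    and low: "\<And>x. x \<in> Dom T \<Longrightarrow> x \<in> ortho_compl (ker T) \<Longrightarrow> norm x \<le> C * norm (T \<cdot> x)"
  shows "bounded_clinear (pseudoinverse T)"
proof -
  note lin = symmetric_linear[OF self_adjoint_symmetric[OF T]]
  note dom = op_linear_csubspace[OF lin]
  note p = self_adjoint_pseudoinverse[OF T low]
  have K: "closed (ker T)" "csubspace (ker T)"
    using closed_ker[OF closed_graph_self_adjoint[OF T]] csubspace_ker[OF lin] .
  interpret P: bounded_linear "ortho_proj (ker T)"
    using bounded_clinear_ortho_proj[OF K] by (simp add: bounded_clinear_def)
  have Psc: "ortho_proj (ker T) (c *\<^sub>C x) = c *\<^sub>C ortho_proj (ker T) x" for c x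
    using bounded_clinear_ortho_proj[OF K] by (simp add: bounded_clinear_def)
  have add: "pseudoinverse T (x + y) = pseudoinverse T x + pseudoinverse T y" for x y
    using p(1-3)[of x] p(1-3)[of y] dom csubspace_ortho_compl[of "ker T"]
    by (intro p(4)) (simp_all add: csubspace_def op_linear_add[OF lin] P.add)
  have scale: "pseudoinverse T (c *\<^sub>C x) = c *\<^sub>C pseudoinverse T x" for c x
    using p(1-3)[of x] dom csubspace_ortho_compl[of "ker T"]
    by (intro p(4)) (simp_all add: csubspace_def op_linear_scaleC[OF lin] Psc scaleC_diff_right)
  have "bounded_linear (pseudoinverse T)"
  proof (rule bounded_linear_intro[where K = "C * 2"])
    show "pseudoinverse T (r *\<^sub>R x) = r *\<^sub>R pseudoinverse T x" for r x
      using scale[of "complex_of_real r" x] by (simp add: scaleC_of_real)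
    show "norm (pseudoinverse T x) \<le> norm x * (C * 2)" for x
    proof -
      have "norm (pseudoinverse T x) \<le> C * norm (x - ortho_proj (ker T) x)"
        using low[OF p(1,2)] p(3) by simp
      also have "C * norm (x - ortho_proj (ker T) x) \<le> C * (2 * norm x)"
        using norm_triangle_ineq4[of x "ortho_proj (ker T) x"] norm_ortho_proj_le[OF K, of x]
        by (intro mult_left_mono C) linarith
      finally show ?thesis by (simp add: mult_ac)
    qed
  qed (rule add)
  then show ?thesis using scale by (simp add: bounded_clinear_def)
qed

text \<open>The form \<open>B y x = \<langle>T y, G x\<rangle> + \<langle>G y, T x\<rangle>\<close> is positive semidefinite, and its diagonal value at \<open>x\<close> is at most \<open>2 \<parallel>T x\<parallel> \<parallel>x\<parallel>\<close>. If \<open>T x\<close> is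
  small, then \<open>B y x\<close> is small by the Cauchy-Schwarz inequality, and with it \<open>\<langle>T y, G x\<rangle>\<close> for all \<open>y\<close> with
  bounded graph norm. If \<open>T x = 0\<close>, then \<open>G x\<close> is a weak solution of \<open>T (G x) = 0\<close>.\<close>

lemma
  assumes T: "self_adjoint T"
    and G: "\<And>x. G (G x) = x" "\<And>x y. cinner (G x) y = cinner x (G y)"
      "\<And>x y. G (x + y) = G x + G y" "\<And>c x. G (c *\<^sub>C x) = c *\<^sub>C G x"
    and pos: "\<And>x. x \<in> Dom T \<Longrightarrow> 0 \<le> Re (cinner (T \<cdot> x) (G x) + cinner (G x) (T \<cdot> x))"
  shows anticommutator_estimate: "\<lbrakk>x \<in> Dom T; y \<in> Dom T; norm x \<le> 1; norm y \<le> 1; norm (T \<cdot> y) \<le> 1\<rbrakk>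
      \<Longrightarrow> cmod (cinner (T \<cdot> y) (G x)) \<le> norm (T \<cdot> x) + sqrt (4 * norm (T \<cdot> x))"
    and anticommutator_kernel: "x \<in> ker T \<Longrightarrow> G x \<in> ker T"
proof -
  note sym = self_adjoint_symmetric[OF T]
  note lin = symmetric_linear[OF sym]
  note nG = norm_symmetric_involution[of G, OF G(1,2)]
  define B where "B y x = cinner (T \<cdot> y) (G x) + cinner (G y) (T \<cdot> x)" for y x
  have B_cs: "(cmod (B y x))\<^sup>2 \<le> a * Re (B x x)"
    if "x \<in> Dom T" "y \<in> Dom T" "Re (B y y) \<le> a" "0 < a" for x y a
  \<comment> \<open>the form is Hermitian by its shape and positive by hypothesis\<close>
  proof (rule psd_cauchy_schwarz[OF op_linear_csubspace[OF lin]])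
    show "B u v = cnj (B v u)" for u v
      by (simp add: B_def add.commute flip: cinner_commute)
    show "B u (v + w) = B u v + B u w" if "v \<in> Dom T" "w \<in> Dom T" for u v w
      using that by (simp add: B_def G cinner_add_right op_linear_add[OF lin])
    show "B u (c *\<^sub>C v) = c * B u v" if "v \<in> Dom T" for u v c
      using that by (simp add: B_def G cinner_scaleC_right op_linear_scaleC[OF lin] distrib_left)
    show "0 \<le> Re (B u u)" if "u \<in> Dom T" for u
      using pos[OF that] by (simp add: B_def)
  qed (use that in auto)
  have B_le: "Re (B x x) \<le> 2 * (norm (T \<cdot> x) * norm x)" for x
  proof -
    have "Re (cinner (T \<cdot> x) (G x)) \<le> norm (T \<cdot> x) * norm x"
      using complex_Re_le_cmod cmod_cinner_le[of "T \<cdot> x" "G x"] nG by (metis order_trans)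
    moreover have "Re (cinner (G x) (T \<cdot> x)) \<le> norm (T \<cdot> x) * norm x"
      using complex_Re_le_cmod cmod_cinner_le[of "G x" "T \<cdot> x"] nG by (metis order_trans mult.commute)
    ultimately show ?thesis by (simp add: B_def)
  qed
  show "cmod (cinner (T \<cdot> y) (G x)) \<le> norm (T \<cdot> x) + sqrt (4 * norm (T \<cdot> x))"
    if x: "x \<in> Dom T" "norm x \<le> 1" and y: "y \<in> Dom T" "norm y \<le> 1" "norm (T \<cdot> y) \<le> 1"
  proof -
    have "norm (T \<cdot> y) * norm y \<le> 1 * 1"
      using y by (intro mult_mono) auto
    then have "(cmod (B y x))\<^sup>2 \<le> 2 * Re (B x x)"
      using B_le[of y] by (intro B_cs x y) auto
    \<comment> \<open>the diagonal value at \<open>x\<close> is at most \<open>2 \<parallel>T x\<parallel> \<parallel>x\<parallel>\<close>, and likewise at \<open>y\<close>\<close>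
    also have "\<dots> \<le> 2 * (2 * (norm (T \<cdot> x) * 1))"
      using B_le[of x] mult_left_mono[OF x(2), of "norm (T \<cdot> x)"] by simp
    finally have "cmod (B y x) \<le> sqrt (4 * norm (T \<cdot> x))"
      by (intro real_le_rsqrt) simp
    moreover have "cmod (cinner (G y) (T \<cdot> x)) \<le> 1 * norm (T \<cdot> x)"
      using cmod_cinner_le[of "G y" "T \<cdot> x"] mult_right_mono[OF y(2), of "norm (T \<cdot> x)"] nG[of y]
      by simp
    moreover have "cinner (T \<cdot> y) (G x) = B y x - cinner (G y) (T \<cdot> x)"
      by (simp add: B_def)
    ultimately show ?thesis
      using norm_triangle_ineq4[of "B y x" "cinner (G y) (T \<cdot> x)"] by simp
  qed
  show "G x \<in> ker T" if "x \<in> ker T"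
  proof -
    have x: "x \<in> Dom T" "T \<cdot> x = 0"
      using that by (auto simp: ker_def)
    have "cinner 0 y = cinner (G x) (T \<cdot> y)" if y: "y \<in> Dom T" for y
    proof -
      have "(cmod (B y x))\<^sup>2 \<le> (\<bar>Re (B y y)\<bar> + 1) * Re (B x x)"
        by (intro B_cs x y) auto
      also have "Re (B x x) = 0"
        using x by (simp add: B_def)
      finally have "cinner (T \<cdot> y) (G x) = 0"
        using x by (simp add: B_def)
      then show ?thesis
        using cinner_commute[of "G x" "T \<cdot> y"] by simp
    qed
    then show ?thesis
      using self_adjointD[OF T, of 0 "G x"] by (auto simp: ker_def)
  qed
qed

text \<open>Suppose that unit vectors \<open>x k\<close> orthogonal to the kernel have \<open>T (x k) \<rightarrow> 0\<close>. By the preceding estimate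
  \<open>T\<close> is weakly small on \<open>G (x k)\<close>, so \<open>G (x k)\<close> is close to a vector \<open>u k\<close> in the domain of \<open>T\<close>, with bounded
  graph norm. The compactness hypothesis applies to \<open>x k\<close> and to \<open>u k\<close>. As \<open>E\<close> anticommutes with \<open>G\<close>, it controls
  both \<open>x k - E (x k)\<close> and \<open>x k + E (x k)\<close>, hence \<open>x k\<close> itself.\<close>

lemma lower_bound_by_anticommuting_symmetries:
  fixes T :: "'x::complex_hilbert operator"
  assumes T: "self_adjoint T"
    and G: "bounded_linear G" "\<And>x. G (G x) = x" "\<And>x y. cinner (G x) y = cinner x (G y)"
      "\<And>c x. G (c *\<^sub>C x) = c *\<^sub>C G x"
    and pos: "\<And>x. x \<in> Dom T \<Longrightarrow> 0 \<le> Re (cinner (T \<cdot> x) (G x) + cinner (G x) (T \<cdot> x))"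
    and E: "bounded_linear E" "\<And>x. E (G x) = - G (E x)"
    and compact: "\<And>x :: nat \<Rightarrow> 'x. (\<And>k. x k \<in> Dom T \<and> norm (x k) \<le> 1 \<and> norm (T \<cdot> x k) \<le> 1)
      \<Longrightarrow> \<exists>r l. strict_mono r \<and> (\<lambda>k. x (r k) - E (x (r k))) \<longlonglongrightarrow> l"
  shows "\<exists>C\<ge>0. \<forall>x\<in>Dom T. x \<in> ortho_compl (ker T) \<longrightarrow> norm x \<le> C * norm (T \<cdot> x)"
proof (rule ccontr)
  assume "\<not> ?thesis"
  then have no: "\<exists>x\<in>Dom T. x \<in> ortho_compl (ker T) \<and> C * norm (T \<cdot> x) < norm x" if "C \<ge> 0" for C
    using that unfolding not_le[symmetric] by blast
  interpret G: bounded_linear G by fact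
  interpret E: bounded_linear E by fact
  note lin = symmetric_linear[OF self_adjoint_symmetric[OF T]]
  note dom = op_linear_csubspace[OF lin]
  note cl = closed_graph_self_adjoint[OF T]
  note nG = norm_symmetric_involution[of G, OF G(2,3)]
  have "\<exists>x. x \<in> Dom T \<and> x \<in> ortho_compl (ker T) \<and> norm x = 1 \<and> norm (T \<cdot> x) < 1 / Suc k" for k
  proof -
    obtain x where x: "x \<in> Dom T" "x \<in> ortho_compl (ker T)" "real (Suc k) * norm (T \<cdot> x) < norm x"
      using no[of "real (Suc k)"] by auto
    have nx: "norm x > 0"
      using x(3) by (smt (verit) mult_nonneg_nonneg norm_ge_zero of_nat_0_le_iff)
    define u where "u = (1 / norm x) *\<^sub>R x"
    have "u \<in> Dom T" "u \<in> ortho_compl (ker T)"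
      unfolding u_def
      by (intro subspace_scale[OF csubspace_subspace] dom csubspace_ortho_compl x)+
    moreover have "norm u = 1" using nx by (simp add: u_def)
    moreover have "norm (T \<cdot> u) < 1 / Suc k"
    proof -
      have "norm (T \<cdot> u) = norm (T \<cdot> x) / norm x"
        using x(1) nx by (simp add: u_def op_linear_scaleR[OF lin])
      then have "real (Suc k) * norm (T \<cdot> u) < 1"
        using x(3) nx by (simp add: pos_divide_less_eq del: of_nat_Suc)
      then show ?thesis
        by (simp add: pos_less_divide_eq mult.commute del: of_nat_Suc)
    qed
    ultimately show ?thesis by blast
  qed
  then obtain x where x: "\<And>k. x k \<in> Dom T" "\<And>k. x k \<in> ortho_compl (ker T)" "\<And>k. norm (x k) = 1"
    "\<And>k. norm (T \<cdot> x k) < 1 / Suc k"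
    by metis
  have Tx_lim: "(\<lambda>k. norm (T \<cdot> x k)) \<longlonglongrightarrow> 0"
    by (rule tendsto_sandwich[OF _ _ tendsto_const lim_1_over_n[THEN LIMSEQ_Suc]])
      (use x(4) in \<open>auto simp: less_imp_le\<close>)
  have Tx_le: "norm (T \<cdot> x k) \<le> 1" for k
    using x(4)[of k] by (smt (verit) divide_le_eq_1 of_nat_0_less_iff of_nat_Suc of_nat_0_le_iff)
  have "\<exists>u. u \<in> Dom T \<and> T \<cdot> u \<in> Dom T \<and> G (x k) = u + T \<cdot> T \<cdot> u" for k
    using one_plus_square_surjective[OF T, of "G (x k)"] by metis
  then obtain u where u: "\<And>k. u k \<in> Dom T" "\<And>k. T \<cdot> u k \<in> Dom T" "\<And>k. G (x k) = u k + T \<cdot> T \<cdot> u k"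
    by metis
  have sq: "(norm (u k))\<^sup>2 + 2 * (norm (T \<cdot> u k))\<^sup>2 + (norm (T \<cdot> T \<cdot> u k))\<^sup>2 = 1" for k
  proof -
    have "inner (u k) (T \<cdot> T \<cdot> u k) = (norm (T \<cdot> u k))\<^sup>2"
      using symmetric_cinner[OF self_adjoint_symmetric[OF T] u(1,2), of k k]
      by (metis Re_cinner Re_complex_of_real cinner_self)
    moreover have "(norm (u k + T \<cdot> T \<cdot> u k))\<^sup>2 = 1"
      using u(3)[of k] nG[of "x k"] x(3)[of k] by simp
    ultimately show ?thesis
      by (simp add: power2_norm_eq_inner inner_add_left inner_add_right inner_commute)
  qed
  have le1: "norm (u k) \<le> 1" "norm (T \<cdot> u k) \<le> 1" "norm (T \<cdot> T \<cdot> u k) \<le> 1" for k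
  proof -
    have "(norm (u k))\<^sup>2 \<le> 1\<^sup>2" "(norm (T \<cdot> u k))\<^sup>2 \<le> 1\<^sup>2" "(norm (T \<cdot> T \<cdot> u k))\<^sup>2 \<le> 1\<^sup>2"
      using sq[of k] zero_le_power2[of "norm (u k)"] zero_le_power2[of "norm (T \<cdot> u k)"]
        zero_le_power2[of "norm (T \<cdot> T \<cdot> u k)"] unfolding one_power2 by linarith+
    then show "norm (u k) \<le> 1" "norm (T \<cdot> u k) \<le> 1" "norm (T \<cdot> T \<cdot> u k) \<le> 1"
      by (simp_all add: abs_square_le_1)
  qed
  \<comment> \<open>\<open>G (x k) - u k = T (T (u k))\<close> is paired with \<open>G (x k)\<close>, and the estimate applies to \<open>y = T (u k)\<close>\<close>
  have diff_sq: "(norm (T \<cdot> T \<cdot> u k))\<^sup>2 \<le> norm (T \<cdot> x k) + sqrt (4 * norm (T \<cdot> x k))" for k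
  proof -
    have "cinner (T \<cdot> T \<cdot> u k) (G (x k))
        = complex_of_real ((norm (T \<cdot> u k))\<^sup>2 + (norm (T \<cdot> T \<cdot> u k))\<^sup>2)"
      using symmetric_cinner[OF self_adjoint_symmetric[OF T] u(2,1), of k k]
      by (simp add: u(3) cinner_add_right cinner_self)
    then have "cmod (cinner (T \<cdot> T \<cdot> u k) (G (x k)))
        = (norm (T \<cdot> u k))\<^sup>2 + (norm (T \<cdot> T \<cdot> u k))\<^sup>2"
      by (metis abs_of_nonneg add_nonneg_nonneg norm_of_real zero_le_power2)
    moreover have "cmod (cinner (T \<cdot> T \<cdot> u k) (G (x k))) \<le> norm (T \<cdot> x k) + sqrt (4 * norm (T \<cdot> x k))"
      using x(3)[of k] le1[of k]
      by (intro anticommutator_estimate[OF T G(2,3) G.add G(4) pos] x u) auto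
    ultimately show ?thesis
      using zero_le_power2[of "norm (T \<cdot> u k)"] by linarith
  qed
  have "(\<lambda>k. (norm (T \<cdot> T \<cdot> u k))\<^sup>2) \<longlonglongrightarrow> 0"
  proof (rule tendsto_sandwich[of "\<lambda>_. 0" _ _ "\<lambda>k. norm (T \<cdot> x k) + sqrt (4 * norm (T \<cdot> x k))"])
    have "(\<lambda>k. norm (T \<cdot> x k) + sqrt (4 * norm (T \<cdot> x k))) \<longlonglongrightarrow> 0 + sqrt (4 * 0)"
      by (intro tendsto_intros Tx_lim)
    then show "(\<lambda>k. norm (T \<cdot> x k) + sqrt (4 * norm (T \<cdot> x k))) \<longlonglongrightarrow> 0" by simp
  qed (use diff_sq in auto)
  then have "(\<lambda>k. sqrt ((norm (T \<cdot> T \<cdot> u k))\<^sup>2)) \<longlonglongrightarrow> sqrt 0"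
    by (rule tendsto_real_sqrt)
  then have "(\<lambda>k. norm (T \<cdot> T \<cdot> u k)) \<longlonglongrightarrow> 0"
    by (simp only: real_sqrt_abs abs_norm_cancel real_sqrt_zero)
  then have TTu: "(\<lambda>k. T \<cdot> T \<cdot> u k) \<longlonglongrightarrow> 0"
    by (rule tendsto_norm_zero_cancel)
  obtain r1 l1 where r1: "strict_mono r1" "(\<lambda>k. x (r1 k) - E (x (r1 k))) \<longlonglongrightarrow> l1"
    using compact[of x] x(1,3) Tx_le by auto
  obtain r2 l2 where r2: "strict_mono r2" "(\<lambda>k. u (r1 (r2 k)) - E (u (r1 (r2 k)))) \<longlonglongrightarrow> l2"
    using compact[of "u \<circ> r1"] u(1) le1 by auto
  define r where "r = r1 \<circ> r2"
  have r: "strict_mono r"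
    unfolding r_def using r1(1) r2(1) by (rule strict_mono_o)
  have lim1: "(\<lambda>k. x (r k) - E (x (r k))) \<longlonglongrightarrow> l1"
    using LIMSEQ_subseq_LIMSEQ[OF r1(2) r2(1)] by (simp add: r_def o_def)
  have TTu': "(\<lambda>k. T \<cdot> T \<cdot> u (r k)) \<longlonglongrightarrow> 0"
    using LIMSEQ_subseq_LIMSEQ[OF TTu r] by (simp add: o_def)
  have "(\<lambda>k. (u (r k) - E (u (r k))) + (T \<cdot> T \<cdot> u (r k) - E (T \<cdot> T \<cdot> u (r k)))) \<longlonglongrightarrow> l2 + (0 - E 0)"
    using r2(2) by (intro tendsto_intros TTu' E.tendsto) (simp add: r_def)
  moreover have "(u (r k) - E (u (r k))) + (T \<cdot> T \<cdot> u (r k) - E (T \<cdot> T \<cdot> u (r k)))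
      = G (x (r k) + E (x (r k)))" for k
  proof -
    have "(u (r k) - E (u (r k))) + (T \<cdot> T \<cdot> u (r k) - E (T \<cdot> T \<cdot> u (r k)))
        = G (x (r k)) - E (G (x (r k)))"
      by (simp add: u(3) E.add)
    then show ?thesis
      by (simp add: E(2) G.add)
  qed
  ultimately have "(\<lambda>k. G (x (r k) + E (x (r k)))) \<longlonglongrightarrow> l2"
    by (simp add: E.zero)
  from G.tendsto[OF this] have "(\<lambda>k. x (r k) + E (x (r k))) \<longlonglongrightarrow> G l2"
    by (simp add: G(2))
  from tendsto_scaleR[OF tendsto_const tendsto_add[OF lim1 this], of "1/2"]
  have xl: "(\<lambda>k. x (r k)) \<longlonglongrightarrow> (1/2) *\<^sub>R (l1 + G l2)" (is "_ \<longlonglongrightarrow> ?l")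
    by (simp add: scaleR_2[symmetric])
  have Txl: "(\<lambda>k. T \<cdot> x (r k)) \<longlonglongrightarrow> 0"
    using LIMSEQ_subseq_LIMSEQ[OF tendsto_norm_zero_cancel[OF Tx_lim] r] by (simp add: o_def)
  have "?l \<in> ker T"
    using graph_sequential_limit[OF cl _ xl Txl] x(1) by (simp add: ker_def)
  moreover have "?l \<in> ortho_compl (ker T)"
    by (intro closed_sequentially[OF closed_ortho_compl _ xl] x(2))
  ultimately have "cinner ?l ?l = 0"
    by (auto simp: ortho_compl_def)
  then have "norm ?l = 0" by (simp add: cinner_self)
  moreover have "norm ?l = 1"
    using LIMSEQ_unique[OF tendsto_norm[OF xl], of 1] x(3) by simp
  ultimately show False by simp
qed

section \<open>The compact embedding of the minimal domain\<close>

text \<open>The Neumann series for the inverse is replaced by the fixed point of the contraction \<open>x \<mapsto> e + x (e - a)\<close>.\<close>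

lemma left_inverse_near_unit:
  fixes e :: "'a::{real_normed_algebra,complete_space}"
  assumes e: "\<And>x. e * x = x" "\<And>x. x * e = x" and a: "norm (e - a) < 1"
  obtains b where "b * a = e"
proof -
  define f where "f x = e + x * (e - a)" for x
  have "dist (f x) (f y) \<le> norm (e - a) * dist x y" for x y
    using norm_mult_ineq[of "x - y" "e - a"]
    by (simp add: f_def dist_norm left_diff_distrib mult.commute)
  then obtain b where "f b = b"
    using banach_fix_type[of "norm (e - a)" f] a by auto
  then have "b * a = e"
    by (simp add: f_def right_diff_distrib e)
  then show thesis by (rule that)
qed

text \<open>Positivity makes \<open>\<langle>x, S x\<rangle>\<close> real. Symmetry follows by polarisation over the complex numbers.\<close>

lemma is_inv_sqrt_symmetric:
  assumes "is_inv_sqrt M S"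
  shows "cinner (S x) y = cinner x (S y)"
proof -
  have S: "S (x + y) = S x + S y" "S (c *\<^sub>C x) = c *\<^sub>C S x" for x y c
    using assms bounded_linear.linear[THEN linear_add]
    by (auto simp: is_inv_sqrt_def bounded_clinear_def)
  define F where "F x y = cinner x (S y) - cinner (S x) y" for x y
  have F0: "F x x = 0" for x
  proof -
    have "cinner x (S x) \<in> \<real>"
      using assms nonneg_Reals_subset_Reals by (auto simp: is_inv_sqrt_def)
    then show ?thesis
      using cinner_commute[of "S x" x] by (simp add: F_def Reals_cnj_iff)
  qed
  have add: "F x y + F y x = 0" for x y
  proof -
    have "F (x + y) (x + y) = F x x + F x y + F y x + F y y"
      by (simp add: F_def S cinner_add_left cinner_add_right)
    then show ?thesis
      by (simp add: F0)
  qed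
  have "F x (\<i> *\<^sub>C y) + F (\<i> *\<^sub>C y) x = \<i> * (F x y - F y x)"
    by (simp add: F_def S cinner_scaleC_left cinner_scaleC_right algebra_simps)
  then have "F x y - F y x = 0"
    using add[of x "\<i> *\<^sub>C y"] by simp
  with add[of x y] have "F x y = 0"
    by simp
  then show ?thesis by (simp add: F_def)
qed

lemma compact_op_sequence:
  assumes "compact_op K" and z: "\<And>k::nat. norm (z k) \<le> M"
  obtains r l where "strict_mono r" "(\<lambda>k. K (z (r k))) \<longlonglongrightarrow> l"
proof -
  interpret K: bounded_linear K
    using assms(1) by (simp add: compact_op_def bounded_clinear_def)
  \<comment> \<open>\<open>M\<close> need not be positive\<close>
  define N where "N = \<bar>M\<bar> + 1"
  have N: "N > 0" "norm (z k) \<le> N" for k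
    using z[of k] by (auto simp: N_def)
  have "(1 / N) *\<^sub>R z k \<in> cball 0 1" for k
    using N by simp
  then have "\<forall>k. K ((1 / N) *\<^sub>R z k) \<in> closure (K ` cball 0 1)"
    using closure_subset by blast
  moreover have "seq_compact (closure (K ` cball 0 1))"
    using assms(1) by (simp add: compact_op_def compact_imp_seq_compact)
  ultimately obtain l r where lr: "strict_mono r" "((\<lambda>k. K ((1 / N) *\<^sub>R z k)) \<circ> r) \<longlonglongrightarrow> l"
    using seq_compactE[of "closure (K ` cball 0 1)" "\<lambda>k. K ((1 / N) *\<^sub>R z k)"] by blast
  have "(\<lambda>k. N *\<^sub>R K ((1 / N) *\<^sub>R z (r k))) \<longlonglongrightarrow> N *\<^sub>R l"
    using lr(2) by (intro tendsto_scaleR tendsto_const) (simp add: o_def)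
  then have "(\<lambda>k. K (z (r k))) \<longlonglongrightarrow> N *\<^sub>R l"
    using N(1) by (simp add: K.scaleR)
  with lr(1) show thesis by (rule that)
qed

locale unital_clifford_normal = clifford_normal \<alpha> J \<J> \<A> \<pi> \<gamma> D n
  for \<alpha> :: "'a::cstar_algebra \<Rightarrow> 'a"
    and J \<J> \<A> :: "'a set"
    and \<pi> :: "'a \<Rightarrow> 'h::complex_hilbert \<Rightarrow> 'h"
    and \<gamma> :: "'h \<Rightarrow> 'h"
    and D :: "'h operator"
    and n :: "'h \<Rightarrow> 'h" +
  assumes unital: "\<exists>e::'a. \<forall>a. e * a = a \<and> a * e = a"
    and nondegenerate: "nondegenerate \<pi>"

context clifford_normal
begin

lemma dense_Dom_D: "closure (Dom D) = UNIV"
  using D_symmetric by (rule symmetric_dense)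

lemma bounded_linear_rep: "bounded_linear (\<pi> a)"
  using representation by (simp add: even_representation_def bounded_clinear_def)

text \<open>The vector \<open>u = (1 + D*D)\<^sup>-\<^sup>1 z\<close> satisfies \<open>\<langle>d, z\<rangle> = \<langle>d, u\<rangle> + \<langle>D d, D u\<rangle>\<close>, and its graph norm is the norm of \<open>B z\<close>.\<close>

lemma Dom_D_inv_sqrt_estimate:
  assumes B: "is_inv_sqrt (one_plus (op_comp (adj D) D)) B" and d: "d \<in> Dom D"
  shows "cmod (cinner d z) \<le> norm (d, D \<cdot> d) * norm (B z)"
proof -
  define u where "u = B (B z)"
  have "u \<in> Dom (one_plus (op_comp (adj D) D))" "one_plus (op_comp (adj D) D) \<cdot> u = z"
    using B by (simp_all add: u_def is_inv_sqrt_def)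
  then have u: "u \<in> Dom D" "D \<cdot> u \<in> Dom (adj D)" "z = u + adj D \<cdot> D \<cdot> u"
    by (auto simp: one_plus_def op_comp_def)
  have pair: "cinner x z = cinner (x, D \<cdot> x) (u, D \<cdot> u)" if "x \<in> Dom D" for x
    using adj_cinner_right[OF dense_Dom_D u(2) that]
    by (simp add: u(3) cinner_add_right cinner_prod_def)
  have "complex_of_real ((norm (u, D \<cdot> u))\<^sup>2) = cinner u z"
    using pair[OF u(1)] by (simp only: cinner_self)
  also have "\<dots> = complex_of_real ((norm (B z))\<^sup>2)"
    using is_inv_sqrt_symmetric[OF B, of "B z" z] by (simp add: u_def cinner_self)
  finally have "norm (u, D \<cdot> u) = norm (B z)"
    by (simp only: of_real_eq_iff power2_eq_iff_nonneg norm_ge_zero)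
  then show ?thesis
    using pair[OF d] cmod_cinner_le[of "(d, D \<cdot> d)" "(u, D \<cdot> u)"] by simp
qed

end

context unital_clifford_normal
begin

text \<open>The unit acts as the identity on the vectors \<open>\<pi> a x\<close>, which span a dense subspace.\<close>

lemma rep_unit:
  assumes e: "\<And>a. e * a = (a::'a)"
  shows "\<pi> e x = x"
proof -
  interpret e: bounded_linear "\<pi> e" by (rule bounded_linear_rep)
  define V where "V = {x. \<pi> e x = x}"
  have "\<pi> e (\<pi> a x) = \<pi> a x" for a x
    using representation e[of a] by (metis even_representation_def)
  then have "{\<pi> a x | a x. True} \<subseteq> V"
    by (auto simp: V_def)
  moreover have "subspace V"
    by (simp add: subspace_def V_def e.add e.scaleR e.zero)
  ultimately have "span {\<pi> a x | a x. True} \<subseteq> V"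
    by (rule span_minimal)
  moreover have "closed V"
    unfolding V_def by (intro closed_Collect_eq continuous_intros e.continuous_on)
  ultimately have "closure (span {\<pi> a x | a x. True}) \<subseteq> V"
    by (rule closure_minimal)
  then show ?thesis
    using nondegenerate by (auto simp: nondegenerate_def V_def)
qed

text \<open>The unit of \<open>A\<close> need not lie in the dense subalgebra \<open>\<A>\<close>. An element \<open>a\<close> of \<open>\<A>\<close> close to the unit has a left
  inverse \<open>b\<close> in \<open>A\<close>, and \<open>\<pi> b\<close> carries the compactness of \<open>\<pi> a \<circ> B\<close> over to \<open>B\<close>.\<close>

lemma inv_sqrt_compact:
  obtains B where "is_inv_sqrt (one_plus (op_comp (adj D) D)) B"
    "\<And>(z :: nat \<Rightarrow> 'h) M. (\<And>k. norm (z k) \<le> M) \<Longrightarrow>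
      \<exists>r l. strict_mono r \<and> (\<lambda>k. B (z (r k))) \<longlonglongrightarrow> l"
proof -
  obtain e :: 'a where e: "\<And>a. e * a = a" "\<And>a. a * e = a"
    using unital by blast
  have "e \<in> closure \<A>"
    using dense_A(2) by simp
  then obtain a where a: "a \<in> \<A>" "norm (e - a) < 1"
    by (metis closure_approachable dist_commute dist_norm zero_less_one)
  obtain b where b: "b * a = e"
    using left_inverse_near_unit[OF e a(2)] by blast
  have ba: "\<pi> b (\<pi> a x) = x" for x
    using rep_unit[OF e(1), of x] representation b by (metis even_representation_def)
  interpret b: bounded_linear "\<pi> b" by (rule bounded_linear_rep)
  obtain B where B: "is_inv_sqrt (one_plus (op_comp (adj D) D)) B" "compact_op (\<pi> a \<circ> B)"
    using compact_resolvent[OF a(1)] by blast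
  have "\<exists>r l. strict_mono r \<and> (\<lambda>k. B (z (r k))) \<longlonglongrightarrow> l"
    if z: "\<And>k. norm (z k) \<le> M" for z :: "nat \<Rightarrow> 'h" and M
  proof -
    obtain r l where rl: "strict_mono r" "(\<lambda>k. (\<pi> a \<circ> B) (z (r k))) \<longlonglongrightarrow> l"
      by (rule compact_op_sequence[OF B(2) z])
    have "(\<lambda>k. \<pi> b ((\<pi> a \<circ> B) (z (r k)))) \<longlonglongrightarrow> \<pi> b l"
      by (rule b.tendsto[OF rl(2)])
    then show ?thesis
      using rl(1) by (auto simp: ba)
  qed
  with B(1) show thesis by (rule that)
qed

text \<open>By the estimate above, \<open>\<parallel>x\<^sub>k - x\<^sub>m\<parallel>\<^sup>2 \<le> 2 M \<parallel>B (x\<^sub>k - x\<^sub>m)\<parallel>\<close>. Thus \<open>x\<close> is Cauchy along a subsequence along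
  which \<open>B x\<close> converges.\<close>

lemma Dom_D_compact_embedding:
  fixes x :: "nat \<Rightarrow> 'h"
  assumes x: "\<And>k. x k \<in> Dom D" "\<And>k. norm (x k, D \<cdot> x k) \<le> M"
  obtains r l where "strict_mono r" "(\<lambda>k. x (r k)) \<longlonglongrightarrow> l"
proof -
  note lin = symmetric_linear[OF D_symmetric]
  obtain B where B: "is_inv_sqrt (one_plus (op_comp (adj D) D)) B"
    and cpt: "\<And>(z :: nat \<Rightarrow> 'h) M. (\<And>k. norm (z k) \<le> M) \<Longrightarrow>
      \<exists>r l. strict_mono r \<and> (\<lambda>k. B (z (r k))) \<longlonglongrightarrow> l"
    using inv_sqrt_compact by blast
  interpret B: bounded_linear B
    using B by (simp add: is_inv_sqrt_def bounded_clinear_def)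
  have "norm (x k) \<le> M" for k
    using x(2)[of k] norm_fst_le[of "x k" "D \<cdot> x k"] by linarith
  then obtain r l where rl: "strict_mono r" "(\<lambda>k. B (x (r k))) \<longlonglongrightarrow> l"
    using cpt by blast
  define y where "y k = x (r k)" for k
  have est: "(norm (y k - y m))\<^sup>2 \<le> 2 * M * norm (B (y k) - B (y m))" for k m
  proof -
    have "y k - y m \<in> Dom D"
      using x(1) csubspace_diff[OF op_linear_csubspace[OF lin]] by (simp add: y_def)
    from Dom_D_inv_sqrt_estimate[OF B this, of "y k - y m"]
    have "(norm (y k - y m))\<^sup>2
        \<le> norm (y k - y m, D \<cdot> (y k - y m)) * norm (B (y k) - B (y m))"
      by (simp add: cinner_self B.diff norm_power)
    also have "(y k - y m, D \<cdot> (y k - y m)) = (y k, D \<cdot> y k) - (y m, D \<cdot> y m)"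
      using x(1) op_linear_diff[OF lin] by (simp add: y_def)
    also have "norm \<dots> * norm (B (y k) - B (y m)) \<le> (M + M) * norm (B (y k) - B (y m))"
      using norm_triangle_ineq4[of "(y k, D \<cdot> y k)" "(y m, D \<cdot> y m)"] x(2)[of "r k"] x(2)[of "r m"]
      by (intro mult_right_mono) (auto simp: y_def)
    finally show ?thesis by simp
  qed
  have "Cauchy y"
  proof (rule metric_CauchyI)
    fix \<epsilon> :: real assume \<epsilon>: "\<epsilon> > 0"
    have "Cauchy (\<lambda>k. B (y k))"
      using rl(2) unfolding y_def by (rule LIMSEQ_imp_Cauchy)
    moreover have "\<epsilon>\<^sup>2 / (2 * \<bar>M\<bar> + 1) > 0"
      using \<epsilon> by simp
    ultimately obtain N where
      N: "\<And>k m. k \<ge> N \<Longrightarrow> m \<ge> N \<Longrightarrow> dist (B (y k)) (B (y m)) < \<epsilon>\<^sup>2 / (2 * \<bar>M\<bar> + 1)"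
      by (meson metric_CauchyD)
    have "dist (y k) (y m) < \<epsilon>" if "k \<ge> N" "m \<ge> N" for k m
    proof -
      have "(norm (y k - y m))\<^sup>2 \<le> 2 * M * norm (B (y k) - B (y m))"
        by (rule est)
      also have "\<dots> \<le> (2 * \<bar>M\<bar> + 1) * norm (B (y k) - B (y m))"
        by (intro mult_right_mono) auto
      also have "\<dots> < \<epsilon>\<^sup>2"
        using N[OF that] by (simp add: dist_norm pos_less_divide_eq add_nonneg_pos mult.commute)
      finally show ?thesis
        using \<epsilon> by (simp add: dist_norm power_less_imp_less_base)
    qed
    then show "\<exists>N. \<forall>k\<ge>N. \<forall>m\<ge>N. dist (y k) (y m) < \<epsilon>" by blast
  qed
  then obtain l' where "y \<longlonglongrightarrow> l'"
    using Cauchy_convergent convergent_def by blast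
  then show thesis
    using that[OF rl(1)] by (simp add: y_def[abs_def])
qed

end

section \<open>The boundary form and the doubled operator\<close>

text \<open>The uniform boundedness argument needs a map that is defined everywhere. Projecting onto the graph
  of \<open>T\<close> extends \<open>\<Lambda>\<close> from the domain of \<open>T\<close> to the whole product space.\<close>

lemma adj_bounded_on_graph:
  fixes T :: "'x::complex_hilbert operator" and \<Lambda> :: "'x \<Rightarrow> 'h::complex_hilbert"
  assumes T: "op_linear T" "closed (graph_of T)" and S: "closure (Dom S) = UNIV"
    and L: "bounded_linear \<Lambda>" "\<And>x. x \<in> Dom T \<Longrightarrow> \<Lambda> x \<in> Dom (adj S)"
  shows "\<exists>C\<ge>0. \<forall>x\<in>Dom T. norm (adj S \<cdot> \<Lambda> x) \<le> C * norm (x, T \<cdot> x)"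
proof -
  note gr = T(2) csubspace_graph[OF T(1)]
  define P where "P = ortho_proj (graph_of T)"
  have P_in: "P z \<in> graph_of T" for z
    unfolding P_def using gr by (rule ortho_proj_in)
  have "bounded_linear (\<lambda>z. \<Lambda> (fst (P z)))"
    using bounded_clinear_ortho_proj[OF gr]
    by (intro bounded_linear_compose[OF L(1)] bounded_linear_compose[OF bounded_linear_fst])
      (simp add: P_def bounded_clinear_def)

  moreover have "\<Lambda> (fst (P z)) \<in> Dom (adj S)" for z
    using P_in[of z] L(2) by (auto simp: graph_of_def)
  ultimately obtain C where C: "C \<ge> 0" "\<And>z. norm (adj S \<cdot> \<Lambda> (fst (P z))) \<le> C * norm z"
    using adj_compose_bounded[OF S, of "\<lambda>z. \<Lambda> (fst (P z))"] by blast
  have "norm (adj S \<cdot> \<Lambda> x) \<le> C * norm (x, T \<cdot> x)" if "x \<in> Dom T" for x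
  proof -
    have "P (x, T \<cdot> x) = (x, T \<cdot> x)"
      unfolding P_def using that
      by (intro ortho_proj_eqI[OF gr(2)]) (auto simp: graph_of_def ortho_compl_def)
    then show ?thesis using C(2)[of "(x, T \<cdot> x)"] by simp
  qed
  with C(1) show ?thesis by blast
qed

context clifford_normal
begin

lemma linear_adj_D: "op_linear (adj D)"
  using dense_Dom_D by (rule op_linear_adj)

lemmas Dom_adj_D = op_linear_csubspace[OF linear_adj_D]
  and linear_D = symmetric_linear[OF D_symmetric]
  and Dom_D_subspace = op_linear_csubspace[OF symmetric_linear[OF D_symmetric]]
  and Dom_D_adj = symmetric_Dom_adj[OF D_symmetric]
  and adj_D_eq = symmetric_adj[OF D_symmetric]

lemma Dom_D_simps:
  "0 \<in> Dom D" "\<lbrakk>x \<in> Dom D; y \<in> Dom D\<rbrakk> \<Longrightarrow> x + y \<in> Dom D"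
  "\<lbrakk>x \<in> Dom D; y \<in> Dom D\<rbrakk> \<Longrightarrow> x - y \<in> Dom D" "x \<in> Dom D \<Longrightarrow> - x \<in> Dom D"
  "x \<in> Dom D \<Longrightarrow> c *\<^sub>C x \<in> Dom D"
  using Dom_D_subspace csubspace_diff[OF Dom_D_subspace] csubspace_neg[OF Dom_D_subspace]
  by (simp_all add: csubspace_def)

lemma Dom_adj_simps:
  "0 \<in> Dom (adj D)" "\<lbrakk>x \<in> Dom (adj D); y \<in> Dom (adj D)\<rbrakk> \<Longrightarrow> x + y \<in> Dom (adj D)"
  "\<lbrakk>x \<in> Dom (adj D); y \<in> Dom (adj D)\<rbrakk> \<Longrightarrow> x - y \<in> Dom (adj D)"
  "x \<in> Dom (adj D) \<Longrightarrow> - x \<in> Dom (adj D)" "x \<in> Dom (adj D) \<Longrightarrow> c *\<^sub>C x \<in> Dom (adj D)"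
  using Dom_adj_D csubspace_diff[OF Dom_adj_D] csubspace_neg[OF Dom_adj_D]
  by (simp_all add: csubspace_def)

lemma
  shows gamma_gamma: "\<gamma> (\<gamma> x) = x"
    and gamma_cinner: "cinner (\<gamma> x) y = cinner x (\<gamma> y)"
    and bounded_linear_gamma: "bounded_linear \<gamma>"
    and gamma_scaleC: "\<gamma> (c *\<^sub>C x) = c *\<^sub>C \<gamma> x"
  using grading_H by (auto simp: hilbert_grading_def bounded_clinear_def)

lemmas gamma_add = linear_add[OF bounded_linear.linear[OF bounded_linear_gamma]]
  and gamma_diff = linear_diff[OF bounded_linear.linear[OF bounded_linear_gamma]]
  and gamma_neg = linear_neg[OF bounded_linear.linear[OF bounded_linear_gamma]]
  and gamma_zero = linear_0[OF bounded_linear.linear[OF bounded_linear_gamma]]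

lemma bounded_linear_n: "bounded_linear n" and n_scaleC: "n (c *\<^sub>C x) = c *\<^sub>C n x"
  using n_bounded by (auto simp: bounded_clinear_def)

lemmas n_add = linear_add[OF bounded_linear.linear[OF bounded_linear_n]]
  and n_diff = linear_diff[OF bounded_linear.linear[OF bounded_linear_n]]
  and n_neg = linear_neg[OF bounded_linear.linear[OF bounded_linear_n]]
  and n_zero = linear_0[OF bounded_linear.linear[OF bounded_linear_n]]

lemma n_gamma: "n (\<gamma> x) = - \<gamma> (n x)"
  using n_odd by (simp add: odd_op_def everywhere_def)

lemma gamma_n_gamma: "\<gamma> (n (\<gamma> x)) = - n x"
  by (simp add: n_gamma gamma_neg gamma_gamma)

lemma gamma_Dom_D: "x \<in> Dom D \<Longrightarrow> \<gamma> x \<in> Dom D" "x \<in> Dom D \<Longrightarrow> D \<cdot> \<gamma> x = - \<gamma> (D \<cdot> x)"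
  using D_odd by (auto simp: odd_op_def)

lemma gamma_Dom_D_iff: "\<gamma> x \<in> Dom D \<longleftrightarrow> x \<in> Dom D"
  using gamma_Dom_D(1)[of x] gamma_Dom_D(1)[of "\<gamma> x"] by (auto simp: gamma_gamma)

lemma
  assumes x: "x \<in> Dom (adj D)"
  shows gamma_Dom_adj: "\<gamma> x \<in> Dom (adj D)" and adj_gamma: "adj D \<cdot> \<gamma> x = - \<gamma> (adj D \<cdot> x)"
proof -
  have "cinner (- \<gamma> (adj D \<cdot> x)) y = cinner (\<gamma> x) (D \<cdot> y)" if "y \<in> Dom D" for y
    using adj_cinner[OF dense_Dom_D x gamma_Dom_D(1)[OF that]] gamma_Dom_D(2)[OF that]
    by (simp add: gamma_cinner)
  from adjI[OF dense_Dom_D this]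
  show "\<gamma> x \<in> Dom (adj D)" "adj D \<cdot> \<gamma> x = - \<gamma> (adj D \<cdot> x)" by blast+
qed

lemma n_Dom_D: "x \<in> Dom D \<Longrightarrow> n x \<in> Dom D"
  using n_Dom by blast

lemma Dom_D_Dom_n: "x \<in> Dom D \<Longrightarrow> x \<in> Dom_n D n"
  by (simp add: Dom_n_def Dom_D_adj n_Dom_D)

lemma Dom_n_simps:
  "0 \<in> Dom_n D n" "\<lbrakk>x \<in> Dom_n D n; y \<in> Dom_n D n\<rbrakk> \<Longrightarrow> x + y \<in> Dom_n D n"
  "\<lbrakk>x \<in> Dom_n D n; y \<in> Dom_n D n\<rbrakk> \<Longrightarrow> x - y \<in> Dom_n D n"
  "x \<in> Dom_n D n \<Longrightarrow> - x \<in> Dom_n D n" "x \<in> Dom_n D n \<Longrightarrow> c *\<^sub>C x \<in> Dom_n D n"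
  by (simp_all add: Dom_n_def Dom_adj_simps n_zero n_add n_diff n_neg n_scaleC)

lemma Dom_n_Dom_adj: "x \<in> Dom_n D n \<Longrightarrow> x \<in> Dom (adj D)"
  and Dom_n_n_Dom_adj: "x \<in> Dom_n D n \<Longrightarrow> n x \<in> Dom (adj D)"
  by (simp_all add: Dom_n_def)

lemma n_Dom_n:
  assumes "x \<in> Dom_n D n"
  shows "n x \<in> Dom_n D n"
proof -
  have "(n (n x) + x) - x \<in> Dom (adj D)"
    using assms by (intro Dom_adj_simps Dom_D_adj n_square Dom_n_Dom_adj)
  then show ?thesis
    using assms by (simp add: Dom_n_def)
qed

lemma gamma_Dom_n: "x \<in> Dom_n D n \<Longrightarrow> \<gamma> x \<in> Dom_n D n"
  by (simp add: Dom_n_def gamma_Dom_adj n_gamma Dom_adj_simps)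

lemma omega_add_left:
  "\<lbrakk>x \<in> Dom (adj D); x' \<in> Dom (adj D)\<rbrakk> \<Longrightarrow> \<omega> D (x + x') y = \<omega> D x y + \<omega> D x' y"
  by (simp add: \<omega>_def op_linear_add[OF linear_adj_D] cinner_add_left)

lemma omega_add_right:
  "\<lbrakk>y \<in> Dom (adj D); y' \<in> Dom (adj D)\<rbrakk> \<Longrightarrow> \<omega> D x (y + y') = \<omega> D x y + \<omega> D x y'"
  by (simp add: \<omega>_def op_linear_add[OF linear_adj_D] cinner_add_right)

lemma omega_scale_left: "x \<in> Dom (adj D) \<Longrightarrow> \<omega> D (c *\<^sub>C x) y = cnj c * \<omega> D x y"
  by (simp add: \<omega>_def op_linear_scaleC[OF linear_adj_D] cinner_scaleC_left algebra_simps)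

lemma omega_scale_right: "y \<in> Dom (adj D) \<Longrightarrow> \<omega> D x (c *\<^sub>C y) = c * \<omega> D x y"
  by (simp add: \<omega>_def op_linear_scaleC[OF linear_adj_D] cinner_scaleC_right algebra_simps)

lemma omega_neg_left: "x \<in> Dom (adj D) \<Longrightarrow> \<omega> D (- x) y = - \<omega> D x y"
  using omega_scale_left[of x "-1" y] by simp

lemma omega_neg_right: "y \<in> Dom (adj D) \<Longrightarrow> \<omega> D x (- y) = - \<omega> D x y"
  using omega_scale_right[of y x "-1"] by simp

lemma omega_Dom_D_left: "\<lbrakk>d \<in> Dom D; x \<in> Dom (adj D)\<rbrakk> \<Longrightarrow> \<omega> D d x = 0"
  by (simp add: \<omega>_def adj_D_eq adj_cinner_right[OF dense_Dom_D])

lemma omega_Dom_D_right: "\<lbrakk>d \<in> Dom D; x \<in> Dom (adj D)\<rbrakk> \<Longrightarrow> \<omega> D x d = 0"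
  by (simp add: \<omega>_def adj_D_eq adj_cinner[OF dense_Dom_D])

lemma omega_cong:
  assumes "x - x' \<in> Dom D" "y - y' \<in> Dom D"
    and "x' \<in> Dom (adj D)" "y' \<in> Dom (adj D)"
  shows "\<omega> D x y = \<omega> D x' y'"
proof -
  have "x = x' + (x - x')" "y = y' + (y - y')" "y \<in> Dom (adj D)"
    using assms Dom_adj_simps(2)[of y' "y - y'"] Dom_D_adj by auto
  then show ?thesis
    by (metis (no_types, opaque_lifting) assms omega_add_left omega_add_right Dom_D_adj omega_Dom_D_left
        omega_Dom_D_right add.right_neutral)
qed

lemma omega_gamma:
  "\<lbrakk>x \<in> Dom (adj D); y \<in> Dom (adj D)\<rbrakk> \<Longrightarrow> \<omega> D (\<gamma> x) (\<gamma> y) = - \<omega> D x y"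
  by (simp add: \<omega>_def adj_gamma gamma_cinner gamma_neg gamma_gamma)

lemma omega_gamma_left:
  "\<lbrakk>x \<in> Dom (adj D); y \<in> Dom (adj D)\<rbrakk> \<Longrightarrow> \<omega> D (\<gamma> x) y = - \<omega> D x (\<gamma> y)"
  using omega_gamma[of x "\<gamma> y"] by (simp add: gamma_Dom_adj gamma_gamma)

text \<open>This restates the symmetry of the commutator of \<open>n\<close> with the adjoint of \<open>D\<close>.\<close>

lemma omega_n:
  assumes x: "x \<in> Dom_n D n" and y: "y \<in> Dom_n D n"
  shows "\<omega> D x (n y) = - \<omega> D (n x) y"
proof -
  define C where "C = op_diff (op_comp (adj D) (everywhere n)) (op_comp (everywhere n) (adj D))"
  have "cinner (C \<cdot> x) y = cinner x (C \<cdot> y)"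
    using x y n_commutator unfolding C_def[symmetric]
    by (intro symmetric_cinner) (auto simp: C_def op_diff_def op_comp_def everywhere_def Dom_n_def)
  then show ?thesis
    by (simp add: C_def op_diff_def op_comp_def everywhere_def \<omega>_def cinner_diff_left
        cinner_diff_right n_skew algebra_simps)
qed

abbreviation dbl :: "('h \<times> 'h) operator" where
  "dbl \<equiv> double_op D \<gamma> n"

lemma mem_Dom_dbl:
  "(\<xi>, \<eta>) \<in> Dom dbl \<longleftrightarrow> \<xi> \<in> Dom_n D n \<and> \<eta> \<in> Dom_n D n \<and> \<eta> - n (\<gamma> \<xi>) \<in> Dom D"
  by (simp add: double_op_def)

lemma dbl_app: "dbl \<cdot> (\<xi>, \<eta>) = (adj D \<cdot> \<xi>, adj D \<cdot> \<eta>)"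
  by (simp add: double_op_def)

lemma linear_dbl: "op_linear dbl"
  unfolding op_linear_def csubspace_def
proof (intro conjI ballI allI)
  show "0 \<in> Dom dbl"
    by (simp add: zero_prod_def mem_Dom_dbl Dom_n_simps gamma_zero n_zero Dom_D_simps)
  fix p assume "p \<in> Dom dbl"
  then obtain \<xi> \<eta> where p: "p = (\<xi>, \<eta>)" "\<xi> \<in> Dom_n D n" "\<eta> \<in> Dom_n D n" "\<eta> - n (\<gamma> \<xi>) \<in> Dom D"
    by (cases p) (auto simp: mem_Dom_dbl)
  show "c *\<^sub>C p \<in> Dom dbl" for c
  proof -
    have "c *\<^sub>C \<eta> - n (\<gamma> (c *\<^sub>C \<xi>)) = c *\<^sub>C (\<eta> - n (\<gamma> \<xi>))"
      by (simp add: gamma_scaleC n_scaleC scaleC_diff_right)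
    then show ?thesis
      using p by (simp add: scaleC_prod_def mem_Dom_dbl Dom_n_simps Dom_D_simps)
  qed
  show "dbl \<cdot> (c *\<^sub>C p) = c *\<^sub>C dbl \<cdot> p" for c
    using p by (simp add: scaleC_prod_def dbl_app op_linear_scaleC[OF linear_adj_D] Dom_n_Dom_adj)
  fix q assume "q \<in> Dom dbl"
  then obtain \<xi>' \<eta>' where
    q: "q = (\<xi>', \<eta>')" "\<xi>' \<in> Dom_n D n" "\<eta>' \<in> Dom_n D n" "\<eta>' - n (\<gamma> \<xi>') \<in> Dom D"
    by (cases q) (auto simp: mem_Dom_dbl)
  have "(\<eta> + \<eta>') - n (\<gamma> (\<xi> + \<xi>')) \<in> Dom D"
    using Dom_D_simps(2)[OF p(4) q(4)] by (simp add: gamma_add n_add algebra_simps)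
  then show "p + q \<in> Dom dbl"
    using p q by (simp add: mem_Dom_dbl Dom_n_simps)
  show "dbl \<cdot> (p + q) = dbl \<cdot> p + dbl \<cdot> q"
    using p q by (simp add: dbl_app op_linear_add[OF linear_adj_D] Dom_n_Dom_adj)
qed

lemma Dom_D_Dom_dbl: "\<lbrakk>\<xi> \<in> Dom D; \<eta> \<in> Dom D\<rbrakk> \<Longrightarrow> (\<xi>, \<eta>) \<in> Dom dbl"
  by (simp add: mem_Dom_dbl Dom_D_Dom_n Dom_D_simps n_Dom_D gamma_Dom_D)

lemma dense_dbl: "closure (Dom dbl) = UNIV"
proof -
  have "Dom D \<times> Dom D \<subseteq> Dom dbl"
    using Dom_D_Dom_dbl by auto
  then have "closure (Dom D \<times> Dom D) \<subseteq> closure (Dom dbl)"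
    by (rule closure_mono)
  then show ?thesis
    by (auto simp: closure_Times dense_Dom_D)
qed

text \<open>Modulo \<open>Dom D\<close>, the operator \<open>n \<gamma>\<close> is an involution, because \<open>n\<^sup>2 = -1\<close> and \<open>n\<close> anticommutes with \<open>\<gamma>\<close>. The boundary condition
  is therefore symmetric in the two components.\<close>

lemma dbl_swap:
  assumes "(\<xi>, \<eta>) \<in> Dom dbl"
  shows "\<xi> - n (\<gamma> \<eta>) \<in> Dom D"
proof -
  define d where "d = \<eta> - n (\<gamma> \<xi>)"
  have d: "d \<in> Dom D" "\<xi> \<in> Dom_n D n"
    using assms by (simp_all add: d_def mem_Dom_dbl)
  have "\<eta> = n (\<gamma> \<xi>) + d" by (simp add: d_def)
  then have eq: "\<xi> - n (\<gamma> \<eta>) = (n (n \<xi>) + \<xi>) - n (\<gamma> d)"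
    by (simp add: gamma_add n_diff gamma_n_gamma)
  show ?thesis
    unfolding eq using d by (intro Dom_D_simps(3) n_square n_Dom_D gamma_Dom_D(1))
qed

text \<open>Modulo \<open>Dom D\<close>, the second components are the images of the first ones under \<open>n \<gamma>\<close>. The form \<open>\<omega>\<close> is preserved by \<open>n\<close>
  and changes its sign under \<open>\<gamma>\<close>, so that the two contributions cancel.\<close>

lemma omega_dbl:
  assumes x: "(\<xi>, \<eta>) \<in> Dom dbl" and y: "(\<xi>', \<eta>') \<in> Dom dbl"
  shows "\<omega> D \<xi> \<xi>' + \<omega> D \<eta> \<eta>' = 0"
proof -
  have mem: "\<gamma> \<xi> \<in> Dom_n D n" "\<gamma> \<xi>' \<in> Dom_n D n" "\<xi> \<in> Dom_n D n" "\<xi>' \<in> Dom_n D n"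
    using x y by (auto simp: mem_Dom_dbl gamma_Dom_n)
  have "\<omega> D \<eta> \<eta>' = \<omega> D (n (\<gamma> \<xi>)) (n (\<gamma> \<xi>'))"
    using x y mem by (intro omega_cong) (auto simp: mem_Dom_dbl Dom_n_n_Dom_adj)
  also have "\<dots> = - \<omega> D (n (n (\<gamma> \<xi>))) (\<gamma> \<xi>')"
    using mem by (intro omega_n n_Dom_n)
  also have "\<omega> D (n (n (\<gamma> \<xi>))) (\<gamma> \<xi>') = \<omega> D (- \<gamma> \<xi>) (\<gamma> \<xi>')"
    using mem n_square[OF mem(1)]
    by (intro omega_cong) (auto simp: Dom_D_simps Dom_adj_simps Dom_n_Dom_adj)
  also have "\<dots> = \<omega> D \<xi> \<xi>'"
    using mem by (simp add: omega_neg_left Dom_n_Dom_adj omega_gamma)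
  finally show ?thesis by simp
qed

lemma symmetric_dbl: "op_symmetric dbl"
proof -
  have "cinner (dbl \<cdot> x) y = cinner x (dbl \<cdot> y)" if "x \<in> Dom dbl" "y \<in> Dom dbl" for x y
  proof -
    obtain \<xi> \<eta> \<xi>' \<eta>' where [simp]: "x = (\<xi>, \<eta>)" "y = (\<xi>', \<eta>')"
      by (cases x, cases y)
    show ?thesis
      using omega_dbl[of \<xi> \<eta> \<xi>' \<eta>'] that
      by (simp add: dbl_app cinner_prod_def \<omega>_def algebra_simps)
  qed
  then show ?thesis
    using linear_dbl dense_dbl by (simp add: op_symmetric_def)
qed

text \<open>Testing with \<open>Dom D \<times> Dom D\<close> shows that both components \<open>w\<close>, \<open>z\<close> of a vector in the domain of the adjoint lie in the
  domain of the adjoint of \<open>D\<close>. Testing with \<open>(\<gamma> \<zeta>, n \<zeta>)\<close> then gives \<open>\<omega>(z, n \<zeta>) = \<omega>(\<gamma> w, \<zeta>)\<close>, which is the hypothesis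
  of the maximality axiom for the pair \<open>z\<close>, \<open>- \<gamma> w\<close>. Its conclusion is the boundary condition.\<close>

lemma self_adjoint_dbl: "self_adjoint dbl"
proof -
  have "p \<in> Dom dbl" if p: "p \<in> Dom (adj dbl)" for p
  proof -
    obtain w z where [simp]: "p = (w, z)" by (cases p)
    obtain w' z' where wz': "adj dbl \<cdot> p = (w', z')" by (cases "adj dbl \<cdot> p")
    have eq: "cinner w' \<xi> + cinner z' \<eta> = cinner w (adj D \<cdot> \<xi>) + cinner z (adj D \<cdot> \<eta>)"
      if "(\<xi>, \<eta>) \<in> Dom dbl" for \<xi> \<eta>
      using adj_cinner[OF dense_dbl p that] wz' by (simp add: cinner_prod_def dbl_app)
    have "cinner w' \<xi> = cinner w (D \<cdot> \<xi>)" if "\<xi> \<in> Dom D" for \<xi>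
      using eq[OF Dom_D_Dom_dbl[OF that Dom_D_simps(1)]] that
      by (simp add: adj_D_eq op_linear_zero[OF linear_adj_D])
    from adjI[OF dense_Dom_D this] have w: "w \<in> Dom (adj D)" "adj D \<cdot> w = w'" by blast+
    have "cinner z' \<eta> = cinner z (D \<cdot> \<eta>)" if "\<eta> \<in> Dom D" for \<eta>
      using eq[OF Dom_D_Dom_dbl[OF Dom_D_simps(1) that]] that
      by (simp add: adj_D_eq op_linear_zero[OF linear_adj_D])
    from adjI[OF dense_Dom_D this] have z: "z \<in> Dom (adj D)" "adj D \<cdot> z = z'" by blast+
    have gw: "- \<gamma> w \<in> Dom (adj D)"
      using w(1) by (simp add: gamma_Dom_adj Dom_adj_simps)
    have "cinner z (adj D \<cdot> n \<zeta>) - cinner (adj D \<cdot> z) (n \<zeta>)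
        = - cinner (- \<gamma> w) (adj D \<cdot> \<zeta>) + cinner (adj D \<cdot> (- \<gamma> w)) \<zeta>"
      if \<zeta>: "\<zeta> \<in> Dom_n D n" for \<zeta>
    proof -
      have "(\<gamma> \<zeta>, n \<zeta>) \<in> Dom dbl"
        using \<zeta> by (simp add: mem_Dom_dbl gamma_Dom_n n_Dom_n gamma_gamma Dom_D_simps)
      from eq[OF this] have "\<omega> D z (n \<zeta>) = - \<omega> D w (\<gamma> \<zeta>)"
        using w(2) z(2) by (simp add: \<omega>_def algebra_simps)
      also have "\<dots> = - \<omega> D (- \<gamma> w) \<zeta>"
        using w(1) \<zeta> by (simp add: omega_gamma_left omega_neg_left gamma_Dom_adj Dom_n_Dom_adj)
      finally show ?thesis
        by (simp add: \<omega>_def algebra_simps)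
    qed
    from n_maximal[OF z(1) gw this] have d: "z - n (\<gamma> w) \<in> Dom D"
      by (simp add: n_neg)
    have "z - (z - n (\<gamma> w)) \<in> Dom (adj D)"
      using z(1) Dom_D_adj[OF d] by (rule Dom_adj_simps(3))
    then have "n (\<gamma> w) \<in> Dom (adj D)" by simp
    then have gw_n: "\<gamma> w \<in> Dom_n D n"
      using w(1) by (simp add: Dom_n_def gamma_Dom_adj)
    then have "w \<in> Dom_n D n"
      using gamma_Dom_n[of "\<gamma> w"] by (simp add: gamma_gamma)
    moreover have "z \<in> Dom_n D n"
      using Dom_n_simps(2)[OF n_Dom_n[OF gw_n] Dom_D_Dom_n[OF d]] by simp
    ultimately show ?thesis
      using d by (simp add: mem_Dom_dbl)
  qed
  then show ?thesis
    using symmetric_dbl by (auto simp: self_adjoint_def)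
qed

text \<open>The symmetry \<open>G\<close> of the introduction. Its two factors are the exchange of the components, which commutes with \<open>dbl\<close>, and the grading
  \<open>\<gamma> \<oplus> \<gamma>\<close>, which anticommutes with the adjoint of \<open>D\<close> but does not preserve the domain of \<open>dbl\<close>.\<close>

definition swap_gamma :: "'h \<times> 'h \<Rightarrow> 'h \<times> 'h" where
  "swap_gamma p = (\<gamma> (snd p), \<gamma> (fst p))"

text \<open>The symmetry \<open>E\<close> of the introduction, which fixes the domain of \<open>dbl\<close> pointwise modulo \<open>Dom D \<times> Dom D\<close>.\<close>

definition swap_n_gamma :: "'h \<times> 'h \<Rightarrow> 'h \<times> 'h" where
  "swap_n_gamma p = (n (\<gamma> (snd p)), n (\<gamma> (fst p)))"

lemma bounded_linear_swap_gamma: "bounded_linear swap_gamma"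
  unfolding swap_gamma_def[abs_def]
  by (intro bounded_linear_Pair bounded_linear_compose[OF bounded_linear_gamma]
      bounded_linear_fst bounded_linear_snd)

lemma bounded_linear_swap_n_gamma: "bounded_linear swap_n_gamma"
  unfolding swap_n_gamma_def[abs_def]
  by (intro bounded_linear_Pair bounded_linear_compose[OF bounded_linear_n]
      bounded_linear_compose[OF bounded_linear_gamma] bounded_linear_fst bounded_linear_snd)

lemma swap_gamma_simps:
  "swap_gamma (swap_gamma p) = p" "cinner (swap_gamma p) q = cinner p (swap_gamma q)"
  "swap_gamma (c *\<^sub>C p) = c *\<^sub>C swap_gamma p" "swap_gamma (p + q) = swap_gamma p + swap_gamma q"
  "swap_n_gamma (swap_gamma p) = - swap_gamma (swap_n_gamma p)"
  by (simp_all add: swap_gamma_def swap_n_gamma_def gamma_gamma cinner_prod_def gamma_cinner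
      scaleC_prod_def gamma_scaleC gamma_n_gamma gamma_add uminus_prod_def)

text \<open>The boundary condition replaces \<open>\<gamma> \<eta>\<close> by \<open>- n \<xi>\<close> and \<open>\<gamma> \<xi>\<close> by \<open>- n \<eta>\<close>, and turns the form into
  \<open>\<omega>(\<xi>, n \<xi>) + \<omega>(\<eta>, n \<eta>)\<close>.\<close>

lemma swap_gamma_positive:
  assumes "p \<in> Dom dbl"
  shows "0 \<le> Re (cinner (dbl \<cdot> p) (swap_gamma p) + cinner (swap_gamma p) (dbl \<cdot> p))"
proof -
  obtain \<xi> \<eta> where [simp]: "p = (\<xi>, \<eta>)" by (cases p)
  have mem: "\<xi> \<in> Dom_n D n" "\<eta> \<in> Dom_n D n" "\<eta> - n (\<gamma> \<xi>) \<in> Dom D" "\<xi> - n (\<gamma> \<eta>) \<in> Dom D"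
    using assms dbl_swap[of \<xi> \<eta>] by (simp_all add: mem_Dom_dbl)
  have 1: "\<gamma> \<eta> - (- n \<xi>) \<in> Dom D" "\<gamma> \<xi> - (- n \<eta>) \<in> Dom D"
    using gamma_Dom_D(1)[OF mem(3)] gamma_Dom_D(1)[OF mem(4)] by (simp_all add: gamma_diff gamma_n_gamma)
  have 2: "cinner (dbl \<cdot> p) (swap_gamma p) + cinner (swap_gamma p) (dbl \<cdot> p)
      = - \<omega> D \<xi> (\<gamma> \<eta>) - \<omega> D \<eta> (\<gamma> \<xi>)"
    using mem by (simp add: dbl_app swap_gamma_def cinner_prod_def \<omega>_def adj_gamma Dom_n_Dom_adj gamma_cinner)
  have 3: "\<omega> D \<xi> (\<gamma> \<eta>) = - \<omega> D \<xi> (n \<xi>)"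
    using omega_cong[of \<xi> \<xi> "\<gamma> \<eta>" "- n \<xi>"] mem 1(1)
    by (simp add: Dom_D_simps Dom_adj_simps Dom_n_Dom_adj Dom_n_n_Dom_adj omega_neg_right)
  have 4: "\<omega> D \<eta> (\<gamma> \<xi>) = - \<omega> D \<eta> (n \<eta>)"
    using omega_cong[of \<eta> \<eta> "\<gamma> \<xi>" "- n \<eta>"] mem 1(2)
    by (simp add: Dom_D_simps Dom_adj_simps Dom_n_Dom_adj Dom_n_n_Dom_adj omega_neg_right)
  have "0 \<le> Re (\<omega> D \<xi> (n \<xi>))" "0 \<le> Re (\<omega> D \<eta> (n \<eta>))"
    using n_positive mem(1,2) unfolding \<omega>_def[symmetric] by (auto simp: complex_nonneg_Reals_iff)
  then show ?thesis
    unfolding 2 3 4 by simp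
qed

text \<open>The kernel is invariant under \<open>swap_gamma\<close>. The boundary conditions for a vector and for its image have opposite signs,
  so that adding them leaves twice the vector in \<open>Dom D \<times> Dom D\<close>.\<close>

lemma ker_dbl: "ker dbl = ker D \<times> ker D"
proof (intro equalityI subsetI)
  fix p assume p: "p \<in> ker dbl"
  obtain \<xi> \<eta> where [simp]: "p = (\<xi>, \<eta>)" by (cases p)
  have mem: "(\<xi>, \<eta>) \<in> Dom dbl" "adj D \<cdot> \<xi> = 0" "adj D \<cdot> \<eta> = 0"
    using p by (auto simp: ker_def dbl_app zero_prod_def)
  have "swap_gamma p \<in> ker dbl"
    using p
    by (intro anticommutator_kernel[OF self_adjoint_dbl swap_gamma_simps(1,2,4,3) swap_gamma_positive])
  then have g: "(\<gamma> \<eta>, \<gamma> \<xi>) \<in> Dom dbl"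
    by (simp add: swap_gamma_def ker_def)
  have "\<gamma> \<xi> - n \<eta> \<in> Dom D" "\<gamma> \<eta> - n \<xi> \<in> Dom D"
    using g dbl_swap[OF g] by (simp_all add: mem_Dom_dbl gamma_gamma)
  from this[THEN gamma_Dom_D(1)] have "\<xi> + n (\<gamma> \<eta>) \<in> Dom D" "\<eta> + n (\<gamma> \<xi>) \<in> Dom D"
    by (simp_all add: gamma_diff gamma_gamma n_gamma)
  moreover have "\<xi> - n (\<gamma> \<eta>) \<in> Dom D" "\<eta> - n (\<gamma> \<xi>) \<in> Dom D"
    using mem(1) dbl_swap by (simp_all add: mem_Dom_dbl)
  ultimately have "(\<xi> + n (\<gamma> \<eta>)) + (\<xi> - n (\<gamma> \<eta>)) \<in> Dom D" "(\<eta> + n (\<gamma> \<xi>)) + (\<eta> - n (\<gamma> \<xi>)) \<in> Dom D"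
    by (simp_all only: Dom_D_simps(2))
  then have "\<xi> + \<xi> \<in> Dom D" "\<eta> + \<eta> \<in> Dom D" by simp_all
  from this[THEN subspace_scale[OF csubspace_subspace[OF Dom_D_subspace], of _ "1/2"]]
  have "\<xi> \<in> Dom D" "\<eta> \<in> Dom D"
    by (simp_all flip: scaleR_2)
  then show "p \<in> ker D \<times> ker D"
    using mem by (simp add: ker_def adj_D_eq)
next
  fix p assume "p \<in> ker D \<times> ker D"
  then show "p \<in> ker dbl"
    by (auto simp: ker_def dbl_app adj_D_eq Dom_D_Dom_dbl zero_prod_def)
qed

end

section \<open>Solutions of the doubled problem\<close>

lemma graph_norm_eq: "graph_norm T x = norm (x, T \<cdot> x)" for x :: "'h::complex_hilbert"
  by (simp add: graph_norm_def norm_Pair)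

context unital_clifford_normal
begin

text \<open>The two components of \<open>p - swap_n_gamma p\<close> lie in \<open>Dom D\<close>, with graph norm bounded by that of
  \<open>p\<close>, and \<open>Dom D\<close> is compactly embedded.\<close>

lemma Dom_dbl_compact:
  fixes p :: "nat \<Rightarrow> 'h \<times> 'h"
  assumes p: "\<And>k. p k \<in> Dom dbl \<and> norm (p k) \<le> 1 \<and> norm (dbl \<cdot> p k) \<le> 1"
  shows "\<exists>r l. strict_mono r \<and> (\<lambda>k. p (r k) - swap_n_gamma (p (r k))) \<longlonglongrightarrow> l"
proof -
  note cl = closed_graph_self_adjoint[OF self_adjoint_dbl]
  interpret E: bounded_linear swap_n_gamma by (rule bounded_linear_swap_n_gamma)
  define \<Lambda> where "\<Lambda> q = q - swap_n_gamma q" for q :: "'h \<times> 'h"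
  have L: "bounded_linear \<Lambda>"
    unfolding \<Lambda>_def[abs_def] by (intro bounded_linear_sub bounded_linear_ident E.bounded_linear_axioms)
  have L_Dom: "fst (\<Lambda> q) \<in> Dom D" "snd (\<Lambda> q) \<in> Dom D" if "q \<in> Dom dbl" for q
    using that dbl_swap[of "fst q" "snd q"] mem_Dom_dbl[of "fst q" "snd q"]
    by (simp_all add: \<Lambda>_def swap_n_gamma_def)
  obtain K where K: "K \<ge> 0" "\<And>q. norm (\<Lambda> q) \<le> K * norm q"
    using bounded_linear.nonneg_bounded[OF L] by (metis mult.commute)
  have bound: "\<exists>M. \<forall>k. norm (f (\<Lambda> (p k)), D \<cdot> f (\<Lambda> (p k))) \<le> M"
    if f: "bounded_linear f" "\<And>q. q \<in> Dom dbl \<Longrightarrow> f (\<Lambda> q) \<in> Dom D" "\<And>q. norm (f q) \<le> norm q"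
    for f :: "'h \<times> 'h \<Rightarrow> 'h"
  proof -
    have "bounded_linear (\<lambda>q. f (\<Lambda> q))"
      by (rule bounded_linear_compose[OF f(1) L])
    from adj_bounded_on_graph[OF linear_dbl cl dense_Dom_D this] f(2)
    obtain C where C: "C \<ge> 0" "\<And>q. q \<in> Dom dbl \<Longrightarrow> norm (adj D \<cdot> f (\<Lambda> q)) \<le> C * norm (q, dbl \<cdot> q)"
      by (meson Dom_D_adj)
    have "norm (f (\<Lambda> (p k)), D \<cdot> f (\<Lambda> (p k))) \<le> K + C * 2" for k
    proof -
      have "norm (p k, dbl \<cdot> p k) \<le> 2"
        using p[of k] norm_Pair_le[of "p k" "dbl \<cdot> p k"] by linarith
      then have "C * norm (p k, dbl \<cdot> p k) \<le> C * 2"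
        using C(1) by (rule mult_left_mono)
      then have "norm (D \<cdot> f (\<Lambda> (p k))) \<le> C * 2"
        using C(2)[of "p k"] p[of k] f(2)[of "p k"] by (simp add: adj_D_eq)
      moreover have "norm (f (\<Lambda> (p k))) \<le> K"
      proof -
        have "norm (f (\<Lambda> (p k))) \<le> K * norm (p k)"
          using f(3)[of "\<Lambda> (p k)"] K(2)[of "p k"] by linarith
        also have "\<dots> \<le> K * 1"
          using p[of k] K(1) by (intro mult_left_mono) auto
        finally show ?thesis by simp
      qed
      ultimately show ?thesis
        using norm_Pair_le[of "f (\<Lambda> (p k))" "D \<cdot> f (\<Lambda> (p k))"] by linarith
    qed
    then show ?thesis by blast
  qed
  obtain M1 where M1: "\<And>k. norm (fst (\<Lambda> (p k)), D \<cdot> fst (\<Lambda> (p k))) \<le> M1"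
    using bound[OF bounded_linear_fst] L_Dom(1) norm_fst_le by (metis prod.collapse)
  obtain M2 where M2: "\<And>k. norm (snd (\<Lambda> (p k)), D \<cdot> snd (\<Lambda> (p k))) \<le> M2"
    using bound[OF bounded_linear_snd] L_Dom(2) norm_snd_le by (metis prod.collapse)
  obtain r1 l1 where r1: "strict_mono r1" "(\<lambda>k. fst (\<Lambda> (p (r1 k)))) \<longlonglongrightarrow> l1"
    by (rule Dom_D_compact_embedding[of "\<lambda>k. fst (\<Lambda> (p k))" M1]) (use L_Dom p M1 in auto)
  obtain r2 l2 where r2: "strict_mono r2" "(\<lambda>k. snd (\<Lambda> (p (r1 (r2 k))))) \<longlonglongrightarrow> l2"
    by (rule Dom_D_compact_embedding[of "\<lambda>k. snd (\<Lambda> (p (r1 k)))" M2]) (use L_Dom p M2 in auto)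
  have "(\<lambda>k. fst (\<Lambda> (p (r1 (r2 k))))) \<longlonglongrightarrow> l1"
    using LIMSEQ_subseq_LIMSEQ[OF r1(2) r2(1)] by (simp add: o_def)
  from tendsto_Pair[OF this r2(2)] have "(\<lambda>k. \<Lambda> (p (r1 (r2 k)))) \<longlonglongrightarrow> (l1, l2)"
    by simp
  moreover have "strict_mono (r1 \<circ> r2)"
    using r1(1) r2(1) by (rule strict_mono_o)
  ultimately show ?thesis
    by (intro exI[of _ "r1 \<circ> r2"] exI[of _ "(l1, l2)"]) (simp add: \<Lambda>_def)
qed

lemma dbl_lower_bound:
  "\<exists>C\<ge>0. \<forall>p\<in>Dom dbl. p \<in> ortho_compl (ker dbl) \<longrightarrow> norm p \<le> C * norm (dbl \<cdot> p)"
  by (rule lower_bound_by_anticommuting_symmetries[OF self_adjoint_dbl bounded_linear_swap_gamma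
        swap_gamma_simps(1,2,3) swap_gamma_positive bounded_linear_swap_n_gamma
        swap_gamma_simps(5) Dom_dbl_compact])

lemma
  shows closed_ker_D: "closed (ker D)" and csubspace_ker_D: "csubspace (ker D)"
  using closed_ker[of D] D_closed csubspace_ker[OF linear_D] by (simp_all add: op_closed_def)

lemmas ker_proj_in = ortho_proj_in[OF closed_ker_D csubspace_ker_D]
  and ker_proj_ortho = ortho_proj_ortho[OF closed_ker_D csubspace_ker_D]
  and ker_proj_eqI = ortho_proj_eqI[OF csubspace_ker_D]

lemma ortho_compl_ker_dbl:
  "(\<xi>, \<eta>) \<in> ortho_compl (ker dbl) \<longleftrightarrow> \<xi> \<in> ortho_compl (ker D) \<and> \<eta> \<in> ortho_compl (ker D)"
proof
  have 0: "0 \<in> ker D" using csubspace_ker_D by (simp add: csubspace_def)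
  assume *: "(\<xi>, \<eta>) \<in> ortho_compl (ker dbl)"
  have "cinner k \<xi> = 0" "cinner k \<eta> = 0" if "k \<in> ker D" for k
  proof -
    have "(k, 0) \<in> ker dbl" "(0, k) \<in> ker dbl"
      using that 0 by (simp_all add: ker_dbl)
    with * have "cinner (k, 0) (\<xi>, \<eta>) = 0" "cinner (0, k) (\<xi>, \<eta>) = 0"
      unfolding ortho_compl_def by blast+
    then show "cinner k \<xi> = 0" "cinner k \<eta> = 0"
      by (simp_all add: cinner_prod_def)
  qed
  then show "\<xi> \<in> ortho_compl (ker D) \<and> \<eta> \<in> ortho_compl (ker D)"
    by (simp add: ortho_compl_def)
qed (auto simp: ortho_compl_def ker_dbl cinner_prod_def)

lemma proj_ker_dbl: "ortho_proj (ker dbl) (v, 0) = (ortho_proj (ker D) v, 0)"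
proof (rule ortho_proj_eqI[OF csubspace_ker[OF linear_dbl]])
  have "0 \<in> ker D" using csubspace_ker_D by (simp add: csubspace_def)
  then show "(ortho_proj (ker D) v, 0) \<in> ker dbl"
    using ker_proj_in by (simp add: ker_dbl)
  show "(v, 0) - (ortho_proj (ker D) v, 0) \<in> ortho_compl (ker dbl)"
    using ker_proj_ortho csubspace_ortho_compl[of "ker D"]
    by (simp add: ortho_compl_ker_dbl csubspace_def)
qed

text \<open>The vector \<open>r\<^sub>1 D\<^sup>~\<^sup>-\<^sup>1 e\<^sub>1 v\<close>, where \<open>D\<^sup>~\<close> is the doubled operator.\<close>

definition doubled_solution :: "'h \<Rightarrow> 'h" where
  "doubled_solution v = r1 (pseudoinverse dbl (e1 v))"

lemma doubled_solution:
  obtains \<eta> where "(doubled_solution v, \<eta>) \<in> Dom dbl"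
    "doubled_solution v \<in> ortho_compl (ker D)" "\<eta> \<in> ortho_compl (ker D)"
    "adj D \<cdot> doubled_solution v = v - ortho_proj (ker D) v" "adj D \<cdot> \<eta> = 0"
proof -
  obtain C where "\<And>p. \<lbrakk>p \<in> Dom dbl; p \<in> ortho_compl (ker dbl)\<rbrakk> \<Longrightarrow> norm p \<le> C * norm (dbl \<cdot> p)"
    using dbl_lower_bound by blast
  note pinv = self_adjoint_pseudoinverse(1-3)[OF self_adjoint_dbl this]
  obtain \<xi> \<eta> where p: "pseudoinverse dbl (e1 v) = (\<xi>, \<eta>)"
    by (cases "pseudoinverse dbl (e1 v)")
  have \<xi>: "doubled_solution v = \<xi>"
    by (simp add: doubled_solution_def p r1_def)
  show thesis
  proof (rule that)
    show "(doubled_solution v, \<eta>) \<in> Dom dbl"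
      using pinv(1)[of "e1 v"] by (simp add: p \<xi>)
    show "doubled_solution v \<in> ortho_compl (ker D)" "\<eta> \<in> ortho_compl (ker D)"
      using pinv(2)[of "e1 v"] by (simp_all add: p \<xi> ortho_compl_ker_dbl)
    show "adj D \<cdot> doubled_solution v = v - ortho_proj (ker D) v" "adj D \<cdot> \<eta> = 0"
      using pinv(3)[of "e1 v"] unfolding p by (simp_all add: \<xi> dbl_app e1_def proj_ker_dbl)
  qed
qed

lemma doubled_solution_eqI:
  assumes "(\<xi>, \<eta>) \<in> Dom dbl" "\<xi> \<in> ortho_compl (ker D)" "\<eta> \<in> ortho_compl (ker D)"
    and "adj D \<cdot> \<xi> = v - ortho_proj (ker D) v" "adj D \<cdot> \<eta> = 0"
  shows "doubled_solution v = \<xi>"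
proof -
  obtain C where "\<And>p. \<lbrakk>p \<in> Dom dbl; p \<in> ortho_compl (ker dbl)\<rbrakk> \<Longrightarrow> norm p \<le> C * norm (dbl \<cdot> p)"
    using dbl_lower_bound by blast
  from self_adjoint_pseudoinverse(4)[OF self_adjoint_dbl this, of "(\<xi>, \<eta>)" "e1 v"]
  have "pseudoinverse dbl (e1 v) = (\<xi>, \<eta>)"
    using assms by (simp add: ortho_compl_ker_dbl dbl_app e1_def proj_ker_dbl)
  then show ?thesis
    by (simp add: doubled_solution_def r1_def)
qed

lemma bounded_clinear_doubled_solution: "bounded_clinear doubled_solution"
proof -
  obtain C where "C \<ge> 0"
    "\<And>p. \<lbrakk>p \<in> Dom dbl; p \<in> ortho_compl (ker dbl)\<rbrakk> \<Longrightarrow> norm p \<le> C * norm (dbl \<cdot> p)"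
    using dbl_lower_bound by blast
  from bounded_clinear_pseudoinverse[OF self_adjoint_dbl this]
  have p: "bounded_linear (pseudoinverse dbl)" "\<And>c x. pseudoinverse dbl (c *\<^sub>C x) = c *\<^sub>C pseudoinverse dbl x"
    unfolding bounded_clinear_def by blast+
  have "bounded_linear (\<lambda>v. (v, 0) :: 'h \<times> 'h)"
    by (intro bounded_linear_Pair bounded_linear_ident bounded_linear_zero)
  from bounded_linear_compose[OF bounded_linear_fst bounded_linear_compose[OF p(1) this]]
  have "bounded_linear doubled_solution"
    by (simp add: doubled_solution_def[abs_def] r1_def e1_def)
  moreover have "doubled_solution (c *\<^sub>C v) = c *\<^sub>C doubled_solution v" for c v
  proof -
    have "e1 (c *\<^sub>C v) = c *\<^sub>C (e1 v :: 'h \<times> 'h)"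
      by (simp add: e1_def scaleC_prod_def)
    then show ?thesis
      by (simp add: doubled_solution_def r1_def p(2)) (simp add: scaleC_prod_def)
  qed
  ultimately show ?thesis
    by (simp add: bounded_clinear_def)
qed

abbreviation poisson :: "'h \<Rightarrow> 'h" where
  "poisson \<equiv> poisson_vector D \<gamma> n"

lemma poisson_eq: "poisson v = n (doubled_solution v)"
  by (simp add: poisson_vector_def doubled_solution_def)

lemma doubled_solution_Dom_n: "doubled_solution v \<in> Dom_n D n"
  by (rule doubled_solution[of v]) (simp add: mem_Dom_dbl)

lemma adj_doubled_solution: "adj D \<cdot> doubled_solution v = v - ortho_proj (ker D) v"
  by (rule doubled_solution[of v])

lemma poisson_Dom_n: "poisson v \<in> Dom_n D n"
  by (simp add: poisson_eq n_Dom_n doubled_solution_Dom_n)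

lemma bounded_clinear_poisson: "bounded_clinear poisson"
  using bounded_clinear_doubled_solution bounded_linear_compose[OF bounded_linear_n, of doubled_solution]
  by (simp add: bounded_clinear_def poisson_eq[abs_def] n_scaleC)

lemma graph_norm_n_le: "graph_norm_n D n x \<le> norm x + norm (adj D \<cdot> x) + norm (n x) + norm (adj D \<cdot> n x)"
proof -
  have "graph_norm_n D n x = norm ((x, adj D \<cdot> x), (n x, adj D \<cdot> n x))"
    by (simp add: graph_norm_n_def graph_norm_eq norm_Pair)
  then show ?thesis
    using norm_Pair_le[of "(x, adj D \<cdot> x)" "(n x, adj D \<cdot> n x)"] norm_Pair_le[of x "adj D \<cdot> x"]
      norm_Pair_le[of "n x" "adj D \<cdot> n x"] by linarith
qed

text \<open>Both \<open>poisson\<close> and \<open>n \<circ> poisson\<close> are bounded with values in the domain of the adjoint of \<open>D\<close>. Composing them with this adjoint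
  gives bounded operators again.\<close>

lemma poisson_bounded: "\<exists>C\<ge>0. \<forall>v. graph_norm_n D n (poisson v) \<le> C * norm v"
proof -
  have p: "bounded_linear poisson"
    using bounded_clinear_poisson by (simp add: bounded_clinear_def)
  have np: "bounded_linear (\<lambda>v. n (poisson v))"
    by (rule bounded_linear_compose[OF bounded_linear_n p])
  obtain C1 where C1: "C1 \<ge> 0" "\<And>v. norm (poisson v) \<le> norm v * C1"
    using bounded_linear.nonneg_bounded[OF p] by blast
  obtain C2 where C2: "C2 \<ge> 0" "\<And>v. norm (n (poisson v)) \<le> norm v * C2"
    using bounded_linear.nonneg_bounded[OF np] by blast
  obtain C3 where C3: "C3 \<ge> 0" "\<And>v. norm (adj D \<cdot> poisson v) \<le> C3 * norm v"
    using adj_compose_bounded[OF dense_Dom_D p] Dom_n_Dom_adj[OF poisson_Dom_n] by blast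
  obtain C4 where C4: "C4 \<ge> 0" "\<And>v. norm (adj D \<cdot> n (poisson v)) \<le> C4 * norm v"
    using adj_compose_bounded[OF dense_Dom_D np] Dom_n_n_Dom_adj[OF poisson_Dom_n] by blast
  have "graph_norm_n D n (poisson v) \<le> (C1 + C3 + C2 + C4) * norm v" for v
    using graph_norm_n_le[of "poisson v"] C1(2)[of v] C2(2)[of v] C3(2)[of v] C4(2)[of v]
    by (simp add: algebra_simps)
  then show ?thesis
    using C1(1) C2(1) C3(1) C4(1) by (intro exI[of _ "C1 + C3 + C2 + C4"]) simp
qed

lemma ran_D_ortho_ker: "x \<in> Dom D \<Longrightarrow> D \<cdot> x \<in> ortho_compl (ker D)"
  using symmetric_cinner[OF D_symmetric] by (force simp: ortho_compl_def ker_def)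

text \<open>For \<open>v = D x\<close> the doubled problem is solved within \<open>Dom D \<times> Dom D\<close> by \<open>(x - P x, 0)\<close>, where \<open>P\<close> is the projection onto
  \<open>ker D\<close>.\<close>

lemma poisson_ran_D:
  assumes x: "x \<in> Dom D"
  shows "poisson (D \<cdot> x) \<in> Dom D"
proof -
  define k where "k = ortho_proj (ker D) x"
  have k: "k \<in> Dom D" "D \<cdot> k = 0"
    using ker_proj_in[of x] by (auto simp: k_def ker_def)
  have xk: "x - k \<in> Dom D" using x k(1) by (rule Dom_D_simps)
  have "ortho_proj (ker D) (D \<cdot> x) = 0"
    using ran_D_ortho_ker[OF x] csubspace_ker_D by (intro ker_proj_eqI) (simp_all add: csubspace_def)
  then have "doubled_solution (D \<cdot> x) = x - k"
    using xk x k ker_proj_ortho[of x] csubspace_ortho_compl[of "ker D"]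
    by (intro doubled_solution_eqI[of _ 0])
      (simp_all add: k_def Dom_D_Dom_dbl Dom_D_simps adj_D_eq op_linear_diff[OF linear_D]
        op_linear_zero[OF linear_adj_D] csubspace_def)
  then show ?thesis
    using xk by (simp add: poisson_eq n_Dom_D)
qed

lemma poisson_ker_D:
  assumes k: "k \<in> ker D"
  shows "poisson k = 0"
proof -
  have "ortho_proj (ker D) k = k"
    using k csubspace_ortho_compl[of "ker D"] by (intro ker_proj_eqI) (simp_all add: csubspace_def)
  then have "doubled_solution k = 0"
    using csubspace_ortho_compl[of "ker D"]
    by (intro doubled_solution_eqI[of 0 0])
      (simp_all add: Dom_D_Dom_dbl Dom_D_simps op_linear_zero[OF linear_adj_D] csubspace_def)
  then show ?thesis
    by (simp add: poisson_eq n_zero)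
qed

lemma gamma_ker_D: "k \<in> ker D \<Longrightarrow> \<gamma> k \<in> ker D"
  by (simp add: ker_def gamma_Dom_D gamma_zero)

lemma gamma_ortho_ker_D: "x \<in> ortho_compl (ker D) \<Longrightarrow> \<gamma> x \<in> ortho_compl (ker D)"
  using gamma_ker_D by (simp add: ortho_compl_def flip: gamma_cinner)

text \<open>If \<open>(\<xi>, \<eta>)\<close> solves the doubled problem for \<open>v\<close>, then \<open>(- \<gamma> \<xi>, \<gamma> \<eta>)\<close> solves it for \<open>\<gamma> v\<close>. The sign is absorbed because \<open>n\<close>
  and \<open>\<gamma>\<close> anticommute.\<close>

lemma poisson_gamma: "poisson (\<gamma> v) = \<gamma> (poisson v)"
proof -
  obtain \<eta> where \<eta>: "(doubled_solution v, \<eta>) \<in> Dom dbl"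
    "doubled_solution v \<in> ortho_compl (ker D)" "\<eta> \<in> ortho_compl (ker D)"
    "adj D \<cdot> doubled_solution v = v - ortho_proj (ker D) v" "adj D \<cdot> \<eta> = 0"
    by (rule doubled_solution)
  define \<xi> where "\<xi> = doubled_solution v"
  have mem: "\<xi> \<in> Dom_n D n" "\<eta> \<in> Dom_n D n" "\<eta> - n (\<gamma> \<xi>) \<in> Dom D"
    using \<eta>(1) by (simp_all add: \<xi>_def mem_Dom_dbl)
  have "\<gamma> (\<eta> - n (\<gamma> \<xi>)) \<in> Dom D"
    using mem(3) by (rule gamma_Dom_D)
  then have "\<gamma> \<eta> - n (\<gamma> (- \<gamma> \<xi>)) \<in> Dom D"
    by (simp add: gamma_diff gamma_n_gamma gamma_neg gamma_gamma n_neg)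
  then have "(- \<gamma> \<xi>, \<gamma> \<eta>) \<in> Dom dbl"
    using mem by (simp add: mem_Dom_dbl gamma_Dom_n Dom_n_simps)
  moreover have "- \<gamma> \<xi> \<in> ortho_compl (ker D)" "\<gamma> \<eta> \<in> ortho_compl (ker D)"
    using \<eta>(2,3) by (simp_all add: \<xi>_def gamma_ortho_ker_D csubspace_neg[OF csubspace_ortho_compl])
  moreover have "ortho_proj (ker D) (\<gamma> v) = \<gamma> (ortho_proj (ker D) v)"
  proof (rule ker_proj_eqI)
    show "\<gamma> (ortho_proj (ker D) v) \<in> ker D"
      by (intro gamma_ker_D ker_proj_in)
    show "\<gamma> v - \<gamma> (ortho_proj (ker D) v) \<in> ortho_compl (ker D)"
      using gamma_ortho_ker_D[OF ker_proj_ortho[of v]] by (simp add: gamma_diff)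
  qed
  then have "adj D \<cdot> (- \<gamma> \<xi>) = \<gamma> v - ortho_proj (ker D) (\<gamma> v)"
    using \<eta>(4) mem(1)
    by (simp add: \<xi>_def[symmetric] op_linear_neg[OF linear_adj_D] adj_gamma gamma_Dom_adj
        Dom_n_Dom_adj gamma_diff)
  moreover have "adj D \<cdot> \<gamma> \<eta> = 0"
    using \<eta>(5) mem(2) by (simp add: adj_gamma Dom_n_Dom_adj gamma_zero)
  ultimately have "doubled_solution (\<gamma> v) = - \<gamma> \<xi>"
    by (rule doubled_solution_eqI)
  then show ?thesis
    by (simp add: poisson_eq n_neg n_gamma \<xi>_def)
qed

end

section \<open>Dual boundary space\<close>

lemma graph_norm_n_eq: "graph_norm_n D n x = norm ((x, adj D \<cdot> x), (n x, adj D \<cdot> n x))"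
  for x :: "'h::complex_hilbert"
  by (simp add: graph_norm_n_def graph_norm_eq norm_Pair)

lemma half_norm_le: "x \<in> Z \<Longrightarrow> half_norm D n Z \<le> graph_norm_n D n x"
  for x :: "'h::complex_hilbert"
  unfolding half_norm_def graph_norm_n_eq by (intro cINF_lower bdd_belowI2[where m = 0]) auto

context clifford_normal
begin

lemma mem_cls: "y \<in> cls D x \<longleftrightarrow> y - x \<in> Dom D"
proof
  assume "y - x \<in> Dom D"
  moreover have "y = x + (y - x)" by simp
  ultimately show "y \<in> cls D x"
    unfolding cls_def by blast
qed (auto simp: cls_def)

lemma cls_eqI:
  assumes "x - y \<in> Dom D"
  shows "cls D x = cls D y"
proof -
  have "z - x \<in> Dom D \<longleftrightarrow> z - y \<in> Dom D" for z
    using Dom_D_simps(2)[of "z - x" "x - y"] Dom_D_simps(3)[of "z - y" "x - y"] assms by auto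
  then show ?thesis
    by (auto simp: mem_cls)
qed

lemma self_mem_cls: "x \<in> cls D x"
  by (simp add: mem_cls Dom_D_simps)

lemma cls_Dom_n: "\<lbrakk>x \<in> Dom_n D n; y \<in> cls D x\<rbrakk> \<Longrightarrow> y \<in> Dom_n D n"
  using Dom_n_simps(2)[of x "y - x"] by (simp add: mem_cls Dom_D_Dom_n)

lemma half_space_iff: "Z \<in> half_space D n \<longleftrightarrow> (\<exists>x\<in>Dom_n D n. Z = cls D x)"
  by (auto simp: half_space_def)

lemma graph_norm_n_scale:
  assumes "x \<in> Dom_n D n"
  shows "graph_norm_n D n (c *\<^sub>C x) = cmod c * graph_norm_n D n x"
proof -
  have "((c *\<^sub>C x, adj D \<cdot> (c *\<^sub>C x)), (n (c *\<^sub>C x), adj D \<cdot> n (c *\<^sub>C x)))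
      = c *\<^sub>C ((x, adj D \<cdot> x), (n x, adj D \<cdot> n x))"
    using assms by (simp add: scaleC_prod_def n_scaleC op_linear_scaleC[OF linear_adj_D] Dom_n_def)
  then show ?thesis
    unfolding graph_norm_n_eq by (simp only: norm_scaleC_hilbert)
qed

lemma half_norm_ge:
  assumes "Z \<in> half_space D n" "\<And>x. \<lbrakk>x \<in> Z; x \<in> Dom_n D n\<rbrakk> \<Longrightarrow> c \<le> graph_norm_n D n x"
  shows "c \<le> half_norm D n Z"
  unfolding half_norm_def
proof (rule cINF_greatest)
  obtain x where x: "x \<in> Dom_n D n" "Z = cls D x"
    using assms(1) by (auto simp: half_space_iff)
  show "Z \<noteq> {}"
    using self_mem_cls[of x] x(2) by blast
  show "c \<le> graph_norm_n D n y" if "y \<in> Z" for y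
    using that assms(2) cls_Dom_n[OF x(1), of y] x(2) by blast
qed

lemma half_norm_nonneg: "Z \<in> half_space D n \<Longrightarrow> 0 \<le> half_norm D n Z"
  by (rule half_norm_ge) (simp_all add: graph_norm_n_eq)

lemma half_norm_scale:
  assumes x: "x \<in> Dom_n D n" and c: "c > 0"
  shows "half_norm D n (cls D (complex_of_real c *\<^sub>C x)) \<le> c * half_norm D n (cls D x)"
proof -
  have "half_norm D n (cls D (complex_of_real c *\<^sub>C x)) / c \<le> half_norm D n (cls D x)"
  proof (rule half_norm_ge)
    show "cls D x \<in> half_space D n"
      using x by (auto simp: half_space_iff)
    fix y assume y: "y \<in> cls D x" "y \<in> Dom_n D n"
    then have "complex_of_real c *\<^sub>C y \<in> cls D (complex_of_real c *\<^sub>C x)"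
      by (simp add: mem_cls Dom_D_simps flip: scaleC_diff_right)
    from half_norm_le[OF this, of D n]
    show "half_norm D n (cls D (complex_of_real c *\<^sub>C x)) / c \<le> graph_norm_n D n y"
      using c y(2) by (simp add: graph_norm_n_scale pos_divide_le_eq mult.commute)
  qed
  then show ?thesis
    using c by (simp add: pos_divide_le_eq mult.commute)
qed

lemma half_norm_zero_le: "half_norm D n (cls D 0) \<le> 0"
  using half_norm_le[OF self_mem_cls[of 0], of D n]
  by (simp add: graph_norm_n_eq n_zero op_linear_zero[OF linear_adj_D] norm_Pair)

lemma
  assumes "f \<in> dual_space D n"
  shows dual_add_cls: "\<lbrakk>x \<in> Dom_n D n; y \<in> Dom_n D n\<rbrakk> \<Longrightarrow> f (cls D (x + y)) = f (cls D x) + f (cls D y)"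
    and dual_scale_cls: "x \<in> Dom_n D n \<Longrightarrow> f (cls D (c *\<^sub>C x)) = c * f (cls D x)"
    and dual_bounded: "\<exists>C. \<forall>Z\<in>half_space D n. cmod (f Z) \<le> C * half_norm D n Z"
    and dual_outside: "Z \<notin> half_space D n \<Longrightarrow> f Z = 0"
  using assms by (simp_all add: dual_space_def)

lemma dual_Dom_D:
  assumes "f \<in> dual_space D n" "x \<in> Dom D"
  shows "f (cls D x) = 0"
proof -
  have "cls D x = cls D (0 *\<^sub>C x)"
    using assms(2) by (intro cls_eqI) (simp add: Dom_D_simps)
  then show ?thesis
    using dual_scale_cls[OF assms(1) Dom_D_Dom_n[OF assms(2)], of 0] by simp
qed

lemma dual_eqI:
  assumes "f \<in> dual_space D n" "g \<in> dual_space D n"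
    and "\<And>x. x \<in> Dom_n D n \<Longrightarrow> f (cls D x) = g (cls D x)"
  shows "f = g"
proof
  fix Z show "f Z = g Z"
    using assms dual_outside[OF assms(1), of Z] dual_outside[OF assms(2), of Z]
    by (cases "Z \<in> half_space D n") (auto simp: half_space_iff)
qed

lemma dual_norm_le:
  assumes "0 \<le> K" "\<And>Z. Z \<in> half_space D n \<Longrightarrow> cmod (f Z) \<le> K * half_norm D n Z"
  shows "dual_norm D n f \<le> K"
  unfolding dual_norm_def
proof (rule cSUP_least)
  have "cls D 0 \<in> half_space D n"
    using Dom_n_simps(1) by (auto simp: half_space_iff)
  then show "{Z \<in> half_space D n. half_norm D n Z \<le> 1} \<noteq> {}"
    using half_norm_zero_le by (metis (mono_tags, lifting) empty_iff le_numeral_extra(1) mem_Collect_eq order_trans)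
  fix Z assume "Z \<in> {Z \<in> half_space D n. half_norm D n Z \<le> 1}"
  then show "cmod (f Z) \<le> K"
    using assms(2)[of Z] mult_left_mono[of "half_norm D n Z" 1 K] assms(1) by simp
qed

lemma dual_norm_upper:
  assumes f: "f \<in> dual_space D n" and Z: "Z \<in> half_space D n" "half_norm D n Z \<le> 1"
  shows "cmod (f Z) \<le> dual_norm D n f"
  unfolding dual_norm_def
proof (rule cSUP_upper)
  obtain C where C: "\<And>Z. Z \<in> half_space D n \<Longrightarrow> cmod (f Z) \<le> C * half_norm D n Z"
    using dual_bounded[OF f] by blast
  have "cmod (f Z) \<le> \<bar>C\<bar>" if "Z \<in> half_space D n" "half_norm D n Z \<le> 1" for Z
  proof -
    have "C * half_norm D n Z \<le> \<bar>C\<bar> * half_norm D n Z"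
      using half_norm_nonneg[OF that(1)] by (intro mult_right_mono) auto
    also have "\<dots> \<le> \<bar>C\<bar> * 1"
      using that(2) by (intro mult_left_mono) auto
    finally show ?thesis
      using C[OF that(1)] by simp
  qed
  then show "bdd_above ((\<lambda>Z. cmod (f Z)) ` {Z \<in> half_space D n. half_norm D n Z \<le> 1})"
    by (intro bdd_aboveI2[where M = "\<bar>C\<bar>"]) auto
qed (use Z in auto)

lemma dual_norm_nonneg:
  assumes "f \<in> dual_space D n"
  shows "0 \<le> dual_norm D n f"
proof -
  have "cls D 0 \<in> half_space D n"
    using Dom_n_simps(1) by (auto simp: half_space_iff)
  from dual_norm_upper[OF assms this] show ?thesis
    using half_norm_zero_le norm_ge_zero[of "f (cls D 0)"] by linarith
qed

text \<open>The class \<open>Z\<close> is scaled into the unit ball by \<open>1 / s\<close>, with \<open>s\<close> slightly larger than its norm, since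
  nothing excludes a class of norm zero at this point.\<close>

lemma dual_norm_bound:
  assumes f: "f \<in> dual_space D n" and Z: "Z \<in> half_space D n"
  shows "cmod (f Z) \<le> dual_norm D n f * half_norm D n Z"
proof (rule field_le_epsilon)
  fix \<epsilon> :: real assume \<epsilon>: "0 < \<epsilon>"
  define N where "N = dual_norm D n f"
  have N: "N \<ge> 0" unfolding N_def using f by (rule dual_norm_nonneg)
  obtain x where x: "x \<in> Dom_n D n" "Z = cls D x"
    using Z by (auto simp: half_space_iff)
  \<comment> \<open>the excess over the norm of \<open>Z\<close> costs at most \<open>\<epsilon>\<close> after multiplication by \<open>N\<close>\<close>
  define s where "s = half_norm D n Z + \<epsilon> / (N + 1)"
  have hn: "0 \<le> half_norm D n Z" using Z by (rule half_norm_nonneg)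
  have s: "s > 0" using hn \<epsilon> N by (simp add: s_def add_nonneg_pos)
  define Z' where "Z' = cls D (complex_of_real (1 / s) *\<^sub>C x)"
  have "half_norm D n Z' \<le> (1 / s) * half_norm D n Z"
    unfolding Z'_def x(2) using x(1) s by (intro half_norm_scale) auto
  also have "\<dots> \<le> 1"
    using s \<epsilon> N by (simp add: s_def)
  finally have "half_norm D n Z' \<le> 1" .
  moreover have "Z' \<in> half_space D n"
    unfolding Z'_def half_space_def using x(1) by (intro imageI Dom_n_simps)
  ultimately have "cmod (f Z') \<le> N"
    unfolding N_def using f by (intro dual_norm_upper)
  moreover have "cmod (f Z') = cmod (f Z) / s"
    using dual_scale_cls[OF f x(1), of "complex_of_real (1 / s)"] s x(2)
    by (simp add: Z'_def norm_divide)
  ultimately have "cmod (f Z) \<le> N * s"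
    using s by (simp add: pos_divide_le_eq)
  also have "N * s = N * half_norm D n Z + N * (\<epsilon> / (N + 1))"
    by (simp add: s_def distrib_left)
  also have "N * (\<epsilon> / (N + 1)) \<le> \<epsilon>"
    using N \<epsilon> by (simp add: pos_divide_le_eq algebra_simps)
  finally show "cmod (f Z) \<le> dual_norm D n f * half_norm D n Z + \<epsilon>"
    by (simp add: N_def)
qed

lemma dual_norm_zero_imp:
  assumes "f \<in> dual_space D n" "dual_norm D n f \<le> 0"
  shows "f Z = 0"
proof (cases "Z \<in> half_space D n")
  case True
  then have "cmod (f Z) \<le> 0"
    using order_trans[OF dual_norm_bound[OF assms(1) True]
        mult_right_mono[OF assms(2) half_norm_nonneg[OF True]]] by simp
  then show ?thesis by simp
qed (use dual_outside[OF assms(1)] in auto)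

lemma dual_spaceI:
  assumes "\<And>x y. \<lbrakk>x \<in> Dom_n D n; y \<in> Dom_n D n\<rbrakk> \<Longrightarrow> f (cls D (x + y)) = f (cls D x) + f (cls D y)"
    and "\<And>c x. x \<in> Dom_n D n \<Longrightarrow> f (cls D (c *\<^sub>C x)) = c * f (cls D x)"
    and "\<And>Z. Z \<in> half_space D n \<Longrightarrow> cmod (f Z) \<le> C * half_norm D n Z"
    and "\<And>Z. Z \<notin> half_space D n \<Longrightarrow> f Z = 0"
  shows "f \<in> dual_space D n"
  unfolding dual_space_def using assms by blast

lemma dual_add_closed:
  assumes f: "f \<in> dual_space D n" and g: "g \<in> dual_space D n"
  shows "dual_add f g \<in> dual_space D n"
proof (rule dual_spaceI)
  show "cmod (dual_add f g Z) \<le> (dual_norm D n f + dual_norm D n g) * half_norm D n Z"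
    if "Z \<in> half_space D n" for Z
    using dual_norm_bound[OF f that] dual_norm_bound[OF g that] norm_triangle_ineq[of "f Z" "g Z"]
    by (simp add: dual_add_def distrib_right)
qed (simp_all add: dual_add_def dual_add_cls[OF f] dual_add_cls[OF g] dual_scale_cls[OF f]
      dual_scale_cls[OF g] dual_outside[OF f] dual_outside[OF g] distrib_left)

lemma dual_scale_closed:
  assumes f: "f \<in> dual_space D n"
  shows "dual_scale c f \<in> dual_space D n"
proof (rule dual_spaceI)
  show "cmod (dual_scale c f Z) \<le> (cmod c * dual_norm D n f) * half_norm D n Z"
    if "Z \<in> half_space D n" for Z
    using mult_left_mono[OF dual_norm_bound[OF f that], of "cmod c"]
    by (simp add: dual_scale_def norm_mult mult.assoc)
qed (simp_all add: dual_scale_def dual_add_cls[OF f] dual_scale_cls[OF f] dual_outside[OF f] distrib_left)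

lemma gamma_image_cls: "\<gamma> ` cls D x = cls D (\<gamma> x)"
proof
  show "\<gamma> ` cls D x \<subseteq> cls D (\<gamma> x)"
    by (auto simp: mem_cls gamma_Dom_D_iff simp flip: gamma_diff)
  show "cls D (\<gamma> x) \<subseteq> \<gamma> ` cls D x"
  proof
    fix y assume "y \<in> cls D (\<gamma> x)"
    then have "\<gamma> (y - \<gamma> x) \<in> Dom D"
      by (simp add: mem_cls gamma_Dom_D)
    then have "\<gamma> y \<in> cls D x"
      by (simp add: mem_cls gamma_diff gamma_gamma)
    then show "y \<in> \<gamma> ` cls D x"
      by (metis gamma_gamma image_eqI)
  qed
qed

lemmas norm_gamma = norm_symmetric_involution[of \<gamma>, OF gamma_gamma gamma_cinner]

lemma graph_norm_n_gamma: "x \<in> Dom_n D n \<Longrightarrow> graph_norm_n D n (\<gamma> x) = graph_norm_n D n x"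
  by (simp add: graph_norm_n_def graph_norm_def n_gamma norm_gamma adj_gamma Dom_n_def
      op_linear_neg[OF linear_adj_D] gamma_Dom_adj)

lemma dual_grading_cls: "dual_grading \<gamma> f (cls D x) = f (cls D (\<gamma> x))"
  by (simp add: dual_grading_def gamma_image_cls)

lemma dual_grading_closed:
  assumes f: "f \<in> dual_space D n"
  shows "dual_grading \<gamma> f \<in> dual_space D n"
proof (rule dual_spaceI)
  show "dual_grading \<gamma> f (cls D (x + y)) = dual_grading \<gamma> f (cls D x) + dual_grading \<gamma> f (cls D y)"
    if "x \<in> Dom_n D n" "y \<in> Dom_n D n" for x y
    using that by (simp add: dual_grading_cls gamma_add dual_add_cls[OF f] gamma_Dom_n)
  show "dual_grading \<gamma> f (cls D (c *\<^sub>C x)) = c * dual_grading \<gamma> f (cls D x)"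
    if "x \<in> Dom_n D n" for x c
    using that by (simp add: dual_grading_cls gamma_scaleC dual_scale_cls[OF f] gamma_Dom_n)
  show "dual_grading \<gamma> f Z = 0" if "Z \<notin> half_space D n" for Z
  proof -
    have "\<gamma> ` Z \<notin> half_space D n"
    proof
      assume "\<gamma> ` Z \<in> half_space D n"
      then obtain x where x: "x \<in> Dom_n D n" "\<gamma> ` Z = cls D x"
        by (auto simp: half_space_iff)
      then have "\<gamma> ` \<gamma> ` Z = cls D (\<gamma> x)"
        by (simp add: gamma_image_cls)
      then have "Z = cls D (\<gamma> x)"
        by (simp add: image_image gamma_gamma)
      then show False
        using that gamma_Dom_n[OF x(1)] by (auto simp: half_space_iff)
    qed
    then show ?thesis
      by (simp add: dual_grading_def dual_outside[OF f])
  qed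
  show "cmod (dual_grading \<gamma> f Z) \<le> dual_norm D n f * half_norm D n Z"
    if Z: "Z \<in> half_space D n" for Z
  proof -
    obtain x where x: "x \<in> Dom_n D n" "Z = cls D x"
      using Z by (auto simp: half_space_iff)
    have Z': "\<gamma> ` Z \<in> half_space D n"
      using x gamma_Dom_n[OF x(1)] by (auto simp: half_space_iff gamma_image_cls)
    have "half_norm D n (\<gamma> ` Z) \<le> half_norm D n Z"
      using Z
    proof (rule half_norm_ge)
      fix y assume "y \<in> Z" "y \<in> Dom_n D n"
      then show "half_norm D n (\<gamma> ` Z) \<le> graph_norm_n D n y"
        using half_norm_le[of "\<gamma> y" "\<gamma> ` Z" D n] by (simp add: graph_norm_n_gamma)
    qed
    then have "dual_norm D n f * half_norm D n (\<gamma> ` Z) \<le> dual_norm D n f * half_norm D n Z"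
      by (intro mult_left_mono dual_norm_nonneg f)
    then show ?thesis
      using dual_norm_bound[OF f Z'] by (simp add: dual_grading_def)
  qed
qed

text \<open>The form \<open>\<omega>\<close> vanishes if one argument lies in \<open>Dom D\<close>, so that its values depend on classes only.\<close>

lemma pairing_n_cls:
  assumes x: "x \<in> Dom (adj D)" and y: "y \<in> Dom_n D n"
  shows "pairing_n D n (cls D x) (cls D y) = \<omega> D x (n y)"
proof -
  have *: "\<omega> D \<xi> (n \<eta>) = \<omega> D x (n y)" if "\<xi> \<in> cls D x" "\<eta> \<in> cls D y" for \<xi> \<eta>
  proof (rule omega_cong)
    show "\<xi> - x \<in> Dom D" using that(1) by (simp add: mem_cls)
    show "n \<eta> - n y \<in> Dom D"
      using n_Dom_D[of "\<eta> - y"] that(2) by (simp add: mem_cls n_diff)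
  qed (use x y in \<open>simp_all add: Dom_n_def\<close>)
  show ?thesis
    unfolding pairing_n_def
  proof (rule the_equality)
    show "\<forall>\<xi>\<in>cls D x. \<forall>\<eta>\<in>cls D y. \<omega> D x (n y) = \<omega> D \<xi> (n \<eta>)"
      using * by simp
    show "c = \<omega> D x (n y)" if "\<forall>\<xi>\<in>cls D x. \<forall>\<eta>\<in>cls D y. c = \<omega> D \<xi> (n \<eta>)" for c
      using that self_mem_cls by blast
  qed
qed

lemma R_map_cls:
  "\<lbrakk>x \<in> Dom (adj D); y \<in> Dom_n D n\<rbrakk> \<Longrightarrow> R_map D n x (cls D y) = \<omega> D x (n y)"
  by (auto simp: R_map_def check_to_dual_def half_space_iff pairing_n_cls)

text \<open>The boundary form is the inner product of \<open>(x, D* x)\<close> with the rotated graph vector \<open>(D* y, - y)\<close>.\<close>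

lemma cmod_omega_le: "cmod (\<omega> D x y) \<le> graph_norm (adj D) x * graph_norm (adj D) y"
proof -
  have "\<omega> D x y = cinner (x, adj D \<cdot> x) (adj D \<cdot> y, - y)"
    by (simp add: \<omega>_def cinner_prod_def)
  moreover have "norm (adj D \<cdot> y, - y) = norm (y, adj D \<cdot> y)"
    by (simp add: norm_Pair add.commute)
  ultimately show ?thesis
    using cmod_cinner_le[of "(x, adj D \<cdot> x)" "(adj D \<cdot> y, - y)"] by (simp add: graph_norm_eq)
qed

lemma R_map_bound:
  assumes x: "x \<in> Dom (adj D)" and Z: "Z \<in> half_space D n"
  shows "cmod (R_map D n x Z) \<le> graph_norm (adj D) x * half_norm D n Z"
proof (cases "graph_norm (adj D) x = 0")
  case True
  then show ?thesis
    using Z x cmod_omega_le[of x] by (auto simp: half_space_iff R_map_cls)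
next
  case False
  then have pos: "graph_norm (adj D) x > 0"
    by (simp add: graph_norm_eq)
  have "cmod (R_map D n x Z) / graph_norm (adj D) x \<le> half_norm D n Z"
    using Z
  proof (rule half_norm_ge)
    fix y assume y: "y \<in> Z" "y \<in> Dom_n D n"
    obtain z where z: "z \<in> Dom_n D n" "Z = cls D z"
      using Z by (auto simp: half_space_iff)
    then have "Z = cls D y"
      using y(1) cls_eqI[of y z] by (simp add: mem_cls)
    then have "cmod (R_map D n x Z) \<le> graph_norm (adj D) x * graph_norm (adj D) (n y)"
      using cmod_omega_le[of x "n y"] by (simp add: R_map_cls[OF x y(2)])
    also have "graph_norm (adj D) (n y) \<le> graph_norm_n D n y"
      by (simp add: graph_norm_n_eq graph_norm_eq norm_snd_le)
    finally show "cmod (R_map D n x Z) / graph_norm (adj D) x \<le> graph_norm_n D n y"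
      using pos by (simp add: pos_divide_le_eq mult.commute mult_left_mono)
  qed
  then show ?thesis
    using pos by (simp add: pos_divide_le_eq mult.commute)
qed

lemma R_map_dual:
  assumes x: "x \<in> Dom (adj D)"
  shows "R_map D n x \<in> dual_space D n"
proof (rule dual_spaceI[OF _ _ R_map_bound[OF x]])
  show "R_map D n x Z = 0" if "Z \<notin> half_space D n" for Z
    using that by (simp add: R_map_def check_to_dual_def)
qed (simp_all add: R_map_cls[OF x] Dom_n_simps n_add n_scaleC omega_add_right omega_scale_right Dom_n_n_Dom_adj)

lemma R_map_add:
  "\<lbrakk>x \<in> Dom (adj D); y \<in> Dom (adj D)\<rbrakk> \<Longrightarrow> R_map D n (x + y) = dual_add (R_map D n x) (R_map D n y)"
  by (rule dual_eqI[OF R_map_dual dual_add_closed[OF R_map_dual R_map_dual]])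
    (simp_all add: Dom_adj_simps dual_add_def R_map_cls omega_add_left)

lemma R_map_scale:
  "x \<in> Dom (adj D) \<Longrightarrow> R_map D n (c *\<^sub>C x) = dual_scale c (R_map D n x)"
  by (rule dual_eqI[OF R_map_dual dual_scale_closed[OF R_map_dual]])
    (simp_all add: Dom_adj_simps dual_scale_def R_map_cls omega_scale_left)

lemma R_map_gamma:
  assumes x: "x \<in> Dom (adj D)"
  shows "R_map D n (\<gamma> x) = dual_grading \<gamma> (R_map D n x)"
proof (rule dual_eqI)
  show "R_map D n (\<gamma> x) (cls D y) = dual_grading \<gamma> (R_map D n x) (cls D y)" if y: "y \<in> Dom_n D n" for y
    using x y by (simp add: dual_grading_cls R_map_cls gamma_Dom_adj gamma_Dom_n omega_gamma_left
        Dom_n_n_Dom_adj n_gamma omega_neg_right)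
qed (simp_all add: x R_map_dual dual_grading_closed gamma_Dom_adj)

lemma R_map_cong: "x - y \<in> Dom D \<Longrightarrow> R_map D n x = R_map D n y"
  by (simp add: R_map_def cls_eqI[of x y])

lemma dual_norm_R_map_le: "x \<in> Dom (adj D) \<Longrightarrow> dual_norm D n (R_map D n x) \<le> graph_norm (adj D) x"
  by (rule dual_norm_le[OF _ R_map_bound]) (simp_all add: graph_norm_def)

end

section \<open>Invariance under equivalence of Clifford normals\<close>

context clifford_normal
begin

lemma normal_equiv_sym:
  assumes "normal_equiv D n n'"
  shows "normal_equiv D n' n"
proof -
  obtain C where C: "\<And>\<xi>. \<xi> \<in> Dom (adj D) \<Longrightarrow> graph_norm D (n \<xi> - n' \<xi>) \<le> C * graph_norm (adj D) \<xi>"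
    and D: "\<And>\<xi>. \<xi> \<in> Dom (adj D) \<Longrightarrow> n \<xi> - n' \<xi> \<in> Dom D"
    using assms by (auto simp: normal_equiv_def)
  have "n' \<xi> - n \<xi> \<in> Dom D \<and> graph_norm D (n' \<xi> - n \<xi>) \<le> C * graph_norm (adj D) \<xi>"
    if "\<xi> \<in> Dom (adj D)" for \<xi>
  proof -
    have "graph_norm D (- (n \<xi> - n' \<xi>)) = graph_norm D (n \<xi> - n' \<xi>)"
      by (simp only: graph_norm_def op_linear_neg[OF linear_D D[OF that]] norm_minus_cancel)
    then show ?thesis
      using C[OF that] Dom_D_simps(4)[OF D[OF that]] by simp
  qed
  then show ?thesis
    by (auto simp: normal_equiv_def)
qed

lemma
  assumes "normal_equiv D n n'"
  shows Dom_n_equiv: "Dom_n D n' = Dom_n D n"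
    and half_norm_equiv: "\<exists>a>0. \<forall>Z\<in>half_space D n. half_norm D n' Z \<le> a * half_norm D n Z"
proof -
  obtain C where C: "\<And>\<xi>. \<xi> \<in> Dom (adj D) \<Longrightarrow> graph_norm D (n \<xi> - n' \<xi>) \<le> C * graph_norm (adj D) \<xi>"
    and D: "\<And>\<xi>. \<xi> \<in> Dom (adj D) \<Longrightarrow> n \<xi> - n' \<xi> \<in> Dom D"
    using assms by (auto simp: normal_equiv_def)
  have "n' \<xi> \<in> Dom (adj D) \<longleftrightarrow> n \<xi> \<in> Dom (adj D)" if "\<xi> \<in> Dom (adj D)" for \<xi>
    using Dom_adj_simps(2)[of "n' \<xi>" "n \<xi> - n' \<xi>"] Dom_adj_simps(3)[of "n \<xi>" "n \<xi> - n' \<xi>"]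
      Dom_D_adj[OF D[OF that]] by auto
  then show "Dom_n D n' = Dom_n D n"
    by (auto simp: Dom_n_def)
  define a where "a = \<bar>C\<bar> + 2"
  have a: "a > 0" by (simp add: a_def add_nonneg_pos)
  have le: "graph_norm_n D n' x \<le> a * graph_norm_n D n x" if x: "x \<in> Dom_n D n" for x
  proof -
    define g where "g = graph_norm_n D n x"
    define d where "d = n x - n' x"
    have x': "x \<in> Dom (adj D)" "n x \<in> Dom (adj D)" using x by (simp_all add: Dom_n_def)
    have d: "d \<in> Dom D" unfolding d_def using D[OF x'(1)] .
    have g: "norm (x, adj D \<cdot> x) \<le> g" "norm (n x, adj D \<cdot> n x) \<le> g"
      unfolding g_def graph_norm_n_eq by (rule norm_fst_le, rule norm_snd_le)
    have "n' x = n x - d" by (simp add: d_def)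
    then have eq: "(n' x, adj D \<cdot> n' x) = (n x, adj D \<cdot> n x) - (d, D \<cdot> d)"
      using x'(2) d by (simp add: op_linear_diff[OF linear_adj_D] Dom_D_adj adj_D_eq)
    have "norm (n' x, adj D \<cdot> n' x) \<le> norm (n x, adj D \<cdot> n x) + norm (d, D \<cdot> d)"
      unfolding eq by (rule norm_triangle_ineq4)
    also note g(2)
    also have "norm (d, D \<cdot> d) \<le> C * norm (x, adj D \<cdot> x)"
      using C[OF x'(1)] by (simp add: graph_norm_eq d_def)
    also have "C * norm (x, adj D \<cdot> x) \<le> \<bar>C\<bar> * g"
      using g(1) by (intro mult_mono) auto
    finally have "norm (n' x, adj D \<cdot> n' x) \<le> g + \<bar>C\<bar> * g" by simp
    then have "graph_norm_n D n' x \<le> g + (g + \<bar>C\<bar> * g)"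
      unfolding graph_norm_n_eq
      using norm_Pair_le[of "(x, adj D \<cdot> x)" "(n' x, adj D \<cdot> n' x)"] g(1) by linarith
    then show ?thesis
      by (simp add: a_def g_def algebra_simps)
  qed
  have "half_norm D n' Z \<le> a * half_norm D n Z" if Z: "Z \<in> half_space D n" for Z
  proof -
    have "half_norm D n' Z / a \<le> half_norm D n Z"
      using Z
    proof (rule half_norm_ge)
      fix x assume x: "x \<in> Z" "x \<in> Dom_n D n"
      show "half_norm D n' Z / a \<le> graph_norm_n D n x"
        using half_norm_le[OF x(1), of D n'] le[OF x(2)] a by (simp add: pos_divide_le_eq mult.commute)
    qed
    then show ?thesis
      using a by (simp add: pos_divide_le_eq mult.commute)
  qed
  with a show "\<exists>a>0. \<forall>Z\<in>half_space D n. half_norm D n' Z \<le> a * half_norm D n Z"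
    by blast
qed

text \<open>Equivalent normals differ by a map into \<open>Dom D\<close>, which does not change the boundary condition.\<close>

lemma double_op_equiv:
  assumes "normal_equiv D n n'"
  shows "double_op D \<gamma> n' = double_op D \<gamma> n"
proof -
  have "\<eta> - n' (\<gamma> \<xi>) \<in> Dom D \<longleftrightarrow> \<eta> - n (\<gamma> \<xi>) \<in> Dom D" if "\<xi> \<in> Dom_n D n" for \<xi> \<eta>
  proof -
    have "n (\<gamma> \<xi>) - n' (\<gamma> \<xi>) \<in> Dom D"
      using assms that by (simp add: normal_equiv_def gamma_Dom_adj Dom_n_Dom_adj)
    from Dom_D_simps(2)[OF _ this, of "\<eta> - n (\<gamma> \<xi>)"] Dom_D_simps(3)[OF _ this, of "\<eta> - n' (\<gamma> \<xi>)"]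
    show ?thesis by auto
  qed
  then have "{(\<xi>, \<eta>). \<xi> \<in> Dom_n D n \<and> \<eta> \<in> Dom_n D n \<and> \<eta> - n' (\<gamma> \<xi>) \<in> Dom D}
      = {(\<xi>, \<eta>). \<xi> \<in> Dom_n D n \<and> \<eta> \<in> Dom_n D n \<and> \<eta> - n (\<gamma> \<xi>) \<in> Dom D}"
    by blast
  then show ?thesis
    by (simp only: double_op_def Dom_n_equiv[OF assms])
qed

lemma dual_space_equiv_subset:
  assumes n': "clifford_normal \<alpha> J \<J> \<A> \<pi> \<gamma> D n'" and eq: "normal_equiv D n n'"
  shows "dual_space D n \<subseteq> dual_space D n'"
    and "\<exists>a>0. \<forall>f\<in>dual_space D n. dual_norm D n' f \<le> a * dual_norm D n f"
proof -
  interpret N': clifford_normal \<alpha> J \<J> \<A> \<pi> \<gamma> D n' by fact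
  have eq': "normal_equiv D n' n" using eq by (rule normal_equiv_sym)
  have half: "half_space D n' = half_space D n"
    by (simp add: half_space_def Dom_n_equiv[OF eq])
  obtain a where a: "a > 0" "\<And>Z. Z \<in> half_space D n \<Longrightarrow> half_norm D n Z \<le> a * half_norm D n' Z"
    using N'.half_norm_equiv[OF eq'] by (auto simp: half)
  have bound: "cmod (f Z) \<le> (a * dual_norm D n f) * half_norm D n' Z"
    if f: "f \<in> dual_space D n" and Z: "Z \<in> half_space D n" for f Z
  proof -
    have "cmod (f Z) \<le> dual_norm D n f * half_norm D n Z"
      using f Z by (rule dual_norm_bound)
    also have "\<dots> \<le> dual_norm D n f * (a * half_norm D n' Z)"
      using a(2)[OF Z] dual_norm_nonneg[OF f] by (rule mult_left_mono)
    finally show ?thesis by (simp add: mult_ac)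
  qed
  show "dual_space D n \<subseteq> dual_space D n'"
  proof
    fix f assume f: "f \<in> dual_space D n"
    show "f \<in> dual_space D n'"
      by (rule N'.dual_spaceI[OF _ _ bound[OF f]])
        (use f in \<open>simp_all add: half Dom_n_equiv[OF eq] dual_add_cls dual_scale_cls dual_outside\<close>)
  qed
  have "dual_norm D n' f \<le> a * dual_norm D n f" if f: "f \<in> dual_space D n" for f
    using bound[OF f] a(1) dual_norm_nonneg[OF f] by (intro N'.dual_norm_le) (simp_all add: half)
  with a(1) show "\<exists>a>0. \<forall>f\<in>dual_space D n. dual_norm D n' f \<le> a * dual_norm D n f"
    by blast
qed

lemma R_map_equiv:
  assumes n': "clifford_normal \<alpha> J \<J> \<A> \<pi> \<gamma> D n'" and eq: "normal_equiv D n n'"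
    and x: "x \<in> Dom (adj D)"
  shows "R_map D n' x = R_map D n x"
proof -
  interpret N': clifford_normal \<alpha> J \<J> \<A> \<pi> \<gamma> D n' by fact
  have "R_map D n' x \<in> dual_space D n"
    using N'.R_map_dual[OF x] N'.dual_space_equiv_subset(1)[OF _ normal_equiv_sym[OF eq]]
      clifford_normal_axioms by blast
  then show ?thesis
  proof (rule dual_eqI[OF _ R_map_dual[OF x]])
    fix y assume y: "y \<in> Dom_n D n"
    then have "n' y - n y \<in> Dom D"
      using normal_equiv_sym[OF eq] by (simp add: normal_equiv_def Dom_n_def)
    then have "\<omega> D x (n' y) = \<omega> D x (n y)"
      using x y by (intro omega_cong) (simp_all add: Dom_D_simps Dom_n_n_Dom_adj)
    then show "R_map D n' x (cls D y) = R_map D n x (cls D y)"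
      using x y by (simp add: R_map_cls N'.R_map_cls Dom_n_equiv[OF eq])
  qed
qed

end

section \<open>Poisson operator and Calderon projector\<close>

context unital_clifford_normal
begin

abbreviation K :: "('h set \<Rightarrow> complex) \<Rightarrow> 'h" where
  "K \<equiv> poisson_op D \<gamma> n"

lemma poisson_functional_bound:
  "\<exists>C\<ge>0. \<forall>f\<in>dual_space D n. \<forall>v. cmod (f (cls D (poisson v))) \<le> C * dual_norm D n f * norm v"
proof -
  obtain C where C: "C \<ge> 0" "\<And>v. graph_norm_n D n (poisson v) \<le> C * norm v"
    using poisson_bounded by blast
  have "cmod (f (cls D (poisson v))) \<le> C * dual_norm D n f * norm v"
    if f: "f \<in> dual_space D n" for f v
  proof -
    have "cls D (poisson v) \<in> half_space D n"
      using poisson_Dom_n by (auto simp: half_space_iff)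
    from dual_norm_bound[OF f this]
    have "cmod (f (cls D (poisson v))) \<le> dual_norm D n f * half_norm D n (cls D (poisson v))" .
    also have "\<dots> \<le> dual_norm D n f * (C * norm v)"
      using half_norm_le[OF self_mem_cls[of "poisson v"], of D n] C(2)[of v]
      by (intro mult_left_mono dual_norm_nonneg f) linarith
    finally show ?thesis
      by (simp add: mult_ac)
  qed
  with C(1) show ?thesis by blast
qed

lemma poisson_op_unique:
  assumes f: "f \<in> dual_space D n"
  shows "\<exists>!h. \<forall>v. cinner h v = - f (cls D (poisson v))"
proof (rule riesz_representation)
  obtain C where C: "\<And>v. cmod (f (cls D (poisson v))) \<le> C * dual_norm D n f * norm v"
    using poisson_functional_bound f by blast
  have add: "poisson (x + y) = poisson x + poisson y" for x y
    using bounded_clinear_poisson bounded_linear.linear[THEN linear_add] by (auto simp: bounded_clinear_def)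
  have scale: "poisson (c *\<^sub>C x) = c *\<^sub>C poisson x" for c x
    using bounded_clinear_poisson by (simp add: bounded_clinear_def)
  show *: "- f (cls D (poisson (c *\<^sub>C x))) = c * - f (cls D (poisson x))" for c x
    by (simp add: scale dual_scale_cls[OF f] poisson_Dom_n)
  show "bounded_linear (\<lambda>v. - f (cls D (poisson v)))"
  proof (rule bounded_linear_intro[where K = "C * dual_norm D n f"])
    show "- f (cls D (poisson (x + y))) = - f (cls D (poisson x)) + - f (cls D (poisson y))" for x y
      by (simp add: add dual_add_cls[OF f] poisson_Dom_n)
    show "- f (cls D (poisson (r *\<^sub>R x))) = r *\<^sub>R (- f (cls D (poisson x)))" for r x
      using *[of "complex_of_real r" x] by (simp add: scaleC_of_real scaleR_conv_of_real)
    show "cmod (- f (cls D (poisson x))) \<le> norm x * (C * dual_norm D n f)" for x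
      using C[of x] by (simp add: mult_ac)
  qed
qed

lemma poisson_op_cinner:
  "f \<in> dual_space D n \<Longrightarrow> cinner (K f) v = - f (cls D (poisson v))"
  using theI'[OF poisson_op_unique, of f] by (simp add: poisson_op_def)

lemma poisson_op_eqI:
  assumes "f \<in> dual_space D n" "\<And>v. cinner h v = - f (cls D (poisson v))"
  shows "K f = h"
  by (rule cinner_eqI) (simp add: assms poisson_op_cinner)

lemma poisson_op_add:
  "\<lbrakk>f \<in> dual_space D n; g \<in> dual_space D n\<rbrakk> \<Longrightarrow> K (dual_add f g) = K f + K g"
  by (rule poisson_op_eqI[OF dual_add_closed])
    (simp_all add: dual_add_def cinner_add_left poisson_op_cinner)

lemma poisson_op_scale: "f \<in> dual_space D n \<Longrightarrow> K (dual_scale c f) = c *\<^sub>C K f"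
  by (rule poisson_op_eqI[OF dual_scale_closed])
    (simp_all add: dual_scale_def cinner_scaleC_left poisson_op_cinner)

lemma poisson_op_grading: "f \<in> dual_space D n \<Longrightarrow> K (dual_grading \<gamma> f) = \<gamma> (K f)"
  by (rule poisson_op_eqI)
    (simp_all add: dual_grading_closed dual_grading_cls gamma_cinner poisson_op_cinner poisson_gamma)

lemma poisson_op_bounded: "\<exists>C\<ge>0. \<forall>f\<in>dual_space D n. norm (K f) \<le> C * dual_norm D n f"
proof -
  obtain C where C: "C \<ge> 0"
    "\<And>f v. f \<in> dual_space D n \<Longrightarrow> cmod (f (cls D (poisson v))) \<le> C * dual_norm D n f * norm v"
    using poisson_functional_bound by blast
  have "norm (K f) \<le> C * dual_norm D n f" if f: "f \<in> dual_space D n" for f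
    using C(1) C(2)[OF f] dual_norm_nonneg[OF f]
    by (intro norm_le_of_dense[of UNIV]) (simp_all add: poisson_op_cinner[OF f])
  with C(1) show ?thesis by blast
qed

text \<open>The functional \<open>v \<mapsto> f [poisson v]\<close> vanishes on the range of \<open>D\<close> and on \<open>ker D\<close>, because \<open>poisson v\<close> lies
  in \<open>Dom D\<close> there.\<close>

lemma poisson_op_range:
  assumes f: "f \<in> dual_space D n"
  shows "K f \<in> ker (adj D) \<inter> ortho_compl (ker D)"
proof
  have "cinner 0 x = cinner (K f) (D \<cdot> x)" if "x \<in> Dom D" for x
    using poisson_ran_D[OF that] by (simp add: poisson_op_cinner[OF f] dual_Dom_D[OF f])
  from adjI[OF dense_Dom_D this] show "K f \<in> ker (adj D)"
    by (simp add: ker_def)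
  have "cinner k (K f) = 0" if "k \<in> ker D" for k
    using poisson_op_cinner[OF f, of k] poisson_ker_D[OF that] dual_Dom_D[OF f Dom_D_simps(1)]
      cinner_commute[of k "K f"] by simp
  then show "K f \<in> ortho_compl (ker D)"
    by (simp add: ortho_compl_def)
qed

text \<open>This is Green's formula, in the form of \<open>pairing_kernel\<close>, for \<open>\<kappa>\<close> and the solution of \<open>D* \<xi> = v - P v\<close>.\<close>

lemma poisson_op_R_map:
  assumes \<kappa>: "\<kappa> \<in> ker (adj D)"
  shows "K (R_map D n \<kappa>) = \<kappa> - ortho_proj (ker D) \<kappa>"
proof (rule poisson_op_eqI)
  have \<kappa>': "\<kappa> \<in> Dom (adj D)" using \<kappa> by (simp add: ker_def)
  then show "R_map D n \<kappa> \<in> dual_space D n" by (rule R_map_dual)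
  fix v
  define P where "P = ortho_proj (ker D)"
  have P: "cinner (P x) (y - P y) = 0" "cinner (x - P x) (P y) = 0" for x y
    using ker_proj_in ker_proj_ortho[of y] ortho_compl_commute[OF ker_proj_ortho ker_proj_in]
    by (simp_all add: P_def ortho_compl_def)
  have "R_map D n \<kappa> (cls D (poisson v)) = \<omega> D \<kappa> (n (n (doubled_solution v)))"
    using R_map_cls[OF \<kappa>' poisson_Dom_n] by (simp add: poisson_eq)
  also have "\<dots> = - cinner \<kappa> (v - P v)"
    using pairing_kernel[OF \<kappa> doubled_solution_Dom_n, of v] by (simp add: adj_doubled_solution P_def)
  also have "cinner \<kappa> (v - P v) = cinner (\<kappa> - P \<kappa>) v"
    using P(1)[of \<kappa> v] P(2)[of \<kappa> v] by (simp add: cinner_diff_left cinner_diff_right)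
  finally show "cinner (\<kappa> - ortho_proj (ker D) \<kappa>) v = - R_map D n \<kappa> (cls D (poisson v))"
    by (simp add: P_def)
qed

lemma poisson_op_image: "K ` dual_space D n = ker (adj D) \<inter> ortho_compl (ker D)"
proof (intro equalityI subsetI)
  fix \<kappa> assume \<kappa>: "\<kappa> \<in> ker (adj D) \<inter> ortho_compl (ker D)"
  have "ortho_proj (ker D) \<kappa> = 0"
    using \<kappa> csubspace_ker_D by (intro ker_proj_eqI) (simp_all add: csubspace_def)
  then have "\<kappa> = K (R_map D n \<kappa>)"
    using poisson_op_R_map[of \<kappa>] \<kappa> by simp
  then show "\<kappa> \<in> K ` dual_space D n"
    using \<kappa> R_map_dual by (auto simp: ker_def)
qed (use poisson_op_range in blast)

abbreviation P\<^sub>C :: "('h set \<Rightarrow> complex) \<Rightarrow> 'h set \<Rightarrow> complex" where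
  "P\<^sub>C \<equiv> calderon_op D \<gamma> n"

lemma poisson_op_Dom_adj: "f \<in> dual_space D n \<Longrightarrow> K f \<in> Dom (adj D)"
  using poisson_op_range by (auto simp: ker_def)

lemma calderon_dual: "f \<in> dual_space D n \<Longrightarrow> P\<^sub>C f \<in> dual_space D n"
  unfolding calderon_op_def by (intro R_map_dual poisson_op_Dom_adj)

text \<open>By Green's formula \<open>K (R \<kappa>)\<close> differs from \<open>\<kappa>\<close> by an element of \<open>ker D\<close>, which \<open>R\<close> kills.\<close>

lemma calderon_R_map:
  assumes "\<kappa> \<in> ker (adj D)"
  shows "P\<^sub>C (R_map D n \<kappa>) = R_map D n \<kappa>"
  unfolding calderon_op_def poisson_op_R_map[OF assms]
  using ker_proj_in[of \<kappa>] by (intro R_map_cong) (simp add: ker_def Dom_D_simps)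

lemma calderon_add:
  "\<lbrakk>f \<in> dual_space D n; g \<in> dual_space D n\<rbrakk> \<Longrightarrow> P\<^sub>C (dual_add f g) = dual_add (P\<^sub>C f) (P\<^sub>C g)"
  by (simp add: calderon_op_def poisson_op_add R_map_add poisson_op_Dom_adj)

lemma calderon_scale: "f \<in> dual_space D n \<Longrightarrow> P\<^sub>C (dual_scale c f) = dual_scale c (P\<^sub>C f)"
  by (simp add: calderon_op_def poisson_op_scale R_map_scale poisson_op_Dom_adj)

lemma calderon_grading: "f \<in> dual_space D n \<Longrightarrow> P\<^sub>C (dual_grading \<gamma> f) = dual_grading \<gamma> (P\<^sub>C f)"
  by (simp add: calderon_op_def poisson_op_grading R_map_gamma poisson_op_Dom_adj)

lemma calderon_bounded: "\<exists>C\<ge>0. \<forall>f\<in>dual_space D n. dual_norm D n (P\<^sub>C f) \<le> C * dual_norm D n f"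
proof -
  obtain C where C: "C \<ge> 0" "\<And>f. f \<in> dual_space D n \<Longrightarrow> norm (K f) \<le> C * dual_norm D n f"
    using poisson_op_bounded by blast
  have "dual_norm D n (P\<^sub>C f) \<le> C * dual_norm D n f" if f: "f \<in> dual_space D n" for f
  proof -
    have "dual_norm D n (P\<^sub>C f) \<le> graph_norm (adj D) (K f)"
      unfolding calderon_op_def by (intro dual_norm_R_map_le poisson_op_Dom_adj f)
    also have "\<dots> = norm (K f)"
      using poisson_op_range[OF f] by (simp add: graph_norm_def ker_def)
    finally show ?thesis using C(2)[OF f] by simp
  qed
  with C(1) show ?thesis by blast
qed

lemma calderon_idempotent: "f \<in> dual_space D n \<Longrightarrow> P\<^sub>C (P\<^sub>C f) = P\<^sub>C f"
  using calderon_R_map[of "K f"] poisson_op_range[of f] by (simp add: calderon_op_def)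

lemma dual_diff:
  assumes "f \<in> dual_space D n" "g \<in> dual_space D n"
  shows "(\<lambda>Z. f Z - g Z) = dual_add f (dual_scale (- 1) g)"
    and "(\<lambda>Z. f Z - g Z) \<in> dual_space D n"
proof -
  show *: "(\<lambda>Z. f Z - g Z) = dual_add f (dual_scale (- 1) g)"
    by (simp add: dual_add_def dual_scale_def)
  show "(\<lambda>Z. f Z - g Z) \<in> dual_space D n"
    unfolding * by (intro dual_add_closed dual_scale_closed assms)
qed

text \<open>The projector fixes \<open>R \<kappa>\<close> for \<open>\<kappa>\<close> in the kernel of the adjoint of \<open>D\<close>. By continuity it fixes every limit of such elements.\<close>

lemma calderon_image: "P\<^sub>C ` dual_space D n = cauchy_space D n"
proof (intro equalityI subsetI)
  fix g assume "g \<in> P\<^sub>C ` dual_space D n"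
  then obtain f where f: "f \<in> dual_space D n" "g = R_map D n (K f)"
    by (auto simp: calderon_op_def)
  have "dual_norm D n (\<lambda>Z. g Z - R_map D n (K f) Z) \<le> 0"
    unfolding f(2) by (rule dual_norm_le) simp_all
  then have "\<forall>\<epsilon>>0. \<exists>\<kappa>\<in>ker (adj D). dual_norm D n (\<lambda>Z. g Z - R_map D n \<kappa> Z) < \<epsilon>"
    using poisson_op_range[OF f(1)] by (intro allI impI bexI[of _ "K f"]) auto
  then show "g \<in> cauchy_space D n"
    unfolding cauchy_space_def using f R_map_dual poisson_op_Dom_adj by blast
next
  fix f assume "f \<in> cauchy_space D n"
  then have f: "f \<in> dual_space D n"
    and approx: "\<And>\<epsilon>. \<epsilon> > 0 \<Longrightarrow> \<exists>\<kappa>\<in>ker (adj D). dual_norm D n (\<lambda>Z. f Z - R_map D n \<kappa> Z) < \<epsilon>"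
    by (auto simp: cauchy_space_def)
  obtain C where C: "C \<ge> 0" "\<And>f. f \<in> dual_space D n \<Longrightarrow> dual_norm D n (P\<^sub>C f) \<le> C * dual_norm D n f"
    using calderon_bounded by blast
  \<comment> \<open>if \<open>f\<close> is within \<open>\<epsilon> / (C + 1)\<close> of some \<open>R \<kappa>\<close>, then \<open>d = (1 - P) (f - R \<kappa>)\<close> has norm at most \<open>\<epsilon>\<close>, where \<open>P\<close> is the Calderon projector\<close>
  define d where "d = (\<lambda>Z. f Z - P\<^sub>C f Z)"
  have d: "d \<in> dual_space D n"
    unfolding d_def by (rule dual_diff(2)[OF f calderon_dual[OF f]])
  have "dual_norm D n d \<le> 0 + \<epsilon>" if \<epsilon>: "\<epsilon> > 0" for \<epsilon>
  proof -
    obtain \<kappa> where \<kappa>: "\<kappa> \<in> ker (adj D)" "dual_norm D n (\<lambda>Z. f Z - R_map D n \<kappa> Z) < \<epsilon> / (C + 1)"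
      using approx[of "\<epsilon> / (C + 1)"] \<epsilon> C(1) by auto
    define g where "g = (\<lambda>Z. f Z - R_map D n \<kappa> Z)"
    have R: "R_map D n \<kappa> \<in> dual_space D n"
      using \<kappa>(1) by (simp add: R_map_dual ker_def)
    have g: "g \<in> dual_space D n"
      unfolding g_def using f R by (rule dual_diff(2))
    have "P\<^sub>C g = (\<lambda>Z. P\<^sub>C f Z - R_map D n \<kappa> Z)"
      unfolding g_def dual_diff(1)[OF f R]
      by (simp add: calderon_add calderon_scale f R dual_scale_closed calderon_R_map[OF \<kappa>(1)])
        (simp add: dual_add_def dual_scale_def)
    then have dZ: "d Z = g Z - P\<^sub>C g Z" for Z
      by (simp add: d_def g_def)
    have "dual_norm D n d \<le> dual_norm D n g + dual_norm D n (P\<^sub>C g)"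
    proof (rule dual_norm_le)
      show "0 \<le> dual_norm D n g + dual_norm D n (P\<^sub>C g)"
        using dual_norm_nonneg[OF g] dual_norm_nonneg[OF calderon_dual[OF g]] by simp
      show "cmod (d Z) \<le> (dual_norm D n g + dual_norm D n (P\<^sub>C g)) * half_norm D n Z"
        if "Z \<in> half_space D n" for Z
        using norm_triangle_ineq4[of "g Z" "P\<^sub>C g Z"] dual_norm_bound[OF g that]
          dual_norm_bound[OF calderon_dual[OF g] that] by (simp add: dZ distrib_right)
    qed
    also have "\<dots> \<le> (C + 1) * dual_norm D n g"
      using C(2)[OF g] by (simp add: distrib_right)
    also have "\<dots> \<le> \<epsilon>"
      using \<kappa>(2) C(1) by (simp add: g_def pos_less_divide_eq add_nonneg_pos mult.commute)
    finally show ?thesis by simp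
  qed
  then have "dual_norm D n d \<le> 0"
    by (rule field_le_epsilon)
  then have "d Z = 0" for Z
    by (rule dual_norm_zero_imp[OF d])
  then have "f = P\<^sub>C f"
    by (intro ext) (simp add: d_def)
  then show "f \<in> P\<^sub>C ` dual_space D n"
    using f by blast
qed

text \<open>The doubled operator and hence the solutions of the doubled problem are the same for both normals. The Poisson
  vectors then differ by elements of \<open>Dom D\<close>, which functionals on the quotient do not see.\<close>

lemma normal_structure_invariance:
  assumes n': "clifford_normal \<alpha> J \<J> \<A> \<pi> \<gamma> D n'" and eq: "normal_equiv D n n'"
  shows "dual_space D n' = dual_space D n"
    and "\<exists>c>0. \<exists>C. \<forall>f\<in>dual_space D n.
          c * dual_norm D n f \<le> dual_norm D n' f \<and> dual_norm D n' f \<le> C * dual_norm D n f"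
    and "f \<in> dual_space D n \<Longrightarrow> poisson_op D \<gamma> n' f = poisson_op D \<gamma> n f"
    and "f \<in> dual_space D n \<Longrightarrow> calderon_op D \<gamma> n' f = calderon_op D \<gamma> n f"
proof -
  interpret N': clifford_normal \<alpha> J \<J> \<A> \<pi> \<gamma> D n' by fact
  have eq': "normal_equiv D n' n" using eq by (rule normal_equiv_sym)
  note sub = dual_space_equiv_subset[OF n' eq]
    N'.dual_space_equiv_subset[OF clifford_normal_axioms eq']
  show dual: "dual_space D n' = dual_space D n"
    using sub(1,3) by blast
  obtain a b where a: "\<And>f. f \<in> dual_space D n \<Longrightarrow> dual_norm D n' f \<le> a * dual_norm D n f"
    and b: "b > 0" "\<And>f. f \<in> dual_space D n \<Longrightarrow> dual_norm D n f \<le> b * dual_norm D n' f"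
    using sub(2,4) unfolding dual by blast
  have "1 / b * dual_norm D n f \<le> dual_norm D n' f" if "f \<in> dual_space D n" for f
    using b(2)[OF that] b(1) by (simp add: pos_divide_le_eq mult.commute)
  then show "\<exists>c>0. \<exists>C. \<forall>f\<in>dual_space D n.
      c * dual_norm D n f \<le> dual_norm D n' f \<and> dual_norm D n' f \<le> C * dual_norm D n f"
    using a b(1) by (intro exI[of _ "1 / b"] conjI exI[of _ a]) auto
  have cls: "cls D (poisson_vector D \<gamma> n' v) = cls D (poisson v)" for v
  proof (rule cls_eqI)
    have "n' (doubled_solution v) - n (doubled_solution v) \<in> Dom D"
      using eq' Dom_n_Dom_adj[OF doubled_solution_Dom_n] by (simp add: normal_equiv_def)
    then show "poisson_vector D \<gamma> n' v - poisson v \<in> Dom D"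
      by (simp add: poisson_vector_def double_op_equiv[OF eq] doubled_solution_def)
  qed
  show K: "poisson_op D \<gamma> n' f = K f" for f
    by (simp add: poisson_op_def cls)
  show "calderon_op D \<gamma> n' f = P\<^sub>C f" if "f \<in> dual_space D n"
    using that by (simp add: calderon_op_def K R_map_equiv[OF n' eq] poisson_op_Dom_adj)
qed

end

theorem proposition4p15:
  fixes \<alpha> :: "'a::cstar_algebra \<Rightarrow> 'a"
    and J \<J> \<A> :: "'a set"
    and \<pi> :: "'a \<Rightarrow> 'h::complex_hilbert \<Rightarrow> 'h"
    and \<gamma> :: "'h \<Rightarrow> 'h"
    and D :: "'h operator"
    and n :: "'h \<Rightarrow> 'h"
  assumes "clifford_normal \<alpha> J \<J> \<A> \<pi> \<gamma> D n"
    and "\<exists>e::'a. \<forall>a. e * a = a \<and> a * e = a"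
    and "nondegenerate \<pi>"
  shows "(\<forall>v. poisson_vector D \<gamma> n v \<in> Dom_n D n) \<and>
    (\<forall>f\<in>dual_space D n. \<exists>!h. \<forall>v. cinner h v = - f (cls D (poisson_vector D \<gamma> n v))) \<and>
    (\<forall>f\<in>dual_space D n. \<forall>g\<in>dual_space D n.
       poisson_op D \<gamma> n (dual_add f g) = poisson_op D \<gamma> n f + poisson_op D \<gamma> n g) \<and>
    (\<forall>c. \<forall>f\<in>dual_space D n. poisson_op D \<gamma> n (dual_scale c f) = c *\<^sub>C poisson_op D \<gamma> n f) \<and>
    (\<exists>C. \<forall>f\<in>dual_space D n. norm (poisson_op D \<gamma> n f) \<le> C * dual_norm D n f) \<and>
    (\<forall>f\<in>dual_space D n. dual_grading \<gamma> f \<in> dual_space D n \<and>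
       poisson_op D \<gamma> n (dual_grading \<gamma> f) = \<gamma> (poisson_op D \<gamma> n f)) \<and>
    (poisson_op D \<gamma> n ` dual_space D n = ker (adj D) \<inter> ortho_compl (ker D)) \<and>
    (calderon_op D \<gamma> n ` dual_space D n \<subseteq> dual_space D n) \<and>
    (\<forall>f\<in>dual_space D n. \<forall>g\<in>dual_space D n.
       calderon_op D \<gamma> n (dual_add f g) = dual_add (calderon_op D \<gamma> n f) (calderon_op D \<gamma> n g)) \<and>
    (\<forall>c. \<forall>f\<in>dual_space D n.
       calderon_op D \<gamma> n (dual_scale c f) = dual_scale c (calderon_op D \<gamma> n f)) \<and>
    (\<exists>C. \<forall>f\<in>dual_space D n. dual_norm D n (calderon_op D \<gamma> n f) \<le> C * dual_norm D n f) \<and>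
    (\<forall>f\<in>dual_space D n.
       calderon_op D \<gamma> n (dual_grading \<gamma> f) = dual_grading \<gamma> (calderon_op D \<gamma> n f)) \<and>
    (\<forall>f\<in>dual_space D n. calderon_op D \<gamma> n (calderon_op D \<gamma> n f) = calderon_op D \<gamma> n f) \<and>
    (calderon_op D \<gamma> n ` dual_space D n = cauchy_space D n) \<and>
    (\<forall>n'. clifford_normal \<alpha> J \<J> \<A> \<pi> \<gamma> D n' \<and> normal_equiv D n n' \<longrightarrow>
       dual_space D n' = dual_space D n \<and>
       (\<exists>c>0. \<exists>C. \<forall>f\<in>dual_space D n.
          c * dual_norm D n f \<le> dual_norm D n' f \<and> dual_norm D n' f \<le> C * dual_norm D n f) \<and>
       (\<forall>f\<in>dual_space D n. poisson_op D \<gamma> n' f = poisson_op D \<gamma> n f \<and>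
          calderon_op D \<gamma> n' f = calderon_op D \<gamma> n f))"
proof -
  interpret unital_clifford_normal \<alpha> J \<J> \<A> \<pi> \<gamma> D n
    using assms by (simp add: unital_clifford_normal_def unital_clifford_normal_axioms_def)
  show ?thesis
  proof (intro conjI)
    show "\<forall>v. poisson_vector D \<gamma> n v \<in> Dom_n D n"
      by (simp add: poisson_Dom_n)
    show "\<forall>f\<in>dual_space D n. \<exists>!h. \<forall>v. cinner h v = - f (cls D (poisson_vector D \<gamma> n v))"
      by (simp add: poisson_op_unique)
    show "\<forall>f\<in>dual_space D n. \<forall>g\<in>dual_space D n.
       poisson_op D \<gamma> n (dual_add f g) = poisson_op D \<gamma> n f + poisson_op D \<gamma> n g"
      by (simp add: poisson_op_add)
    show "\<forall>c. \<forall>f\<in>dual_space D n. poisson_op D \<gamma> n (dual_scale c f) = c *\<^sub>C poisson_op D \<gamma> n f"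
      by (simp add: poisson_op_scale)
    show "\<exists>C. \<forall>f\<in>dual_space D n. norm (poisson_op D \<gamma> n f) \<le> C * dual_norm D n f"
      using poisson_op_bounded by blast
    show "\<forall>f\<in>dual_space D n. dual_grading \<gamma> f \<in> dual_space D n \<and>
       poisson_op D \<gamma> n (dual_grading \<gamma> f) = \<gamma> (poisson_op D \<gamma> n f)"
      by (simp add: dual_grading_closed poisson_op_grading)
    show "poisson_op D \<gamma> n ` dual_space D n = ker (adj D) \<inter> ortho_compl (ker D)"
      by (rule poisson_op_image)
    show "calderon_op D \<gamma> n ` dual_space D n \<subseteq> dual_space D n"
      using calderon_dual by blast
    show "\<forall>f\<in>dual_space D n. \<forall>g\<in>dual_space D n.
       calderon_op D \<gamma> n (dual_add f g) = dual_add (calderon_op D \<gamma> n f) (calderon_op D \<gamma> n g)"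
      by (simp add: calderon_add)
    show "\<forall>c. \<forall>f\<in>dual_space D n.
       calderon_op D \<gamma> n (dual_scale c f) = dual_scale c (calderon_op D \<gamma> n f)"
      by (simp add: calderon_scale)
    show "\<exists>C. \<forall>f\<in>dual_space D n. dual_norm D n (calderon_op D \<gamma> n f) \<le> C * dual_norm D n f"
      using calderon_bounded by blast
    show "\<forall>f\<in>dual_space D n.
       calderon_op D \<gamma> n (dual_grading \<gamma> f) = dual_grading \<gamma> (calderon_op D \<gamma> n f)"
      by (simp add: calderon_grading)
    show "\<forall>f\<in>dual_space D n. calderon_op D \<gamma> n (calderon_op D \<gamma> n f) = calderon_op D \<gamma> n f"
      by (simp add: calderon_idempotent)
    show "calderon_op D \<gamma> n ` dual_space D n = cauchy_space D n"
      by (rule calderon_image)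
    show "\<forall>n'. clifford_normal \<alpha> J \<J> \<A> \<pi> \<gamma> D n' \<and> normal_equiv D n n' \<longrightarrow>
       dual_space D n' = dual_space D n \<and>
       (\<exists>c>0. \<exists>C. \<forall>f\<in>dual_space D n.
          c * dual_norm D n f \<le> dual_norm D n' f \<and> dual_norm D n' f \<le> C * dual_norm D n f) \<and>
       (\<forall>f\<in>dual_space D n. poisson_op D \<gamma> n' f = poisson_op D \<gamma> n f \<and>
          calderon_op D \<gamma> n' f = calderon_op D \<gamma> n f)"
    proof (intro allI impI, elim conjE)
      fix n' assume n': "clifford_normal \<alpha> J \<J> \<A> \<pi> \<gamma> D n'" "normal_equiv D n n'"
      note inv = normal_structure_invariance[OF n']
      show "dual_space D n' = dual_space D n \<and>
        (\<exists>c>0. \<exists>C. \<forall>f\<in>dual_space D n.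
          c * dual_norm D n f \<le> dual_norm D n' f \<and> dual_norm D n' f \<le> C * dual_norm D n f) \<and>
        (\<forall>f\<in>dual_space D n. poisson_op D \<gamma> n' f = poisson_op D \<gamma> n f \<and>
          calderon_op D \<gamma> n' f = calderon_op D \<gamma> n f)"
        using inv(1,2) by (intro conjI ballI inv(3,4)) assumption+
    qed
  qed
qed

end
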